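(* Let $q\in\mathbb{C}^*$ be a fixed parameter, let $H\in M_n(\mathbb{Z})$ be skew-symmetric of rank $r(H)=2N$, and let $m_1\le m_2\le\cdots\le m_N$ be positive integers such that $WHW^T=\mathrm{diag}(m_1S,\dots,m_NS,0,\dots,0)$ for some $W\in\mathrm{GL}_n(\mathbb{Z})$, where $S=\begin{pmatrix}0&1\\-1&0\end{pmatrix}$. Then, as algebras, $$\mathcal{L}_q[H]\cong\mathcal{L}_{q^{m_1}}(2)\otimes\mathcal{L}_{q^{m_2}}(2)\otimes\cdots\otimes\mathcal{L}_{q^{m_N}}(2)\otimes Z,$$ where $Z$ is the centre of $\mathcal{L}_q[H]$, which is a Laurent polynomial algebra in $n-r(H)$ variables with a basis $\{x^\alpha\mid\alpha\in\mathbb{Z}^n,\ H\alpha=0\}$.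
   Context: For a skew-symmetric $H=(h_{ij})\in M_n(\mathbb{Z})$ and $q\in\mathbb{C}^*$, the quasi Laurent polynomial algebra $\mathcal{L}_q[H]$ is the associative unital $\mathbb{C}$-algebra generated by $x_1,\dots,x_n$ and their inverses with defining relations $x_ix_j=q^{h_{ij}}x_jx_i$ for all $i,j$. For $\alpha=(a_1,\dots,a_n)^T\in\mathbb{Z}^n$, write $x^\alpha=x_1^{a_1}x_2^{a_2}\cdots x_n^{a_n}$; these Laurent monomials form a basis of $\mathcal{L}_q[H]$. For $p\in\mathbb{C}^*$, $\mathcal{L}_p(2)=\mathcal{L}_p[S]$ is the algebra generated by $x^{\pm1},y^{\pm1}$ with $xy=p\,yx$. $\mathrm{GL}_n(\mathbb{Z})$ is the group of $n\times n$ integer matrices of determinant $\pm1$. Every skew-symmetric matrix in $M_n(\mathbb{Z})$ can be brought by some $W\in\mathrm{GL}_n(\mathbb{Z})$ into the stated block diagonal form $WHW^T$. Tensor products are over $\mathbb{C}$.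
   Formalization: Z is taken as the span of the x^α with Hα=0; that Z is the centre is claimed only if q is not a root of unity or N=0, since otherwise it is false (q=1, H=S: the centre is the whole algebra). The other claims hold for all nonzero q. *)

theory Defs
  imports
    "HOL-Algebra.Algebra"
    "HOL-Library.Poly_Mapping"
    "Jordan_Normal_Form.DL_Rank"
begin

text \<open>
  A complex algebra is represented by a record of type \<open>(complex, 'a) module\<close>: the ring fields
  carry the (possibly noncommutative) ring structure and \<open>smult\<close> is the scalar multiplication.
  A subalgebra is obtained by restricting the carrier.
\<close>

subsection \<open>Complex algebras\<close>

definition alg_iso ::
    "(complex, 'a, 'm) module_scheme \<Rightarrow> (complex, 'b, 'n) module_scheme \<Rightarrow> bool"
    (infixl \<open>\<cong>\<^sub>a\<^sub>l\<^sub>g\<close> 60) where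
  "A \<cong>\<^sub>a\<^sub>l\<^sub>g B \<longleftrightarrow>
     (\<exists>h \<in> ring_iso A B. \<forall>c. \<forall>x \<in> carrier A. h (c \<odot>\<^bsub>A\<^esub> x) = c \<odot>\<^bsub>B\<^esub> h x)"

definition alg_centre ::
    "(complex, 'a, 'm) module_scheme \<Rightarrow> (complex, 'a, 'm) module_scheme" where
  "alg_centre A =
     A\<lparr>carrier := {z \<in> carrier A. \<forall>a \<in> carrier A. z \<otimes>\<^bsub>A\<^esub> a = a \<otimes>\<^bsub>A\<^esub> z}\<rparr>"

text \<open>Quotient by a two-sided ideal; scalars act on cosets in the same way as
  \<^const>\<open>rcoset_mult\<close> multiplies them.\<close>

definition quot_alg ::
    "(complex, 'a, 'm) module_scheme \<Rightarrow> 'a set \<Rightarrow> (complex, 'a set) module" where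
  "quot_alg A I =
     ring.extend (A Quot I) (module.fields (\<lambda>c Y. \<Union>x\<in>Y. I +>\<^bsub>A\<^esub> (c \<odot>\<^bsub>A\<^esub> x)))"

definition monoid_algebra ::
    "('a, 'm) monoid_scheme \<Rightarrow> (complex, 'a \<Rightarrow>\<^sub>0 complex) module" where
  "monoid_algebra M =
     \<lparr>carrier = {f. Poly_Mapping.keys f \<subseteq> carrier M},
      monoid.mult = (\<lambda>f g. \<Sum>a\<in>Poly_Mapping.keys f. \<Sum>b\<in>Poly_Mapping.keys g.
                Poly_Mapping.single (a \<otimes>\<^bsub>M\<^esub> b)
                  (Poly_Mapping.lookup f a * Poly_Mapping.lookup g b)),
      monoid.one = Poly_Mapping.single \<one>\<^bsub>M\<^esub> 1,
      ring.zero = 0,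
      ring.add = (+),
      module.smult = (\<lambda>c. Poly_Mapping.map ((*) c))\<rparr>"

text \<open>The Laurent polynomial algebra in \<open>k\<close> variables is the group algebra of the lattice of
  exponent vectors.\<close>

definition laurent_algebra :: "nat \<Rightarrow> (complex, int vec \<Rightarrow>\<^sub>0 complex) module" where
  "laurent_algebra k = monoid_algebra (monoid_vec TYPE(int) k)"


subsection \<open>Tensor products\<close>

text \<open>
  The tensor product over the complex numbers of a list of algebras: the free vector space on the
  tuples \<open>[x\<^sub>1, \<dots>, x\<^sub>r]\<close>, with the componentwise product of tuples extended bilinearly, modulo
  the subspace expressing that the pure tensors are additive and homogeneous in each slot. That
  subspace is automatically a two-sided ideal.
\<close>

definition multilinear_relations ::
    "(complex, 'a) module list \<Rightarrow> ('a list \<Rightarrow>\<^sub>0 complex) set" where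
  "multilinear_relations As =
     {Poly_Mapping.single (xs[i := x \<oplus>\<^bsub>As ! i\<^esub> y]) 1
        - Poly_Mapping.single (xs[i := x]) 1 - Poly_Mapping.single (xs[i := y]) 1 | xs i x y.
        xs \<in> carrier (DirProd_list As) \<and> i < length As
        \<and> x \<in> carrier (As ! i) \<and> y \<in> carrier (As ! i)}
   \<union> {Poly_Mapping.single (xs[i := c \<odot>\<^bsub>As ! i\<^esub> x]) 1 - Poly_Mapping.single (xs[i := x]) c
        | xs i c x.
        xs \<in> carrier (DirProd_list As) \<and> i < length As \<and> x \<in> carrier (As ! i)}"

definition tensor_algebra ::
    "(complex, 'a) module list \<Rightarrow> (complex, ('a list \<Rightarrow>\<^sub>0 complex) set) module" where
  "tensor_algebra As =
     (let F = monoid_algebra (DirProd_list As)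
      in quot_alg F (LinearCombinations.module.span class_ring F (multilinear_relations As)))"


subsection \<open>Quasi Laurent polynomial algebras\<close>

datatype letter = Gen nat | GenInv nat

type_synonym free_elem = "letter list \<Rightarrow>\<^sub>0 complex"

definition free_algebra :: "letter set \<Rightarrow> (complex, free_elem) module" where
  "free_algebra G = monoid_algebra \<lparr>carrier = lists G, monoid.mult = (@), monoid.one = []\<rparr>"

abbreviation word :: "letter list \<Rightarrow> free_elem" where
  "word w \<equiv> Poly_Mapping.single w 1"

text \<open>Generators are indexed from 0, and their number is the dimension of \<open>H\<close>.\<close>

definition ql_free :: "int mat \<Rightarrow> (complex, free_elem) module" where
  "ql_free H = free_algebra (Gen ` {..<dim_row H} \<union> GenInv ` {..<dim_row H})"

definition ql_relations :: "complex \<Rightarrow> int mat \<Rightarrow> free_elem set" where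
  "ql_relations q H =
     {word [Gen i, GenInv i] - word [] | i. i < dim_row H}
   \<union> {word [GenInv i, Gen i] - word [] | i. i < dim_row H}
   \<union> {word [Gen i, Gen j] - Poly_Mapping.single [Gen j, Gen i] (q powi (H $$ (i, j))) | i j.
        i < dim_row H \<and> j < dim_row H}"

definition ql_ideal :: "complex \<Rightarrow> int mat \<Rightarrow> free_elem set" where
  "ql_ideal q H = Idl\<^bsub>ql_free H\<^esub> (ql_relations q H)"

definition quasi_laurent ::
    "complex \<Rightarrow> int mat \<Rightarrow> (complex, free_elem set) module" (\<open>\<L>\<close>) where
  "\<L> q H = quot_alg (ql_free H) (ql_ideal q H)"

definition ql_gen :: "complex \<Rightarrow> int mat \<Rightarrow> nat \<Rightarrow> free_elem set" where
  "ql_gen q H i = ql_ideal q H +>\<^bsub>ql_free H\<^esub> word [Gen i]"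

text \<open>The ordered Laurent monomial with exponent vector \<open>\<alpha>\<close>; the exponents are integers, so
  this uses inverses in \<open>\<L> q H\<close>.\<close>

definition ql_monomial :: "complex \<Rightarrow> int mat \<Rightarrow> int vec \<Rightarrow> free_elem set" where
  "ql_monomial q H \<alpha> =
     foldr (\<lambda>i p. (ql_gen q H i [^]\<^bsub>\<L> q H\<^esub> (\<alpha> $ i)) \<otimes>\<^bsub>\<L> q H\<^esub> p)
       [0..<dim_row H] \<one>\<^bsub>\<L> q H\<^esub>"

definition symplectic2 :: "int mat" (\<open>\<S>\<close>) where
  "\<S> = mat_of_rows_list 2 [[0, 1], [-1, 0]]"

definition int_kernel :: "int mat \<Rightarrow> int vec set" where
  "int_kernel H = {\<alpha> \<in> carrier_vec (dim_col H). H *\<^sub>v \<alpha> = 0\<^sub>v (dim_row H)}"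

text \<open>
  The span of the monomials \<open>x\<^sup>\<alpha>\<close> with \<open>H \<alpha> = 0\<close>. It always lies in the centre. It is the
  whole centre if \<open>q\<close> is not a root of unity or \<open>H = 0\<close>; but if \<open>q ^ d = 1\<close> with \<open>d > 0\<close>, then
  every \<open>x\<^sub>i ^ d\<close> is central, so for \<open>H \<noteq> 0\<close> the centre is strictly larger.
\<close>

definition ql_kernel_algebra :: "complex \<Rightarrow> int mat \<Rightarrow> (complex, free_elem set) module" where
  "ql_kernel_algebra q H =
     (\<L> q H)\<lparr>carrier :=
        LinearCombinations.module.span class_ring (\<L> q H) (ql_monomial q H ` int_kernel H)\<rparr>"

end

(*
  All algebras in the statement are twisted monoid algebras: vector spaces on a monoid M
  with product a * b = w(a, b) ab for a 2-cocycle w. The key step says that if the lattice Z^n is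
  identified with M so that the basis vectors e_i, e_j commute in the twisted algebra up to the
  factor q^(h_ij), then x_i |-> e_i is an isomorphism from L_q[H] which sends every Laurent monomial
  to a nonzero multiple of the corresponding basis vector: the monomials span L_q[H] by the
  commutation relations, and their images are linearly independent. Likewise a tensor product of
  twisted algebras is the twisted algebra of the direct product of the monoids, with the product
  cocycle, because modulo the multilinear relations every pure tensor reduces to basis tensors.

  Writing an exponent vector as W^T b turns the form of H into the sum of the forms m_i S on the
  planes (b_{2i}, b_{2i+1}), and the remaining coordinates parametrise the kernel of H, on which all
  commutators are trivial. The key step for Z^n = Z^2 x ... x Z^2 x ker H gives the decomposition;
  for H = 0, applied to both Z^(n-2N) and ker H, it identifies the kernel algebra with a Laurent
  polynomial algebra. An element is central iff each monomial x^a in it is, that is iff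
  q^(b . H a) = 1 for all b.
*)
theory Submission
  imports Defs
begin

section \<open>Finitely supported functions\<close>

text \<open>The presentation of L_q[H] shows only that the monomials span. Their independence and
  the injectivity of the comparison map are obtained together, from one homomorphism into a model
  whose basis vectors are visibly independent. For the same reason the scalars produced by
  reordering a monomial are never computed: it is enough that they are nonzero.

  The cocycle of the model has to be an integral power of q. Half of H would need a square root of
  q, so the strict upper triangle U of H is used, for which U - U^T = H. The price is that on ker H
  the cocycle is symmetric without being 1: the kernel algebra is commutative but not literally a
  group algebra, and it is untwisted by presenting it as L_q[0] on n - 2N generators.

  For tensor products the difficulty is to show that the multilinear relations span the whole kernel
  of the comparison map. A linear section through tuples of basis elements writes every element as a
  normal form plus a combination of relations, so an element of the kernel is a combination of
  relations alone.\<close>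

lemma lookup_map_times [simp]:
  "Poly_Mapping.lookup (Poly_Mapping.map ((*) c) p) a = (c :: complex) * Poly_Mapping.lookup p a"
  by (simp add: Poly_Mapping.map.rep_eq when_def)

lemma map_times_single [simp]:
  "Poly_Mapping.map ((*) (c :: complex)) (Poly_Mapping.single a d) = Poly_Mapping.single a (c * d)"
  by (rule poly_mapping_eqI) (auto simp: lookup_single when_def)

lemma map_times_zero [simp]: "Poly_Mapping.map ((*) (c :: complex)) 0 = 0"
  by (rule poly_mapping_eqI) simp

lemma map_times_add:
  "Poly_Mapping.map ((*) (c :: complex)) (p + r) =
    Poly_Mapping.map ((*) c) p + Poly_Mapping.map ((*) c) r"
  by (rule poly_mapping_eqI) (simp add: lookup_add algebra_simps)

lemma keys_map_times: "Poly_Mapping.keys (Poly_Mapping.map ((*) (c :: complex)) p) \<subseteq> Poly_Mapping.keys p"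
  by (auto simp: in_keys_iff)

text \<open>Supports stay inside \<open>S\<close> in the additive case, so closure facts about
  \<open>S\<close> are available for both summands. Later bilinear identities are reduced to basis
  vectors by this rule.\<close>

lemma poly_mapping_induct_on [consumes 1, case_names zero single add]:
  assumes "Poly_Mapping.keys p \<subseteq> S"
    and "P 0" and single: "\<And>a c. a \<in> S \<Longrightarrow> P (Poly_Mapping.single a c)"
    and add: "\<And>p r. Poly_Mapping.keys p \<subseteq> S \<Longrightarrow> Poly_Mapping.keys r \<subseteq> S \<Longrightarrow> P p \<Longrightarrow> P r \<Longrightarrow> P (p + r)"
  shows "P (p :: 'a \<Rightarrow>\<^sub>0 'b::comm_monoid_add)"
proof -
  \<comment> \<open>The support bound is proved along with \<open>P\<close> because the additive
    case demands it of the partial sum.\<close>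
  have *: "Poly_Mapping.keys (\<Sum>a\<in>K. Poly_Mapping.single a (f a)) \<subseteq> K \<and>
      P (\<Sum>a\<in>K. Poly_Mapping.single a (f a))" if "finite K" "K \<subseteq> S" for K and f :: "'a \<Rightarrow> 'b"
    using that
  proof (induction K rule: finite_induct)
    case (insert x K)
    have "Poly_Mapping.keys (Poly_Mapping.single x (f x)) \<subseteq> {x}" by simp
    then have "Poly_Mapping.keys (Poly_Mapping.single x (f x) + (\<Sum>a\<in>K. Poly_Mapping.single a (f a)))
        \<subseteq> insert x K"
      using insert Poly_Mapping.keys_add by fastforce
    moreover have "P (Poly_Mapping.single x (f x) + (\<Sum>a\<in>K. Poly_Mapping.single a (f a)))"
      using insert by (intro add single) auto
    ultimately show ?case using insert by simp
  qed (simp add: \<open>P 0\<close>)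
  have "p = (\<Sum>a\<in>Poly_Mapping.keys p. Poly_Mapping.single a (Poly_Mapping.lookup p a))"
    by (rule poly_mapping_eqI)
      (simp add: lookup_sum lookup_single when_def in_keys_iff)
  with *[OF finite_keys assms(1), of "Poly_Mapping.lookup p"] show ?thesis by simp
qed


text \<open>One formula for two products: the twisted product, with \<open>f\<close> the monoid
  operation and \<open>s\<close> the cocycle, and the tensoring of functions, with \<open>f\<close>
  the list constructor and \<open>s\<close> constantly 1.\<close>

definition basis_bilinear ::
    "('a \<Rightarrow> 'b \<Rightarrow> 'c) \<Rightarrow> ('a \<Rightarrow> 'b \<Rightarrow> complex) \<Rightarrow>
     ('a \<Rightarrow>\<^sub>0 complex) \<Rightarrow> ('b \<Rightarrow>\<^sub>0 complex) \<Rightarrow> ('c \<Rightarrow>\<^sub>0 complex)" where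
  "basis_bilinear f s p r =
     (\<Sum>a\<in>Poly_Mapping.keys p. \<Sum>b\<in>Poly_Mapping.keys r.
        Poly_Mapping.single (f a b) (s a b * Poly_Mapping.lookup p a * Poly_Mapping.lookup r b))"

text \<open>Cancellation can shrink the support of a sum, so additivity has to compare sums over one
  common index set.\<close>

lemma basis_bilinear_superset:
  assumes "finite K" "finite K'" "Poly_Mapping.keys p \<subseteq> K" "Poly_Mapping.keys r \<subseteq> K'"
  shows "basis_bilinear f s p r = (\<Sum>a\<in>K. \<Sum>b\<in>K'.
      Poly_Mapping.single (f a b) (s a b * Poly_Mapping.lookup p a * Poly_Mapping.lookup r b))"
proof -
  have "basis_bilinear f s p r = (\<Sum>a\<in>Poly_Mapping.keys p. \<Sum>b\<in>K'.
      Poly_Mapping.single (f a b) (s a b * Poly_Mapping.lookup p a * Poly_Mapping.lookup r b))"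
    unfolding basis_bilinear_def using assms
    by (intro sum.cong sum.mono_neutral_left refl) (auto simp: in_keys_iff)
  also have "\<dots> = (\<Sum>a\<in>K. \<Sum>b\<in>K'.
      Poly_Mapping.single (f a b) (s a b * Poly_Mapping.lookup p a * Poly_Mapping.lookup r b))"
    using assms by (intro sum.mono_neutral_left) (auto simp: in_keys_iff)
  finally show ?thesis .
qed

lemma basis_bilinear_single [simp]:
  "basis_bilinear f s (Poly_Mapping.single a c) (Poly_Mapping.single b d) =
    Poly_Mapping.single (f a b) (s a b * c * d)"
  using basis_bilinear_superset[of "{a}" "{b}" "Poly_Mapping.single a c" "Poly_Mapping.single b d" f s]
  by simp

lemma basis_bilinear_zero [simp]: "basis_bilinear f s 0 r = 0" "basis_bilinear f s p 0 = 0"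
  by (simp_all add: basis_bilinear_def)

lemma basis_bilinear_add_left:
  "basis_bilinear f s (p + p') r = basis_bilinear f s p r + basis_bilinear f s p' r"
proof -
  let ?K = "Poly_Mapping.keys p \<union> Poly_Mapping.keys p'"
  have "Poly_Mapping.keys (p + p') \<subseteq> ?K"
    by (rule Poly_Mapping.keys_add)
  then show ?thesis
    using basis_bilinear_superset[of ?K "Poly_Mapping.keys r" _ r f s]
    by (simp add: lookup_add algebra_simps single_add sum.distrib)
qed

lemma basis_bilinear_add_right:
  "basis_bilinear f s r (p + p') = basis_bilinear f s r p + basis_bilinear f s r p'"
proof -
  let ?K = "Poly_Mapping.keys p \<union> Poly_Mapping.keys p'"
  have "Poly_Mapping.keys (p + p') \<subseteq> ?K"
    by (rule Poly_Mapping.keys_add)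
  then show ?thesis
    using basis_bilinear_superset[of "Poly_Mapping.keys r" ?K r _ f s]
    by (simp add: lookup_add algebra_simps single_add sum.distrib)
qed

lemma basis_bilinear_smult:
  shows "basis_bilinear f s (Poly_Mapping.map ((*) c) p) r = Poly_Mapping.map ((*) c) (basis_bilinear f s p r)" (is ?L)
    and "basis_bilinear f s p (Poly_Mapping.map ((*) c) r) = Poly_Mapping.map ((*) c) (basis_bilinear f s p r)" (is ?R)
proof -
  have "?L \<and> ?R"
    using subset_UNIV[of "Poly_Mapping.keys p"]
  proof (induction p rule: poly_mapping_induct_on)
    case (single a d)
    show ?case using subset_UNIV[of "Poly_Mapping.keys r"]
    proof (induction r rule: poly_mapping_induct_on)
      case (single b e)
      then show ?case by (simp add: mult_ac)
    qed (simp_all add: basis_bilinear_add_right map_times_add)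
  qed (simp_all add: basis_bilinear_add_left map_times_add)
  then show ?L ?R by blast+
qed

lemma keys_add_subset:
  assumes "Poly_Mapping.keys p \<subseteq> S" "Poly_Mapping.keys r \<subseteq> S"
  shows "Poly_Mapping.keys (p + r) \<subseteq> S"
  using assms Poly_Mapping.keys_add[of p r] by auto

lemma keys_basis_bilinear:
  assumes "Poly_Mapping.keys p \<subseteq> K" "Poly_Mapping.keys r \<subseteq> K'"
    and "\<And>a b. a \<in> K \<Longrightarrow> b \<in> K' \<Longrightarrow> f a b \<in> K''"
  shows "Poly_Mapping.keys (basis_bilinear f s p r) \<subseteq> K''"
  using assms(1)
proof (induction p rule: poly_mapping_induct_on)
  case (single a c)
  show ?case using assms(2)
    by (induction r rule: poly_mapping_induct_on)
      (simp_all add: basis_bilinear_add_right keys_add_subset assms(3) single)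
qed (simp_all add: basis_bilinear_add_left keys_add_subset)


section \<open>Complex algebras\<close>

text \<open>The multiplication may be noncommutative, hence scalars are moved out of the left and of
  the right factor by separate axioms.\<close>

locale complex_algebra = ring A for A :: "(complex, 'a, 'm) module_scheme" (structure) +
  assumes smult_closed [simp, intro]: "x \<in> carrier A \<Longrightarrow> c \<odot> x \<in> carrier A"
    and smult_l_distr: "x \<in> carrier A \<Longrightarrow> (c + d) \<odot> x = c \<odot> x \<oplus> d \<odot> x"
    and smult_r_distr: "x \<in> carrier A \<Longrightarrow> y \<in> carrier A \<Longrightarrow> c \<odot> (x \<oplus> y) = c \<odot> x \<oplus> c \<odot> y"
    and smult_smult: "x \<in> carrier A \<Longrightarrow> c \<odot> (d \<odot> x) = (c * d) \<odot> x"
    and smult_one [simp]: "x \<in> carrier A \<Longrightarrow> 1 \<odot> x = x"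
    and mult_smult_left: "x \<in> carrier A \<Longrightarrow> y \<in> carrier A \<Longrightarrow> (c \<odot> x) \<otimes> y = c \<odot> (x \<otimes> y)"
    and mult_smult_right: "x \<in> carrier A \<Longrightarrow> y \<in> carrier A \<Longrightarrow> x \<otimes> (c \<odot> y) = c \<odot> (x \<otimes> y)"
begin

lemma smult_zero_left [simp]: "x \<in> carrier A \<Longrightarrow> 0 \<odot> x = \<zero>"
  using smult_l_distr[of x 0 0] by (metis add.r_cancel_one' add_0 smult_closed)

lemma smult_zero_right [simp]: "c \<odot> \<zero> = \<zero>"
  using smult_r_distr[of \<zero> \<zero> c] by (metis add.r_cancel_one' smult_closed zero_closed r_zero)

lemma smult_minus_one: "x \<in> carrier A \<Longrightarrow> (-1) \<odot> x = \<ominus> x"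
  using smult_l_distr[of x "-1" 1] by (simp add: minus_equality)

text \<open>Gives access to the span and the basis over \<open>class_ring\<close>, in which the
  tensor product and the final theorem are phrased.\<close>

lemma is_vectorspace: "vectorspace class_ring A"
proof -
  have "cring (class_ring :: complex ring)"
    using class_field field.is_ring field_def domain_def by blast
  moreover have "Module.module_axioms class_ring A"
    unfolding Module.module_axioms_def by (simp add: smult_l_distr smult_r_distr smult_smult)
  ultimately have "Module.module class_ring A"
    unfolding Module.module_def using abelian_group_axioms by blast
  then show ?thesis
    using class_field unfolding vectorspace_def by blast
qed

lemma is_module: "Module.module class_ring A"
  using is_vectorspace unfolding vectorspace_def by blast

definition lin_ext :: "('g \<Rightarrow> 'a) \<Rightarrow> ('g \<Rightarrow>\<^sub>0 complex) \<Rightarrow> 'a" where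
  "lin_ext \<phi> p = (\<Oplus>a\<in>Poly_Mapping.keys p. Poly_Mapping.lookup p a \<odot> \<phi> a)"

lemma lin_ext_superset:
  assumes "finite K" and "Poly_Mapping.keys p \<subseteq> K" and "\<phi> \<in> K \<rightarrow> carrier A"
  shows "lin_ext \<phi> p = (\<Oplus>a\<in>K. Poly_Mapping.lookup p a \<odot> \<phi> a)"
  unfolding lin_ext_def using assms
  by (intro add.finprod_mono_neutral_cong_left) (auto simp: in_keys_iff Pi_iff)

lemma lin_ext_closed:
  "\<phi> \<in> Poly_Mapping.keys p \<rightarrow> carrier A \<Longrightarrow> lin_ext \<phi> p \<in> carrier A"
  unfolding lin_ext_def by (rule finsum_closed) auto

lemma lin_ext_zero [simp]: "lin_ext \<phi> 0 = \<zero>"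
  by (simp add: lin_ext_def)

lemma lin_ext_single [simp]: "\<phi> a \<in> carrier A \<Longrightarrow> lin_ext \<phi> (Poly_Mapping.single a c) = c \<odot> \<phi> a"
  using lin_ext_superset[of "{a}" "Poly_Mapping.single a c" \<phi>] by (simp add: Pi_def)

lemma lin_ext_add:
  assumes "\<phi> \<in> Poly_Mapping.keys p \<union> Poly_Mapping.keys r \<rightarrow> carrier A"
  shows "lin_ext \<phi> (p + r) = lin_ext \<phi> p \<oplus> lin_ext \<phi> r"
proof -
  let ?K = "Poly_Mapping.keys p \<union> Poly_Mapping.keys r"
  have "lin_ext \<phi> (p + r) = (\<Oplus>a\<in>?K. Poly_Mapping.lookup (p + r) a \<odot> \<phi> a)"
    using assms Poly_Mapping.keys_add[of p r] by (intro lin_ext_superset) auto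
  also have "\<dots> = (\<Oplus>a\<in>?K. Poly_Mapping.lookup p a \<odot> \<phi> a \<oplus> Poly_Mapping.lookup r a \<odot> \<phi> a)"
    using assms by (intro finsum_cong') (auto simp: lookup_add smult_l_distr Pi_iff)
  also have "\<dots> = lin_ext \<phi> p \<oplus> lin_ext \<phi> r"
    using assms lin_ext_superset[of ?K p \<phi>] lin_ext_superset[of ?K r \<phi>]
    by (subst finsum_addf) auto
  finally show ?thesis .
qed

lemma lin_ext_smult:
  assumes "\<phi> \<in> Poly_Mapping.keys p \<rightarrow> carrier A"
  shows "lin_ext \<phi> (Poly_Mapping.map ((*) c) p) = c \<odot> lin_ext \<phi> p"
proof -
  \<comment> \<open>The original support is frozen, so that \<open>\<phi>\<close> keeps its values
    in the carrier on all summands met during the induction.\<close>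
  let ?K = "Poly_Mapping.keys p"
  have "Poly_Mapping.keys p \<subseteq> ?K" ..
  then show ?thesis
  proof (induction p rule: poly_mapping_induct_on)
    case (single a d)
    then have "\<phi> a \<in> carrier A" using assms by auto
    then show ?case by (simp add: smult_smult)
  next
    case (add p r)
    have "Poly_Mapping.keys (Poly_Mapping.map ((*) c) p) \<subseteq> ?K"
      "Poly_Mapping.keys (Poly_Mapping.map ((*) c) r) \<subseteq> ?K"
      using add.hyps keys_map_times by fast+
    then have "\<phi> \<in> Poly_Mapping.keys (Poly_Mapping.map ((*) c) p) \<union>
        Poly_Mapping.keys (Poly_Mapping.map ((*) c) r) \<rightarrow> carrier A"
      "\<phi> \<in> Poly_Mapping.keys p \<union> Poly_Mapping.keys r \<rightarrow> carrier A"
      "\<phi> \<in> Poly_Mapping.keys p \<rightarrow> carrier A" "\<phi> \<in> Poly_Mapping.keys r \<rightarrow> carrier A"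
      using assms add.hyps by auto
    then show ?case
      using add.IH by (simp add: map_times_add lin_ext_add smult_r_distr lin_ext_closed)
  qed simp
qed

end

subsection \<open>Twisted monoid algebras\<close>

definition twisted_algebra ::
    "('g, 'm) monoid_scheme \<Rightarrow> ('g \<Rightarrow> 'g \<Rightarrow> complex) \<Rightarrow> (complex, 'g \<Rightarrow>\<^sub>0 complex) module" where
  "twisted_algebra M \<omega> =
     \<lparr>carrier = {f. Poly_Mapping.keys f \<subseteq> carrier M},
      monoid.mult = (\<lambda>f g. \<Sum>a\<in>Poly_Mapping.keys f. \<Sum>b\<in>Poly_Mapping.keys g.
                Poly_Mapping.single (a \<otimes>\<^bsub>M\<^esub> b)
                  (\<omega> a b * Poly_Mapping.lookup f a * Poly_Mapping.lookup g b)),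
      monoid.one = Poly_Mapping.single \<one>\<^bsub>M\<^esub> 1,
      ring.zero = 0,
      ring.add = (+),
      module.smult = (\<lambda>c. Poly_Mapping.map ((*) c))\<rparr>"

text \<open>Free algebras, the algebra of tuples behind a tensor product and the Laurent polynomial
  algebra thereby become instances of the twisted construction.\<close>

lemma monoid_algebra_twisted: "monoid_algebra M = twisted_algebra M (\<lambda>_ _. 1)"
  by (simp add: monoid_algebra_def twisted_algebra_def)

lemma twisted_algebra_simps [simp]:
  "carrier (twisted_algebra M \<omega>) = {f. Poly_Mapping.keys f \<subseteq> carrier M}"
  "\<one>\<^bsub>twisted_algebra M \<omega>\<^esub> = Poly_Mapping.single \<one>\<^bsub>M\<^esub> 1"
  "\<zero>\<^bsub>twisted_algebra M \<omega>\<^esub> = 0"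
  "p \<oplus>\<^bsub>twisted_algebra M \<omega>\<^esub> r = p + r"
  "c \<odot>\<^bsub>twisted_algebra M \<omega>\<^esub> p = Poly_Mapping.map ((*) c) p"
  by (simp_all add: twisted_algebra_def)

lemma twisted_mult_eq: "p \<otimes>\<^bsub>twisted_algebra M \<omega>\<^esub> r = basis_bilinear (\<otimes>\<^bsub>M\<^esub>) \<omega> p r"
  by (simp add: twisted_algebra_def basis_bilinear_def)

lemma twisted_mult_single [simp]:
  "Poly_Mapping.single a c \<otimes>\<^bsub>twisted_algebra M \<omega>\<^esub> Poly_Mapping.single b d =
    Poly_Mapping.single (a \<otimes>\<^bsub>M\<^esub> b) (\<omega> a b * c * d)"
  by (simp add: twisted_mult_eq)

lemma twisted_mult_zero [simp]:
  "0 \<otimes>\<^bsub>twisted_algebra M \<omega>\<^esub> p = 0" "p \<otimes>\<^bsub>twisted_algebra M \<omega>\<^esub> 0 = 0"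
  by (simp_all add: twisted_mult_eq)

lemma twisted_mult_add:
  "(p + p') \<otimes>\<^bsub>twisted_algebra M \<omega>\<^esub> r = p \<otimes>\<^bsub>twisted_algebra M \<omega>\<^esub> r + p' \<otimes>\<^bsub>twisted_algebra M \<omega>\<^esub> r"
  "r \<otimes>\<^bsub>twisted_algebra M \<omega>\<^esub> (p + p') = r \<otimes>\<^bsub>twisted_algebra M \<omega>\<^esub> p + r \<otimes>\<^bsub>twisted_algebra M \<omega>\<^esub> p'"
  by (simp_all add: twisted_mult_eq basis_bilinear_add_left basis_bilinear_add_right)

text \<open>The cocycle identity is associativity on basis vectors, and the normalisation makes the
  basis vector of the unit the unit. Nonvanishing keeps a product of nonzero multiples of basis
  vectors from collapsing to 0.\<close>

locale twisted_monoid = monoid M for M (structure) +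
  fixes \<omega> :: "'a \<Rightarrow> 'a \<Rightarrow> complex"
  assumes cocycle_nonzero: "a \<in> carrier M \<Longrightarrow> b \<in> carrier M \<Longrightarrow> \<omega> a b \<noteq> 0"
    and cocycle_one: "a \<in> carrier M \<Longrightarrow> \<omega> \<one> a = 1" "a \<in> carrier M \<Longrightarrow> \<omega> a \<one> = 1"
    and cocycle: "a \<in> carrier M \<Longrightarrow> b \<in> carrier M \<Longrightarrow> c \<in> carrier M \<Longrightarrow>
      \<omega> a b * \<omega> (a \<otimes> b) c = \<omega> b c * \<omega> a (b \<otimes> c)"
begin

abbreviation T where "T \<equiv> twisted_algebra M \<omega>"

lemma twisted_mult_closed:
  assumes "Poly_Mapping.keys p \<subseteq> carrier M" "Poly_Mapping.keys r \<subseteq> carrier M"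
  shows "Poly_Mapping.keys (p \<otimes>\<^bsub>T\<^esub> r) \<subseteq> carrier M"
  unfolding twisted_mult_eq using assms by (rule keys_basis_bilinear) simp

lemma twisted_mult_assoc:
  assumes "Poly_Mapping.keys p \<subseteq> carrier M" "Poly_Mapping.keys r \<subseteq> carrier M"
    "Poly_Mapping.keys s \<subseteq> carrier M"
  shows "(p \<otimes>\<^bsub>T\<^esub> r) \<otimes>\<^bsub>T\<^esub> s = p \<otimes>\<^bsub>T\<^esub> (r \<otimes>\<^bsub>T\<^esub> s)"
  using assms(1)
proof (induction p rule: poly_mapping_induct_on)
  case (single a c)
  show ?case using assms(2)
  proof (induction r rule: poly_mapping_induct_on)
    case (single b d)
    show ?case using assms(3)
    proof (induction s rule: poly_mapping_induct_on)
      case (single e f)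
      then show ?case
        using \<open>a \<in> carrier M\<close> \<open>b \<in> carrier M\<close> cocycle[of a b e] by (simp add: m_assoc mult_ac)
    qed (simp_all add: twisted_mult_add)
  qed (simp_all add: twisted_mult_add)
qed (simp_all add: twisted_mult_add)

lemma twisted_mult_one:
  assumes "Poly_Mapping.keys p \<subseteq> carrier M"
  shows "Poly_Mapping.single \<one> 1 \<otimes>\<^bsub>T\<^esub> p = p" "p \<otimes>\<^bsub>T\<^esub> Poly_Mapping.single \<one> 1 = p"
  using assms
  by (induction p rule: poly_mapping_induct_on)
    (simp_all add: twisted_mult_add cocycle_one)

lemma complex_algebra_twisted: "complex_algebra T"
proof -
  have "abelian_group T"
  proof (rule abelian_groupI)
    fix x assume "x \<in> carrier T"
    then show "\<exists>y\<in>carrier T. y \<oplus>\<^bsub>T\<^esub> x = \<zero>\<^bsub>T\<^esub>"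
      by (intro bexI[of _ "- x"]) (auto simp: in_keys_iff subset_iff)
  qed (simp_all add: add_ac keys_add_subset)
  moreover have "monoid T"
    by (rule monoidI) (auto simp: twisted_mult_closed twisted_mult_assoc twisted_mult_one simp del: One_nat_def)
  ultimately have "ring T"
    by (intro ringI) (simp_all add: twisted_mult_add)
  moreover have "complex_algebra_axioms T"
  proof
    fix x c assume "x \<in> carrier T"
    then show "c \<odot>\<^bsub>T\<^esub> x \<in> carrier T" using keys_map_times[of c x] by auto
  qed (simp_all add: twisted_mult_eq basis_bilinear_smult map_times_add poly_mapping_eqI lookup_add algebra_simps)
  ultimately show ?thesis by (simp add: complex_algebra_def)
qed

end

lemma twisted_monoid_trivial: "monoid M \<Longrightarrow> twisted_monoid M (\<lambda>_ _. 1)"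
  by (simp add: twisted_monoid_def twisted_monoid_axioms_def)


subsection \<open>Homomorphisms\<close>

definition alg_hom ::
    "(complex, 'a, 'm) module_scheme \<Rightarrow> (complex, 'b, 'n) module_scheme \<Rightarrow> ('a \<Rightarrow> 'b) \<Rightarrow> bool" where
  "alg_hom A B h \<longleftrightarrow>
     h \<in> Ring.ring_hom A B \<and> (\<forall>c. \<forall>x \<in> carrier A. h (c \<odot>\<^bsub>A\<^esub> x) = c \<odot>\<^bsub>B\<^esub> h x)"

lemma alg_isoI: "alg_hom A B h \<Longrightarrow> bij_betw h (carrier A) (carrier B) \<Longrightarrow> A \<cong>\<^sub>a\<^sub>l\<^sub>g B"
  unfolding alg_iso_def alg_hom_def ring_iso_def by blast

lemma alg_isoE:
  assumes "A \<cong>\<^sub>a\<^sub>l\<^sub>g B"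
  obtains h where "alg_hom A B h" and "bij_betw h (carrier A) (carrier B)"
  using assms unfolding alg_iso_def alg_hom_def ring_iso_def by blast

lemma alg_homD:
  assumes "alg_hom A B h"
  shows "x \<in> carrier A \<Longrightarrow> h x \<in> carrier B"
    and "x \<in> carrier A \<Longrightarrow> y \<in> carrier A \<Longrightarrow> h (x \<oplus>\<^bsub>A\<^esub> y) = h x \<oplus>\<^bsub>B\<^esub> h y"
    and "x \<in> carrier A \<Longrightarrow> y \<in> carrier A \<Longrightarrow> h (x \<otimes>\<^bsub>A\<^esub> y) = h x \<otimes>\<^bsub>B\<^esub> h y"
    and "x \<in> carrier A \<Longrightarrow> h (c \<odot>\<^bsub>A\<^esub> x) = c \<odot>\<^bsub>B\<^esub> h x"
    and "h \<one>\<^bsub>A\<^esub> = \<one>\<^bsub>B\<^esub>"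
  using assms unfolding alg_hom_def by (auto simp: Ring.ring_hom_def)

lemma alg_hom_zero:
  assumes "alg_hom A B h" "complex_algebra A" "complex_algebra B"
  shows "h \<zero>\<^bsub>A\<^esub> = \<zero>\<^bsub>B\<^esub>"
proof -
  interpret A: complex_algebra A by fact
  interpret B: complex_algebra B by fact
  have "h (0 \<odot>\<^bsub>A\<^esub> \<zero>\<^bsub>A\<^esub>) = 0 \<odot>\<^bsub>B\<^esub> h \<zero>\<^bsub>A\<^esub>"
    using assms(1) by (rule alg_homD) simp
  then show ?thesis using alg_homD(1)[OF assms(1), of "\<zero>\<^bsub>A\<^esub>"] by simp
qed

lemma alg_hom_uminus:
  assumes "alg_hom A B h" "complex_algebra A" "complex_algebra B" "x \<in> carrier A"
  shows "h (\<ominus>\<^bsub>A\<^esub> x) = \<ominus>\<^bsub>B\<^esub> h x"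
proof -
  interpret A: complex_algebra A by fact
  interpret B: complex_algebra B by fact
  show ?thesis
    using alg_homD(4)[OF assms(1,4), of "-1"] alg_homD(1)[OF assms(1,4)] assms(4)
    by (simp add: A.smult_minus_one B.smult_minus_one)
qed

lemma alg_hom_minus:
  assumes "alg_hom A B h" "complex_algebra A" "complex_algebra B" "x \<in> carrier A" "y \<in> carrier A"
  shows "h (x \<ominus>\<^bsub>A\<^esub> y) = h x \<ominus>\<^bsub>B\<^esub> h y"
proof -
  interpret A: complex_algebra A by fact
  interpret B: complex_algebra B by fact
  show ?thesis
    using assms by (simp add: a_minus_def alg_homD(2) alg_hom_uminus)
qed

lemma alg_hom_inj_on:
  assumes "alg_hom A B h" "complex_algebra A" "complex_algebra B"
    and ker: "\<And>x. x \<in> carrier A \<Longrightarrow> h x = \<zero>\<^bsub>B\<^esub> \<Longrightarrow> x = \<zero>\<^bsub>A\<^esub>"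
  shows "inj_on h (carrier A)"
proof (rule inj_onI)
  interpret A: complex_algebra A by fact
  interpret B: complex_algebra B by fact
  fix x y assume xy: "x \<in> carrier A" "y \<in> carrier A" "h x = h y"
  have "h (x \<ominus>\<^bsub>A\<^esub> y) = \<zero>\<^bsub>B\<^esub>"
    using xy assms(1-3) by (simp add: alg_hom_minus alg_homD(1) B.r_right_minus_eq)
  then have "x \<ominus>\<^bsub>A\<^esub> y = \<zero>\<^bsub>A\<^esub>"
    using xy by (intro ker) auto
  then show "x = y" using xy by simp
qed

lemma alg_hom_comp:
  assumes "alg_hom A B h" "alg_hom B C g"
  shows "alg_hom A C (g \<circ> h)"
  using assms unfolding alg_hom_def by (auto simp: Ring.ring_hom_def Pi_def)

lemma alg_iso_trans:
  assumes "A \<cong>\<^sub>a\<^sub>l\<^sub>g B" "B \<cong>\<^sub>a\<^sub>l\<^sub>g C"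
  shows "A \<cong>\<^sub>a\<^sub>l\<^sub>g C"
proof -
  obtain h where h: "alg_hom A B h" "bij_betw h (carrier A) (carrier B)"
    using assms(1) by (rule alg_isoE)
  obtain g where g: "alg_hom B C g" "bij_betw g (carrier B) (carrier C)"
    using assms(2) by (rule alg_isoE)
  show ?thesis
    by (rule alg_isoI[OF alg_hom_comp[OF h(1) g(1)] bij_betw_trans[OF h(2) g(2)]])
qed

lemma alg_hom_inv_into:
  assumes h: "alg_hom A B h" and bij: "bij_betw h (carrier A) (carrier B)" and A: "complex_algebra A"
  shows "alg_hom B A (inv_into (carrier A) h)"
proof -
  interpret A: complex_algebra A by fact
  let ?g = "inv_into (carrier A) h"
  have g: "?g y \<in> carrier A" "h (?g y) = y" if "y \<in> carrier B" for y
    using that bij by (auto simp: bij_betw_def f_inv_into_f inv_into_into)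
  have eq: "?g y = x" if "x \<in> carrier A" "h x = y" for x y
    using that bij by (auto simp: bij_betw_def inv_into_f_eq)
  show ?thesis
    unfolding alg_hom_def Ring.ring_hom_def
    using h g by (auto intro!: eq simp: alg_homD)
qed

lemma alg_iso_sym:
  assumes "A \<cong>\<^sub>a\<^sub>l\<^sub>g B" "complex_algebra A"
  shows "B \<cong>\<^sub>a\<^sub>l\<^sub>g A"
  by (metis alg_isoE[OF assms(1)] alg_isoI alg_hom_inv_into[OF _ _ assms(2)] bij_betw_inv_into)

text \<open>Both sides of the multiplicativity equation are bilinear, so two nested inductions
  reduce it to the hypothesis on basis vectors.\<close>

lemma (in complex_algebra) lin_ext_alg_hom:
  assumes "twisted_monoid M \<omega>"
    and \<phi>: "\<phi> \<in> carrier M \<rightarrow> carrier A" and one: "\<phi> \<one>\<^bsub>M\<^esub> = \<one>"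
    and mult: "\<And>a b. a \<in> carrier M \<Longrightarrow> b \<in> carrier M \<Longrightarrow> \<phi> a \<otimes> \<phi> b = \<omega> a b \<odot> \<phi> (a \<otimes>\<^bsub>M\<^esub> b)"
  shows "alg_hom (twisted_algebra M \<omega>) A (lin_ext \<phi>)"
proof -
  interpret M: twisted_monoid M \<omega> by fact
  interpret T: complex_algebra M.T by (rule M.complex_algebra_twisted)
  have in_A: "\<phi> a \<in> carrier A" if "a \<in> carrier M" for a
    using \<phi> that by auto
  have closed: "lin_ext \<phi> p \<in> carrier A" if "Poly_Mapping.keys p \<subseteq> carrier M" for p
    using that in_A by (intro lin_ext_closed) auto
  have add: "lin_ext \<phi> (p + r) = lin_ext \<phi> p \<oplus> lin_ext \<phi> r"
    if "Poly_Mapping.keys p \<subseteq> carrier M" "Poly_Mapping.keys r \<subseteq> carrier M" for p r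
    using that in_A by (intro lin_ext_add) auto
  have smult: "lin_ext \<phi> (Poly_Mapping.map ((*) c) p) = c \<odot> lin_ext \<phi> p"
    if "Poly_Mapping.keys p \<subseteq> carrier M" for p c
    using that in_A by (intro lin_ext_smult) auto
  have mult: "lin_ext \<phi> (p \<otimes>\<^bsub>M.T\<^esub> r) = lin_ext \<phi> p \<otimes> lin_ext \<phi> r"
    if p: "Poly_Mapping.keys p \<subseteq> carrier M" and r: "Poly_Mapping.keys r \<subseteq> carrier M" for p r
    using p
  proof (induction p rule: poly_mapping_induct_on)
    case zero
    then show ?case using r by (simp add: closed)
  next
    case (single a c)
    show ?case using r
    proof (induction r rule: poly_mapping_induct_on)
      case zero
      show ?case using single by (simp add: in_A)
    next
      case s: (single b d)
      show ?case using single s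
        by (simp add: in_A mult mult_smult_left mult_smult_right smult_smult mult_ac)
    next
      case s: (add r s)
      have "Poly_Mapping.keys (Poly_Mapping.single a c) \<subseteq> carrier M" using single by simp
      with s show ?case using single
        by (simp add: twisted_mult_add add M.twisted_mult_closed r_distr closed in_A)
    qed
  next
    case s: (add p s)
    with r show ?case
      by (simp add: twisted_mult_add add M.twisted_mult_closed l_distr closed)
  qed
  show ?thesis
    unfolding alg_hom_def Ring.ring_hom_def
    by (simp add: closed add smult mult one in_A Pi_iff)
qed

text \<open>Sending basis vectors to the rescaled family gives a linear section, which is an inverse
  because the composition is the identity on the family.\<close>

lemma bij_betw_of_spanning_family:
  assumes A: "complex_algebra A" and T: "twisted_monoid M \<omega>"
    and h: "alg_hom A (twisted_algebra M \<omega>) h"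
    and \<theta>: "bij_betw \<theta> I (carrier M)"
    and U: "U \<in> I \<rightarrow> carrier A"
    and hU: "\<And>i. i \<in> I \<Longrightarrow> h (U i) = Poly_Mapping.single (\<theta> i) (c i)"
    and nz: "\<And>i. i \<in> I \<Longrightarrow> c i \<noteq> 0"
    and span: "\<And>S. S \<subseteq> carrier A \<Longrightarrow> \<zero>\<^bsub>A\<^esub> \<in> S \<Longrightarrow> U ` I \<subseteq> S \<Longrightarrow>
      (\<And>x y. x \<in> S \<Longrightarrow> y \<in> S \<Longrightarrow> x \<oplus>\<^bsub>A\<^esub> y \<in> S) \<Longrightarrow>
      (\<And>d x. x \<in> S \<Longrightarrow> d \<odot>\<^bsub>A\<^esub> x \<in> S) \<Longrightarrow> S = carrier A"
  shows "bij_betw h (carrier A) (carrier (twisted_algebra M \<omega>))"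
proof -
  interpret A: complex_algebra A by fact
  interpret M: twisted_monoid M \<omega> by fact
  interpret T: complex_algebra M.T by (rule M.complex_algebra_twisted)
  define \<rho> where "\<rho> = inv_into I \<theta>"
  have \<rho>: "\<rho> a \<in> I" "\<theta> (\<rho> a) = a" if "a \<in> carrier M" for a
    using that \<theta> unfolding \<rho>_def by (auto simp: bij_betw_def f_inv_into_f inv_into_into)
  have \<rho>\<theta>: "\<rho> (\<theta> i) = i" "\<theta> i \<in> carrier M" if "i \<in> I" for i
    using that \<theta> unfolding \<rho>_def by (auto simp: bij_betw_def)
  define g where "g = A.lin_ext (\<lambda>a. inverse (c (\<rho> a)) \<odot>\<^bsub>A\<^esub> U (\<rho> a))"
  have inA: "inverse (c (\<rho> a)) \<odot>\<^bsub>A\<^esub> U (\<rho> a) \<in> carrier A" if "a \<in> carrier M" for a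
    using \<rho>[OF that] U by auto
  have g_closed: "g p \<in> carrier A" if "Poly_Mapping.keys p \<subseteq> carrier M" for p
    unfolding g_def using that inA by (intro A.lin_ext_closed) auto
  have g_add: "g (p + r) = g p \<oplus>\<^bsub>A\<^esub> g r"
    if "Poly_Mapping.keys p \<subseteq> carrier M" "Poly_Mapping.keys r \<subseteq> carrier M" for p r
    unfolding g_def using that inA by (intro A.lin_ext_add) auto
  have g_smult: "g (Poly_Mapping.map ((*) d) p) = d \<odot>\<^bsub>A\<^esub> g p"
    if "Poly_Mapping.keys p \<subseteq> carrier M" for p d
    unfolding g_def using that inA by (intro A.lin_ext_smult) auto
  note hD = alg_homD[OF h, simplified]
  \<comment> \<open>The elements fixed by \<open>g\<close> after \<open>h\<close> form a subspace
    containing the family, so the closure form of spanning in \<open>span\<close> yields the whole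
    algebra.\<close>
  have "{x \<in> carrier A. g (h x) = x} = carrier A"
  proof (rule span)
    show "\<zero>\<^bsub>A\<^esub> \<in> {x \<in> carrier A. g (h x) = x}"
      using alg_hom_zero[OF h A M.complex_algebra_twisted] by (simp add: g_def)
    show "U ` I \<subseteq> {x \<in> carrier A. g (h x) = x}"
    proof clarify
      fix i assume i: "i \<in> I"
      then have "U i \<in> carrier A" using U by auto
      moreover have "g (h (U i)) = U i"
        using calculation nz[OF i] \<rho>\<theta>[OF i] by (simp add: g_def hU[OF i] A.smult_smult)
      ultimately show "U i \<in> carrier A \<and> g (h (U i)) = U i" by simp
    qed
  qed (auto simp: hD g_add g_smult)
  then have gh: "g (h x) = x" if "x \<in> carrier A" for x using that by blast
  have "\<exists>x\<in>carrier A. h x = p" if "Poly_Mapping.keys p \<subseteq> carrier M" for p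
    using that
  proof (induction p rule: poly_mapping_induct_on)
    case zero
    show ?case using alg_hom_zero[OF h A M.complex_algebra_twisted] by (intro bexI[of _ "\<zero>\<^bsub>A\<^esub>"]) simp_all
  next
    case (single a d)
    have "U (\<rho> a) \<in> carrier A" using U \<rho>[OF single] by auto
    then show ?case using \<rho>[OF single] nz[OF \<rho>(1)[OF single]]
      by (intro bexI[of _ "(d / c (\<rho> a)) \<odot>\<^bsub>A\<^esub> U (\<rho> a)"]) (simp_all add: hD hU)
  next
    case (add p r)
    then obtain x y where "x \<in> carrier A" "y \<in> carrier A" "h x = p" "h y = r" by blast
    then show ?case by (intro bexI[of _ "x \<oplus>\<^bsub>A\<^esub> y"]) (simp_all add: hD)
  qed
  then have "h ` carrier A = carrier M.T" using hD(1) by (auto simp: image_iff)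
  moreover have "inj_on h (carrier A)" using gh by (rule inj_on_inverseI)
  ultimately show ?thesis by (simp add: bij_betw_def)
qed


text \<open>The relations are written with subtraction of finitely supported functions, whereas
  cosets are compared by the subtraction of the ring.\<close>

lemma (in twisted_monoid) twisted_minus:
  assumes "Poly_Mapping.keys p \<subseteq> carrier M" "Poly_Mapping.keys r \<subseteq> carrier M"
  shows "p \<ominus>\<^bsub>T\<^esub> r = p - r"
proof -
  interpret T: complex_algebra T by (rule complex_algebra_twisted)
  have "\<ominus>\<^bsub>T\<^esub> r = Poly_Mapping.map ((*) (-1)) r"
    using T.smult_minus_one[of r] assms by simp
  also have "\<dots> = - r" by (rule poly_mapping_eqI) (simp only: lookup_map_times lookup_uminus mult_minus1)
  finally show ?thesis by (simp add: a_minus_def)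
qed


subsection \<open>Quotients\<close>

context complex_algebra
begin

text \<open>Scalars act through multiples of the unit, so a ring ideal is automatically a linear
  subspace.\<close>

lemma ideal_smult_closed:
  assumes "ideal I A" "x \<in> I"
  shows "c \<odot> x \<in> I"
proof -
  have x: "x \<in> carrier A" using assms ideal.Icarr by fast
  then have "(c \<odot> \<one>) \<otimes> x = c \<odot> x" by (simp add: mult_smult_left)
  then show ?thesis using ideal.I_l_closed[OF assms, of "c \<odot> \<one>"] by simp
qed

lemma quot_alg_simps:
  "carrier (quot_alg A I) = a_rcosets I"
  "\<one>\<^bsub>quot_alg A I\<^esub> = I +> \<one>"
  "\<zero>\<^bsub>quot_alg A I\<^esub> = I"
  "Y \<oplus>\<^bsub>quot_alg A I\<^esub> Z = Y <+>\<^bsub>A\<^esub> Z"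
  "Y \<otimes>\<^bsub>quot_alg A I\<^esub> Z = rcoset_mult A I Y Z"
  by (simp_all add: quot_alg_def ring.defs module.defs FactRing_def)

text \<open>All representatives of a coset give the same scaled coset, so the union in
  \<open>quot_alg\<close> is a union of equal sets.\<close>

lemma quot_alg_smult:
  assumes I: "ideal I A" and x: "x \<in> carrier A"
  shows "c \<odot>\<^bsub>quot_alg A I\<^esub> (I +> x) = I +> c \<odot> x"
proof -
  interpret I: ideal I A by fact
  have eq: "I +> c \<odot> y = I +> c \<odot> x" if "y \<in> I +> x" for y
  proof -
    obtain i where i: "i \<in> I" "y = i \<oplus> x" using \<open>y \<in> I +> x\<close> by (auto simp: a_r_coset_def')
    have "c \<odot> y = c \<odot> i \<oplus> c \<odot> x"
      using i x I.Icarr by (simp add: smult_r_distr)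
    then have "c \<odot> y \<in> I +> c \<odot> x"
      using ideal_smult_closed[OF I i(1)] by (auto simp: a_r_coset_def')
    then show ?thesis using abelian_subgroup.a_repr_independence'[OF I.abelian_subgroup_axioms _ smult_closed[OF x]] by simp
  qed
  have "c \<odot>\<^bsub>quot_alg A I\<^esub> (I +> x) = (\<Union>y\<in>I +> x. I +> c \<odot> y)"
    by (simp add: quot_alg_def ring.defs module.defs)
  also have "\<dots> = (\<Union>y\<in>I +> x. I +> c \<odot> x)"
    by (rule SUP_cong[OF refl]) (rule eq)
  also have "\<dots> = I +> c \<odot> x"
    using I.a_rcos_self[OF x] by blast
  finally show ?thesis .
qed

lemma complex_algebra_quot_alg:
  assumes I: "ideal I A"
  shows "complex_algebra (quot_alg A I)"
    and "alg_hom A (quot_alg A I) ((+>) I)"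
    and "carrier (quot_alg A I) = (+>) I ` carrier A"
proof -
  interpret I: ideal I A by fact
  show carr: "carrier (quot_alg A I) = (+>) I ` carrier A"
    by (auto simp: quot_alg_simps A_RCOSETS_def')
  \<comment> \<open>The record differs from \<open>A Quot I\<close> only by its scalar
    multiplication, so the ring axioms are carried over field by field.\<close>
  have Q: "ring (A Quot I)" by (rule I.quotient_is_ring)
  have eqs: "carrier (quot_alg A I) = carrier (A Quot I)" "\<one>\<^bsub>quot_alg A I\<^esub> = \<one>\<^bsub>A Quot I\<^esub>"
    "\<zero>\<^bsub>quot_alg A I\<^esub> = \<zero>\<^bsub>A Quot I\<^esub>" "add (quot_alg A I) = add (A Quot I)"
    "monoid.mult (quot_alg A I) = monoid.mult (A Quot I)"
    by (simp_all add: quot_alg_def ring.defs module.defs FactRing_def)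
  interpret Q: ring "A Quot I" by (rule Q)
  have abel: "abelian_group (quot_alg A I)"
    by (rule abelian_groupI)
      (use Q.a_assoc Q.a_comm Q.add.l_inv_ex in \<open>simp_all add: eqs\<close>)
  have mon: "monoid (quot_alg A I)"
    by (rule monoidI) (use Q.m_assoc in \<open>simp_all add: eqs\<close>)
  have ring: "ring (quot_alg A I)"
    by (rule ringI[OF abel mon]) (simp_all add: eqs Q.l_distr Q.r_distr)
  have rh: "(+>) I \<in> Ring.ring_hom A (A Quot I)" by (rule I.rcos_ring_hom)
  show hom: "alg_hom A (quot_alg A I) ((+>) I)"
    using rh quot_alg_smult[OF I] by (auto simp: alg_hom_def Ring.ring_hom_def eqs)
  note hD = alg_homD[OF hom]
  have "complex_algebra_axioms (quot_alg A I)"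
    by standard (auto simp: carr quot_alg_smult[OF I] hD(2,3)[symmetric] smult_l_distr smult_r_distr
      smult_smult mult_smult_left mult_smult_right)
  with ring show "complex_algebra (quot_alg A I)" by (simp add: complex_algebra_def)
qed

lemma quot_alg_eq_iff:
  assumes I: "ideal I A" and "x \<in> carrier A" "y \<in> carrier A"
  shows "I +> x = I +> y \<longleftrightarrow> x \<ominus> y \<in> I"
  using assms quotient_eq_iff_same_a_r_cos[OF I] by metis

lemma quot_alg_lift:
  assumes I: "ideal I A" and B: "complex_algebra B" and h: "alg_hom A B h"
    and ker: "\<And>x. x \<in> I \<Longrightarrow> h x = \<zero>\<^bsub>B\<^esub>"
  obtains k where "alg_hom (quot_alg A I) B k" "\<And>x. x \<in> carrier A \<Longrightarrow> k (I +> x) = h x"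
proof
  interpret I: ideal I A by fact
  interpret B: complex_algebra B by fact
  \<comment> \<open>A coset is evaluated at a chosen representative; \<open>ker\<close> makes the
    result independent of the choice.\<close>
  let ?k = "\<lambda>Y. h (SOME x. x \<in> carrier A \<and> Y = I +> x)"
  note Q = complex_algebra_quot_alg[OF I]
  show k: "?k (I +> x) = h x" if x: "x \<in> carrier A" for x
  proof -
    define y where "y = (SOME y. y \<in> carrier A \<and> I +> x = I +> y)"
    have y: "y \<in> carrier A" "I +> x = I +> y"
      using someI[of "\<lambda>y. y \<in> carrier A \<and> I +> x = I +> y" x] x unfolding y_def by auto
    then have "y \<ominus> x \<in> I" using quot_alg_eq_iff[OF I] x by metis
    then have "h (y \<ominus> x) = \<zero>\<^bsub>B\<^esub>" by (rule ker)
    then have "h y \<ominus>\<^bsub>B\<^esub> h x = \<zero>\<^bsub>B\<^esub>"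
      using alg_hom_minus[OF h complex_algebra_axioms B] x y(1) by simp
    then have "h y = h x" using alg_homD(1)[OF h] x y(1) by simp
    then show ?thesis unfolding y_def .
  qed
  note qD = alg_homD[OF Q(2)]
  show "alg_hom (quot_alg A I) B ?k"
    unfolding alg_hom_def Ring.ring_hom_def using k
    by (auto simp: Q(3) qD(2-5)[symmetric] alg_homD[OF h] simp del: split_paired_Ex)
qed

lemma alg_hom_kernel_ideal:
  assumes B: "complex_algebra B" and h: "alg_hom A B h"
  shows "ideal {x \<in> carrier A. h x = \<zero>\<^bsub>B\<^esub>} A"
proof -
  interpret B: complex_algebra B by fact
  have "RingHom.ring_hom_ring A B h"
    using h by (intro ring_hom_ringI2) (auto simp: alg_hom_def ring_axioms B.ring_axioms)
  from ring_hom_ring.kernel_is_ideal[OF this] show ?thesis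
    by (simp add: a_kernel_def')
qed

text \<open>The first isomorphism theorem. It is applied to tensor products once the span of the
  multilinear relations has been recognised as a kernel.\<close>

lemma quot_alg_iso:
  assumes B: "complex_algebra B" and h: "alg_hom A B h" and surj: "h ` carrier A = carrier B"
  shows "quot_alg A {x \<in> carrier A. h x = \<zero>\<^bsub>B\<^esub>} \<cong>\<^sub>a\<^sub>l\<^sub>g B"
proof -
  interpret B: complex_algebra B by fact
  let ?I = "{x \<in> carrier A. h x = \<zero>\<^bsub>B\<^esub>}"
  have I: "ideal ?I A" by (rule alg_hom_kernel_ideal[OF B h])
  obtain k where k: "alg_hom (quot_alg A ?I) B k" "\<And>x. x \<in> carrier A \<Longrightarrow> k (?I +> x) = h x"
    using quot_alg_lift[OF I B h] by blast
  note Q = complex_algebra_quot_alg[OF I]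
  have "inj_on k (carrier (quot_alg A ?I))"
  proof (rule alg_hom_inj_on[OF k(1) Q(1) B])
    fix Y assume "Y \<in> carrier (quot_alg A ?I)" "k Y = \<zero>\<^bsub>B\<^esub>"
    then obtain x where "x \<in> carrier A" "Y = ?I +> x" "h x = \<zero>\<^bsub>B\<^esub>"
      using k(2) by (auto simp: Q(3))
    moreover from this have "?I +> x = ?I"
      by (intro abelian_subgroup.a_rcos_const abelian_subgroupI3 ideal.axioms(1)[OF I]
          is_abelian_group) auto
    ultimately show "Y = \<zero>\<^bsub>quot_alg A ?I\<^esub>"
      by (simp add: quot_alg_simps)
  qed
  moreover have "k ` carrier (quot_alg A ?I) = carrier B"
    unfolding Q(3) surj[symmetric] by (force simp: k(2) image_iff)
  ultimately show "quot_alg A ?I \<cong>\<^sub>a\<^sub>l\<^sub>g B"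
    by (intro alg_isoI[OF k(1)]) (simp add: bij_betw_def)
qed

end


section \<open>Quasi Laurent polynomial algebras\<close>

context monoid
begin

lemma int_pow_neg_Suc: "u [^] (- int (Suc m)) = inv (u [^] Suc m)"
proof -
  have "- int (Suc m) < 0" "nat (- (- int (Suc m))) = Suc m" by auto
  then show ?thesis by (simp only: int_pow_def2[of _ _ "- int (Suc m)"] if_True)
qed

lemma Units_int_pow_closed:
  assumes "u \<in> Units G"
  shows "u [^] (k :: int) \<in> Units G"
proof (cases k)
  case (nonneg m)
  then show ?thesis using Units_pow_closed[OF assms] by (simp only: int_pow_int)
next
  case (neg m)
  have "inv (u [^] Suc m) \<in> Units G"
    using Units_pow_closed[OF assms, of "Suc m"] by (rule Units_inv_Units)
  then show ?thesis using neg by (simp only: int_pow_neg_Suc)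
qed

text \<open>For a negative exponent, the inverse of \<open>u [^] Suc m\<close> starts with a factor
  \<open>inv u\<close>, which cancels against \<open>u\<close> and leaves the inverse of
  \<open>u [^] m\<close>.\<close>

lemma Units_int_pow_plus_one:
  assumes u: "u \<in> Units G"
  shows "u \<otimes> u [^] (k :: int) = u [^] (k + 1)"
proof (cases k)
  case (nonneg m)
  have "k + 1 = int (Suc m)" using nonneg by simp
  then show ?thesis
    using nonneg nat_pow_Suc2[OF Units_closed[OF u], of m] by (simp only: int_pow_int)
next
  case (neg m)
  have um: "u [^] m \<in> Units G" using u by (rule Units_pow_closed)
  have "inv (u [^] Suc m) = inv u \<otimes> inv (u [^] m)"
  proof (rule inv_unique'[symmetric])
    show "u [^] Suc m \<otimes> (inv u \<otimes> inv (u [^] m)) = \<one>"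
      using u um by (simp add: m_assoc Units_closed flip: m_assoc[of u "inv u"])
    show "inv u \<otimes> inv (u [^] m) \<otimes> u [^] Suc m = \<one>"
      using u um by (simp add: m_assoc Units_closed flip: m_assoc[of "inv (u [^] m)" "u [^] m"])
  qed (use u um in \<open>auto simp: Units_closed\<close>)
  then have "u \<otimes> u [^] k = u \<otimes> (inv u \<otimes> inv (u [^] m))"
    using neg by (simp only: int_pow_neg_Suc)
  also have "\<dots> = inv (u [^] m)"
    using u um by (simp add: Units_closed flip: m_assoc)
  also have "\<dots> = u [^] (k + 1)"
  proof (cases m)
    case 0
    then show ?thesis using neg by simp
  next
    case (Suc m')
    then have "k + 1 = - int (Suc m')" using neg by simp
    then show ?thesis using Suc by (simp only: int_pow_neg_Suc)
  qed
  finally show ?thesis .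
qed

lemma Units_inv_int_pow:
  assumes u: "u \<in> Units G"
  shows "inv u \<otimes> u [^] (k :: int) = u [^] (k - 1)"
proof -
  have "inv u \<otimes> u [^] k = inv u \<otimes> (u \<otimes> u [^] (k - 1))"
    using Units_int_pow_plus_one[OF u, of "k - 1"] by simp
  also have "\<dots> = u [^] (k - 1)"
    using u Units_int_pow_closed[OF u, of "k - 1"] by (simp add: Units_closed flip: m_assoc)
  finally show ?thesis .
qed

end

section \<open>Elements that commute up to a nonzero scalar\<close>

context complex_algebra
begin

text \<open>The scalar stays existential because spanning needs no explicit value. It is nonzero so
  that the relation can be reversed and passed to inverses.\<close>

definition qcomm :: "'a \<Rightarrow> 'a \<Rightarrow> bool" where
  "qcomm u v \<longleftrightarrow> (\<exists>c. u \<otimes> v = c \<odot> (v \<otimes> u) \<and> c \<noteq> 0)"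

lemma qcomm_mult:
  assumes "qcomm u v" "qcomm u w" "u \<in> carrier A" "v \<in> carrier A" "w \<in> carrier A"
  shows "qcomm u (v \<otimes> w)"
proof -
  obtain c d where c: "u \<otimes> v = c \<odot> (v \<otimes> u)" "c \<noteq> 0" and d: "u \<otimes> w = d \<odot> (w \<otimes> u)" "d \<noteq> 0"
    using assms by (auto simp: qcomm_def)
  have "u \<otimes> (v \<otimes> w) = c \<odot> (v \<otimes> (u \<otimes> w))"
    using assms c by (simp add: mult_smult_left m_assoc flip: m_assoc[of u v w])
  also have "\<dots> = (c * d) \<odot> (v \<otimes> w \<otimes> u)"
    using assms d by (simp add: mult_smult_right smult_smult m_assoc)
  finally show ?thesis using c(2) d(2) unfolding qcomm_def by (metis mult_eq_0_iff)
qed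

text \<open>Multiplying the relation by \<open>inv v\<close> on both sides exchanges the roles of
  the two products; dividing by the scalar gives the claim.\<close>

lemma qcomm_inv_right:
  assumes "qcomm u v" "u \<in> carrier A" "v \<in> Units A"
  shows "qcomm u (inv v)"
proof -
  obtain c where c: "u \<otimes> v = c \<odot> (v \<otimes> u)" "c \<noteq> 0"
    using assms by (auto simp: qcomm_def)
  have v: "v \<in> carrier A" "inv v \<in> carrier A" using assms by auto
  have "inv v \<otimes> u = inv v \<otimes> ((u \<otimes> v) \<otimes> inv v)"
    using assms v by (simp add: m_assoc)
  also have "\<dots> = c \<odot> (inv v \<otimes> v \<otimes> (u \<otimes> inv v))"
    using assms v c by (simp add: mult_smult_left mult_smult_right m_assoc del: Units_l_inv)
  also have "\<dots> = c \<odot> (u \<otimes> inv v)" using assms v by simp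
  finally have "u \<otimes> inv v = inverse c \<odot> (inv v \<otimes> u)"
    using assms v c(2) by (simp add: smult_smult)
  then show ?thesis using c(2) unfolding qcomm_def by (metis inverse_nonzero_iff_nonzero)
qed

lemma qcomm_sym:
  assumes "qcomm u v" "u \<in> carrier A" "v \<in> carrier A"
  shows "qcomm v u"
proof -
  obtain c where c: "u \<otimes> v = c \<odot> (v \<otimes> u)" "c \<noteq> 0"
    using assms by (auto simp: qcomm_def)
  then have "v \<otimes> u = inverse c \<odot> (u \<otimes> v)"
    using assms by (simp add: smult_smult)
  then show ?thesis using c(2) unfolding qcomm_def by (metis inverse_nonzero_iff_nonzero)
qed

lemma qcomm_one: "u \<in> carrier A \<Longrightarrow> qcomm u \<one>"
  unfolding qcomm_def by (intro exI[of _ 1]) simp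

lemma qcomm_int_pow:
  assumes "qcomm u v" "u \<in> carrier A" "v \<in> Units A"
  shows "qcomm u (v [^] (k :: int))"
proof -
  have nat: "qcomm u (v [^] m)" for m :: nat
  proof (induction m)
    case (Suc m)
    then show ?case using assms(1-3) by (simp add: qcomm_mult Units_closed)
  qed (simp add: assms(2) qcomm_one)
  show ?thesis
  proof (cases k)
    case (nonneg m)
    then show ?thesis using nat by (simp only: int_pow_int)
  next
    case (neg m)
    have "qcomm u (inv (v [^] Suc m))"
      using nat assms(2) Units_pow_closed[OF assms(3)] by (rule qcomm_inv_right)
    then show ?thesis using neg by (simp only: int_pow_neg_Suc)
  qed
qed

end

section \<open>The presented algebra and its ordered monomials\<close>

locale quasi_laurent_algebra =
  fixes q :: complex and H :: "int mat" and n :: nat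
  assumes q_nonzero: "q \<noteq> 0" and H_carrier: "H \<in> carrier_mat n n"
begin

abbreviation "F \<equiv> ql_free H"
abbreviation "L \<equiv> \<L> q H"
abbreviation "x \<equiv> ql_gen q H"
abbreviation "letters \<equiv> Gen ` {..<n} \<union> GenInv ` {..<n}"
abbreviation "words \<equiv> \<lparr>carrier = lists letters, monoid.mult = (@), monoid.one = []\<rparr>"
abbreviation "proj \<equiv> (+>\<^bsub>F\<^esub>) (ql_ideal q H)"

lemma dim_H [simp]: "dim_row H = n" "dim_col H = n"
  using H_carrier by auto

lemma F_eq: "F = twisted_algebra words (\<lambda>_ _. 1)"
  by (simp add: ql_free_def free_algebra_def monoid_algebra_twisted)

lemma words_twisted: "twisted_monoid words (\<lambda>_ _. 1)"
  by (rule twisted_monoid_trivial) (rule monoidI, auto)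

sublocale W: twisted_monoid words "\<lambda>_ _. 1"
  by (rule words_twisted)

sublocale F: complex_algebra F
  using W.complex_algebra_twisted by (simp add: F_eq)

lemma F_carrier: "carrier F = {f. Poly_Mapping.keys f \<subseteq> lists letters}"
  by (simp add: F_eq)

lemma relations_subset: "ql_relations q H \<subseteq> carrier F"
  unfolding ql_relations_def F_carrier using q_nonzero
  by (auto simp: in_keys_iff lookup_minus lookup_single when_def split: if_splits)

lemma ideal_ql_ideal: "ideal (ql_ideal q H) F"
  unfolding ql_ideal_def by (rule F.genideal_ideal[OF relations_subset])

sublocale L: complex_algebra L
  unfolding quasi_laurent_def by (rule F.complex_algebra_quot_alg(1)[OF ideal_ql_ideal])

lemma proj_hom: "alg_hom F L proj"
  unfolding quasi_laurent_def by (rule F.complex_algebra_quot_alg(2)[OF ideal_ql_ideal])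

lemma proj_surj: "carrier L = proj ` carrier F"
  unfolding quasi_laurent_def by (rule F.complex_algebra_quot_alg(3)[OF ideal_ql_ideal])

lemma word_in_F: "w \<in> lists letters \<Longrightarrow> Poly_Mapping.single w c \<in> carrier F"
  by (simp add: F_carrier)

lemma proj_relation:
  assumes "f - g \<in> ql_relations q H" "f \<in> carrier F" "g \<in> carrier F"
  shows "proj f = proj g"
proof -
  have "f \<ominus>\<^bsub>F\<^esub> g = f - g"
    using assms W.twisted_minus[of f g] by (simp add: F_eq)
  then have "f \<ominus>\<^bsub>F\<^esub> g \<in> ql_ideal q H"
    using F.genideal_self[OF relations_subset] assms(1) by (auto simp: ql_ideal_def)
  then show ?thesis
    using F.quot_alg_eq_iff[OF ideal_ql_ideal] assms by blast
qed

lemma word_mult: "Poly_Mapping.single v c \<otimes>\<^bsub>F\<^esub> Poly_Mapping.single w d = Poly_Mapping.single (v @ w) (c * d)"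
  by (simp add: F_eq)

lemma proj_word_append:
  assumes "v \<in> lists letters" "w \<in> lists letters"
  shows "proj (word (v @ w)) = proj (word v) \<otimes>\<^bsub>L\<^esub> proj (word w)"
  using alg_homD(3)[OF proj_hom word_in_F[OF assms(1), of 1] word_in_F[OF assms(2), of 1]]
  by (simp add: word_mult)

lemma proj_word_Nil: "proj (word []) = \<one>\<^bsub>L\<^esub>"
  using alg_homD(5)[OF proj_hom] by (simp add: F_eq)

lemma x_eq: "x i = proj (word [Gen i])"
  by (simp add: ql_gen_def)

lemma x_unit:
  assumes i: "i < n"
  shows "x i \<in> Units L" and "inv\<^bsub>L\<^esub> (x i) = proj (word [GenInv i])"
proof -
  let ?y = "proj (word [GenInv i])"
  have c: "x i \<in> carrier L" "?y \<in> carrier L"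
    using i by (auto simp: x_eq intro!: alg_homD(1)[OF proj_hom] word_in_F)
  have "proj (word [Gen i, GenInv i]) = proj (word [])"
    using i by (intro proj_relation word_in_F) (auto simp: ql_relations_def)
  then have 1: "x i \<otimes>\<^bsub>L\<^esub> ?y = \<one>\<^bsub>L\<^esub>"
    using i proj_word_append[of "[Gen i]" "[GenInv i]"] by (simp add: x_eq proj_word_Nil)
  have "proj (word [GenInv i, Gen i]) = proj (word [])"
    using i by (intro proj_relation word_in_F) (auto simp: ql_relations_def)
  then have 2: "?y \<otimes>\<^bsub>L\<^esub> x i = \<one>\<^bsub>L\<^esub>"
    using i proj_word_append[of "[GenInv i]" "[Gen i]"] by (simp add: x_eq proj_word_Nil)
  show "x i \<in> Units L" using c 1 2 unfolding Units_def by blast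
  show "inv\<^bsub>L\<^esub> (x i) = ?y" using L.inv_unique'[OF c 1 2] by simp
qed

lemma x_closed [simp]: "i < n \<Longrightarrow> x i \<in> carrier L"
  using x_unit(1) L.Units_closed by blast

lemma x_qcomm:
  assumes "i < n" "j < n"
  shows "L.qcomm (x i) (x j)"
proof -
  let ?c = "q powi (H $$ (i, j))"
  have "proj (word [Gen i, Gen j]) = proj (Poly_Mapping.single [Gen j, Gen i] ?c)"
    using assms by (intro proj_relation word_in_F) (auto simp: ql_relations_def)
  also have "Poly_Mapping.single [Gen j, Gen i] ?c = ?c \<odot>\<^bsub>F\<^esub> word [Gen j, Gen i]"
    by (simp add: F_eq)
  also have "proj \<dots> = ?c \<odot>\<^bsub>L\<^esub> proj (word [Gen j, Gen i])"
    using assms by (intro alg_homD(4)[OF proj_hom] word_in_F) auto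
  finally have "x i \<otimes>\<^bsub>L\<^esub> x j = ?c \<odot>\<^bsub>L\<^esub> (x j \<otimes>\<^bsub>L\<^esub> x i)"
    using assms proj_word_append[of "[Gen i]" "[Gen j]"] proj_word_append[of "[Gen j]" "[Gen i]"]
    by (simp add: x_eq)
  then show ?thesis using q_nonzero unfolding L.qcomm_def by (intro exI[of _ ?c]) auto
qed

text \<open>The index list is arbitrary to permit induction on it, and the exponents form a function
  so that a single one can be updated.\<close>

definition monom_list :: "nat list \<Rightarrow> (nat \<Rightarrow> int) \<Rightarrow> free_elem set" where
  "monom_list js a = foldr (\<lambda>j p. (x j [^]\<^bsub>L\<^esub> a j) \<otimes>\<^bsub>L\<^esub> p) js \<one>\<^bsub>L\<^esub>"

lemma monom_list_simps [simp]:
  "monom_list [] a = \<one>\<^bsub>L\<^esub>"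
  "monom_list (j # js) a = (x j [^]\<^bsub>L\<^esub> a j) \<otimes>\<^bsub>L\<^esub> monom_list js a"
  by (simp_all add: monom_list_def)

lemma x_pow_closed [simp]: "i < n \<Longrightarrow> x i [^]\<^bsub>L\<^esub> (k :: int) \<in> carrier L"
  using L.Units_int_pow_closed[OF x_unit(1)] L.Units_closed by blast

lemma monom_list_closed [simp]: "set js \<subseteq> {..<n} \<Longrightarrow> monom_list js a \<in> carrier L"
  by (induction js) auto

lemma monom_list_cong:
  "(\<And>j. j \<in> set js \<Longrightarrow> a j = b j) \<Longrightarrow> monom_list js a = monom_list js b"
  by (induction js) auto

lemma ql_monomial_eq: "ql_monomial q H \<alpha> = monom_list [0..<n] (($) \<alpha>)"
  by (simp add: ql_monomial_def monom_list_def)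

lemma ql_monomial_vec: "ql_monomial q H (Matrix.vec n a) = monom_list [0..<n] a"
  unfolding ql_monomial_eq by (rule monom_list_cong) auto

lemma ql_monomial_closed [simp]: "ql_monomial q H \<alpha> \<in> carrier L"
  by (simp add: ql_monomial_eq subset_eq)

text \<open>The factor \<open>u\<close> moves to the right past the powers of other generators, at
  the cost of scalars, until it is absorbed by the power of \<open>x i\<close>. The pair of
  \<open>u\<close> and \<open>s\<close> treats a generator and its inverse at once.\<close>

lemma unit_mult_monom_list:
  assumes i: "i < n" and u: "u = x i \<and> s = 1 \<or> u = inv\<^bsub>L\<^esub> (x i) \<and> s = -1"
    and js: "set js \<subseteq> {..<n}" "distinct js" "i \<in> set js"
  shows "\<exists>c. u \<otimes>\<^bsub>L\<^esub> monom_list js a = c \<odot>\<^bsub>L\<^esub> monom_list js (a(i := a i + s))"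
  using js
proof (induction js)
  case (Cons j js)
  have uc: "u \<in> carrier L" using u i x_unit(1)[OF i] by auto
  have j: "j < n" and js: "set js \<subseteq> {..<n}" using Cons.prems by auto
  show ?case
  proof (cases "j = i")
    case True
    have "u \<otimes>\<^bsub>L\<^esub> x i [^]\<^bsub>L\<^esub> a i = x i [^]\<^bsub>L\<^esub> (a i + s)"
      using u L.Units_int_pow_plus_one[OF x_unit(1)[OF i]] L.Units_inv_int_pow[OF x_unit(1)[OF i]]
      by auto
    \<comment> \<open>By \<open>distinct\<close>, the changed index does not occur in the
      tail.\<close>
    moreover have "monom_list js (a(i := a i + s)) = monom_list js a"
      using Cons.prems True by (intro monom_list_cong) auto
    ultimately have "u \<otimes>\<^bsub>L\<^esub> monom_list (j # js) a = monom_list (j # js) (a(i := a i + s))"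
      using True i js uc by (simp flip: L.m_assoc)
    then show ?thesis
      using L.smult_one[OF monom_list_closed[OF Cons.prems(1)]] by metis
  next
    case False
    then have "i \<in> set js" "distinct js" using Cons.prems by auto
    then obtain c where c: "u \<otimes>\<^bsub>L\<^esub> monom_list js a = c \<odot>\<^bsub>L\<^esub> monom_list js (a(i := a i + s))"
      using Cons.IH js by blast
    have "L.qcomm u (x j)"
      using u
    proof (elim disjE conjE)
      assume "u = inv\<^bsub>L\<^esub> (x i)"
      moreover have "L.qcomm (x j) (inv\<^bsub>L\<^esub> (x i))"
        using x_qcomm[OF j i] x_closed[OF j] x_unit(1)[OF i] by (rule L.qcomm_inv_right)
      ultimately show ?thesis using j uc by (auto intro: L.qcomm_sym)
    qed (use x_qcomm[OF i j] in simp)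
    then have "L.qcomm u (x j [^]\<^bsub>L\<^esub> a j)"
      using uc x_unit(1)[OF j] by (rule L.qcomm_int_pow)
    then obtain d where d: "u \<otimes>\<^bsub>L\<^esub> x j [^]\<^bsub>L\<^esub> a j = d \<odot>\<^bsub>L\<^esub> (x j [^]\<^bsub>L\<^esub> a j \<otimes>\<^bsub>L\<^esub> u)"
      by (auto simp: L.qcomm_def)
    have "u \<otimes>\<^bsub>L\<^esub> monom_list (j # js) a = (u \<otimes>\<^bsub>L\<^esub> x j [^]\<^bsub>L\<^esub> a j) \<otimes>\<^bsub>L\<^esub> monom_list js a"
      using uc j js by (simp add: L.m_assoc)
    also have "\<dots> = d \<odot>\<^bsub>L\<^esub> (x j [^]\<^bsub>L\<^esub> a j \<otimes>\<^bsub>L\<^esub> (u \<otimes>\<^bsub>L\<^esub> monom_list js a))"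
      using uc j js by (simp add: d L.mult_smult_left L.m_assoc)
    also have "\<dots> = (d * c) \<odot>\<^bsub>L\<^esub> monom_list (j # js) (a(i := a i + s))"
      using j js False by (simp add: c L.mult_smult_right L.smult_smult)
    finally show ?thesis by blast
  qed
qed simp

text \<open>The letters are absorbed one at a time from the left, each shifting one exponent by 1 or
  -1.\<close>

lemma proj_word_monomial:
  assumes "w \<in> lists letters"
  shows "\<exists>c a. proj (word w) = c \<odot>\<^bsub>L\<^esub> monom_list [0..<n] a"
  using assms
proof (induction w)
  case Nil
  have "monom_list js (\<lambda>_. 0) = \<one>\<^bsub>L\<^esub>" for js
    by (induction js) auto
  then show ?case using proj_word_Nil by (intro exI[of _ 1] exI[of _ "\<lambda>_. 0"]) simp
next
  case (Cons l w)
  from Cons.IH obtain c a where ca: "proj (word w) = c \<odot>\<^bsub>L\<^esub> monom_list [0..<n] a" by blast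
  have set: "set [0..<n] \<subseteq> {..<n}" by auto
  obtain i u and s :: int where i: "i < n" and u: "u = proj (word [l])"
    and us: "u = x i \<and> s = 1 \<or> u = inv\<^bsub>L\<^esub> (x i) \<and> s = -1"
  proof -
    obtain i where i: "i < n" and l: "l = Gen i \<or> l = GenInv i" using Cons.hyps by auto
    from l show ?thesis
    proof
      assume "l = Gen i"
      then show ?thesis using that[OF i refl, of 1] by (simp add: x_eq)
    next
      assume "l = GenInv i"
      then show ?thesis using that[OF i refl, of "-1"] x_unit(2)[OF i] by simp
    qed
  qed
  then obtain d where d: "u \<otimes>\<^bsub>L\<^esub> monom_list [0..<n] a = d \<odot>\<^bsub>L\<^esub> monom_list [0..<n] (a(i := a i + s))"
    using unit_mult_monom_list[OF i us set distinct_upt, of a] i by (metis atLeastLessThan_iff set_upt zero_le)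
  have uc: "u \<in> carrier L" using us i x_unit(1)[OF i] by auto
  have "[l] \<in> lists letters" using Cons.hyps(1) by (intro lists.Cons lists.Nil)
  then have "proj (word (l # w)) = proj (word [l]) \<otimes>\<^bsub>L\<^esub> proj (word w)"
    using proj_word_append[of "[l]" w] Cons.hyps(2) by (simp only: append.simps)
  also have "\<dots> = u \<otimes>\<^bsub>L\<^esub> (c \<odot>\<^bsub>L\<^esub> monom_list [0..<n] a)"
    by (simp only: u ca)
  also have "\<dots> = (c * d) \<odot>\<^bsub>L\<^esub> monom_list [0..<n] (a(i := a i + s))"
    using uc set by (simp add: L.mult_smult_right d L.smult_smult)
  finally show ?case by blast
qed

text \<open>Spanning is put as a closure principle, the form that
  \<open>bij_betw_of_spanning_family\<close> takes; it holds because every element is the projection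
  of a combination of words.\<close>

lemma monomials_span:
  assumes "S \<subseteq> carrier L" "\<zero>\<^bsub>L\<^esub> \<in> S" "ql_monomial q H ` carrier_vec n \<subseteq> S"
    and add: "\<And>y z. y \<in> S \<Longrightarrow> z \<in> S \<Longrightarrow> y \<oplus>\<^bsub>L\<^esub> z \<in> S"
    and smult: "\<And>d y. y \<in> S \<Longrightarrow> d \<odot>\<^bsub>L\<^esub> y \<in> S"
  shows "S = carrier L"
proof -
  have "proj f \<in> S" if "Poly_Mapping.keys f \<subseteq> lists letters" for f
    using that
  proof (induction f rule: poly_mapping_induct_on)
    case zero
    have "proj 0 = \<zero>\<^bsub>L\<^esub>"
      using alg_hom_zero[OF proj_hom F.complex_algebra_axioms L.complex_algebra_axioms]
      by (simp add: F_eq)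
    then show ?case using assms by simp
  next
    case (single w c)
    obtain d a where da: "proj (word w) = d \<odot>\<^bsub>L\<^esub> monom_list [0..<n] a"
      using proj_word_monomial[OF single] by blast
    have "monom_list [0..<n] a \<in> S"
      unfolding ql_monomial_vec[symmetric] using assms(3) by auto
    moreover have "Poly_Mapping.single w c = c \<odot>\<^bsub>F\<^esub> word w"
      by (simp add: F_eq)
    moreover have "proj (c \<odot>\<^bsub>F\<^esub> word w) = c \<odot>\<^bsub>L\<^esub> proj (word w)"
      using single by (intro alg_homD(4)[OF proj_hom] word_in_F)
    ultimately show ?case by (simp add: da smult)
  next
    case (add f g)
    have "proj (f \<oplus>\<^bsub>F\<^esub> g) = proj f \<oplus>\<^bsub>L\<^esub> proj g"
      using add.hyps by (intro alg_homD(2)[OF proj_hom]) (auto simp: F_carrier)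
    moreover have "f + g = f \<oplus>\<^bsub>F\<^esub> g"
      by (simp add: F_eq)
    ultimately show ?case using add.IH assms(4) by simp
  qed
  then show ?thesis using assms(1) by (auto simp: proj_surj F_carrier)
qed

end


text \<open>Commutation is required for unit vectors only, since the defining relations involve just
  the generators. For other vectors the cocycle may be arbitrary.\<close>

locale quasi_laurent_realization =
  quasi_laurent_algebra q H n + M: twisted_monoid M \<omega>
  for q H n and M :: "('g, 'm) monoid_scheme" and \<omega> +
  fixes \<theta> :: "int vec \<Rightarrow> 'g"
  assumes \<theta>_bij: "bij_betw \<theta> (carrier_vec n) (carrier M)"
    and \<theta>_add: "\<alpha> \<in> carrier_vec n \<Longrightarrow> \<beta> \<in> carrier_vec n \<Longrightarrow> \<theta> (\<alpha> + \<beta>) = \<theta> \<alpha> \<otimes>\<^bsub>M\<^esub> \<theta> \<beta>"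
    and \<theta>_comm: "i < n \<Longrightarrow> j < n \<Longrightarrow> \<omega> (\<theta> (unit_vec n i)) (\<theta> (unit_vec n j)) =
      q powi (H $$ (i, j)) * \<omega> (\<theta> (unit_vec n j)) (\<theta> (unit_vec n i))"
begin

abbreviation "T \<equiv> twisted_algebra M \<omega>"

sublocale T: complex_algebra T
  by (rule M.complex_algebra_twisted)

lemma \<theta>_closed [simp]: "\<alpha> \<in> carrier_vec n \<Longrightarrow> \<theta> \<alpha> \<in> carrier M"
  using \<theta>_bij by (auto simp: bij_betw_def)

text \<open>\<open>M\<close> is only known to be a monoid, so instead of cancelling one multiplies
  by the image of a preimage of the unit.\<close>

lemma \<theta>_zero: "\<theta> (0\<^sub>v n) = \<one>\<^bsub>M\<^esub>"
proof -
  obtain \<gamma> where \<gamma>: "\<gamma> \<in> carrier_vec n" "\<theta> \<gamma> = \<one>\<^bsub>M\<^esub>"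
    using \<theta>_bij M.one_closed unfolding bij_betw_def by (metis imageE)
  have "\<theta> (0\<^sub>v n + \<gamma>) = \<theta> (0\<^sub>v n) \<otimes>\<^bsub>M\<^esub> \<theta> \<gamma>"
    using \<gamma> by (intro \<theta>_add) auto
  then show ?thesis using \<gamma> by simp
qed

abbreviation "e i \<equiv> (unit_vec n i :: int vec)"

text \<open>The coefficient of \<open>GenInv i\<close> cancels the cocycle value that arises on
  multiplication with the image of \<open>Gen i\<close>.\<close>

definition letter_image :: "letter \<Rightarrow> ('g \<Rightarrow>\<^sub>0 complex)" where
  "letter_image l = (case l of
      Gen i \<Rightarrow> Poly_Mapping.single (\<theta> (e i)) 1
    | GenInv i \<Rightarrow> Poly_Mapping.single (\<theta> (- e i)) (1 / \<omega> (\<theta> (e i)) (\<theta> (- e i))))"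

definition word_image :: "letter list \<Rightarrow> ('g \<Rightarrow>\<^sub>0 complex)" where
  "word_image w = foldr (\<lambda>l p. letter_image l \<otimes>\<^bsub>T\<^esub> p) w \<one>\<^bsub>T\<^esub>"

lemma word_image_simps [simp]:
  "word_image [] = \<one>\<^bsub>T\<^esub>"
  "word_image (l # w) = letter_image l \<otimes>\<^bsub>T\<^esub> word_image w"
  by (simp_all add: word_image_def del: twisted_algebra_simps)

lemma letter_image_closed: "l \<in> letters \<Longrightarrow> letter_image l \<in> carrier T"
  by (auto simp: letter_image_def split: if_splits)

lemma word_image_closed: "w \<in> lists letters \<Longrightarrow> word_image w \<in> carrier T"
proof (induction w)
  case Nil
  show ?case unfolding word_image_simps by (rule T.one_closed)
next
  case (Cons l w)
  then have "letter_image l \<in> carrier T" "word_image w \<in> carrier T"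
    by (auto intro!: letter_image_closed simp del: twisted_algebra_simps)
  then show ?case
    unfolding word_image_simps by (rule T.m_closed)
qed

lemma word_image_append:
  assumes "v \<in> lists letters" "w \<in> lists letters"
  shows "word_image (v @ w) = word_image v \<otimes>\<^bsub>T\<^esub> word_image w"
  using assms(1)
proof (induction v)
  case Nil
  show ?case unfolding word_image_simps append.simps
    using word_image_closed[OF assms(2)] by (rule T.l_one[symmetric])
next
  case (Cons l v)
  then show ?case
    using letter_image_closed[OF Cons.hyps(1)] word_image_closed assms(2)
    by (simp only: append.simps word_image_simps T.m_assoc)
qed

lemma \<theta>_uminus:
  assumes "\<alpha> \<in> carrier_vec n"
  shows "\<theta> \<alpha> \<otimes>\<^bsub>M\<^esub> \<theta> (- \<alpha>) = \<one>\<^bsub>M\<^esub>" "\<theta> (- \<alpha>) \<otimes>\<^bsub>M\<^esub> \<theta> \<alpha> = \<one>\<^bsub>M\<^esub>"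
  using assms \<theta>_add[of \<alpha> "- \<alpha>"] \<theta>_add[of "- \<alpha>" \<alpha>] uminus_l_inv_vec[OF assms] uminus_r_inv_vec[OF assms]
  by (simp_all add: \<theta>_zero)

text \<open>The cocycle identity at a, its inverse and a again. It makes one normalisation of
  \<open>GenInv i\<close> serve for the left and the right inverse.\<close>

lemma \<omega>_unit_minus:
  assumes "i < n"
  shows "\<omega> (\<theta> (- e i)) (\<theta> (e i)) = \<omega> (\<theta> (e i)) (\<theta> (- e i))"
  using M.cocycle[of "\<theta> (e i)" "\<theta> (- e i)" "\<theta> (e i)"] assms by (simp add: \<theta>_uminus M.cocycle_one)

lemma word_hom: "alg_hom F T (T.lin_ext word_image)"
  unfolding F_eq
proof (rule T.lin_ext_alg_hom[OF words_twisted])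
  show "word_image \<in> carrier words \<rightarrow> carrier T"
    using word_image_closed by auto
  fix v w assume vw: "v \<in> carrier words" "w \<in> carrier words"
  then have v: "v \<in> lists letters" and w: "w \<in> lists letters" by auto
  have "word_image v \<otimes>\<^bsub>T\<^esub> word_image w = word_image (v @ w)"
    by (rule word_image_append[OF v w, symmetric])
  also have "\<dots> = 1 \<odot>\<^bsub>T\<^esub> word_image (v @ w)"
    using word_image_closed[of "v @ w"] v w by (intro T.smult_one[symmetric]) auto
  finally show "word_image v \<otimes>\<^bsub>T\<^esub> word_image w = 1 \<odot>\<^bsub>T\<^esub> word_image (v \<otimes>\<^bsub>words\<^esub> w)"
    by (simp only: monoid.simps)
qed (simp del: twisted_algebra_simps)

lemma word_hom_single:
  assumes "w \<in> lists letters"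
  shows "T.lin_ext word_image (Poly_Mapping.single w c) = c \<odot>\<^bsub>T\<^esub> word_image w"
  using word_image_closed[OF assms] by (rule T.lin_ext_single)

lemma word_hom_relation:
  assumes "r \<in> ql_relations q H"
  shows "T.lin_ext word_image r = \<zero>\<^bsub>T\<^esub>"
proof -
  \<comment> \<open>Each relation is a difference of two scaled words, so it suffices to compare the
    images of these words.\<close>
  have minus: "T.lin_ext word_image (Poly_Mapping.single v c - Poly_Mapping.single w d) = \<zero>\<^bsub>T\<^esub>"
    if "v \<in> lists letters" "w \<in> lists letters" "c \<odot>\<^bsub>T\<^esub> word_image v = d \<odot>\<^bsub>T\<^esub> word_image w" for v w c d
  proof -
    have "Poly_Mapping.single v c - Poly_Mapping.single w d =
        Poly_Mapping.single v c \<ominus>\<^bsub>F\<^esub> Poly_Mapping.single w d"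
      unfolding F_eq by (rule W.twisted_minus[symmetric]) (use that(1,2) in auto)
    moreover have "T.lin_ext word_image (Poly_Mapping.single v c \<ominus>\<^bsub>F\<^esub> Poly_Mapping.single w d) =
        T.lin_ext word_image (Poly_Mapping.single v c) \<ominus>\<^bsub>T\<^esub> T.lin_ext word_image (Poly_Mapping.single w d)"
      using that by (intro alg_hom_minus[OF word_hom F.complex_algebra_axioms T.complex_algebra_axioms] word_in_F)
    moreover have "d \<odot>\<^bsub>T\<^esub> word_image w \<in> carrier T"
      using that(2) by (intro T.smult_closed word_image_closed)
    ultimately show ?thesis
      using that by (simp add: word_hom_single T.r_right_minus_eq del: twisted_algebra_simps)
  qed
  have one: "letter_image l \<otimes>\<^bsub>T\<^esub> \<one>\<^bsub>T\<^esub> = letter_image l" if "l \<in> letters" for l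
    using letter_image_closed[OF that] by (rule T.r_one)
  from assms consider
    (inv1) i where "i < n" "r = word [Gen i, GenInv i] - word []"
    | (inv2) i where "i < n" "r = word [GenInv i, Gen i] - word []"
    | (comm) i j where "i < n" "j < n"
      "r = word [Gen i, Gen j] - Poly_Mapping.single [Gen j, Gen i] (q powi (H $$ (i, j)))"
    by (auto simp: ql_relations_def)
  then show ?thesis
  proof cases
    case inv1
    have "letter_image (Gen i) \<otimes>\<^bsub>T\<^esub> letter_image (GenInv i) = \<one>\<^bsub>T\<^esub>"
      using inv1 M.cocycle_nonzero[of "\<theta> (e i)" "\<theta> (- e i)"]
      by (simp add: letter_image_def \<theta>_uminus)
    then show ?thesis unfolding inv1(2) using inv1(1)
      by (intro minus) (auto simp: one simp del: twisted_algebra_simps)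
  next
    case inv2
    have "letter_image (GenInv i) \<otimes>\<^bsub>T\<^esub> letter_image (Gen i) = \<one>\<^bsub>T\<^esub>"
      using inv2 M.cocycle_nonzero[of "\<theta> (e i)" "\<theta> (- e i)"]
      by (simp add: letter_image_def \<theta>_uminus \<omega>_unit_minus)
    then show ?thesis unfolding inv2(2) using inv2(1)
      by (intro minus) (auto simp: one simp del: twisted_algebra_simps)
  next
    case comm
    have "\<theta> (e i) \<otimes>\<^bsub>M\<^esub> \<theta> (e j) = \<theta> (e j) \<otimes>\<^bsub>M\<^esub> \<theta> (e i)"
      by (simp flip: \<theta>_add add: comm_add_vec[of "e i" n])
    then have "1 \<odot>\<^bsub>T\<^esub> (letter_image (Gen i) \<otimes>\<^bsub>T\<^esub> letter_image (Gen j)) =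
        (q powi (H $$ (i, j))) \<odot>\<^bsub>T\<^esub> (letter_image (Gen j) \<otimes>\<^bsub>T\<^esub> letter_image (Gen i))"
      using \<theta>_comm[OF comm(1,2)] by (simp add: letter_image_def)
    then show ?thesis unfolding comm(3) using comm(1,2)
      by (intro minus) (auto simp: one simp del: twisted_algebra_simps)
  qed
qed

text \<open>The map on words has an ideal as its kernel; containing the relations, this ideal
  contains \<open>ql_ideal\<close>.\<close>

lemma quotient_hom:
  obtains k where "alg_hom L T k" "\<And>i. i < n \<Longrightarrow> k (x i) = Poly_Mapping.single (\<theta> (e i)) 1"
proof -
  let ?K = "{f \<in> carrier F. T.lin_ext word_image f = \<zero>\<^bsub>T\<^esub>}"
  have "ideal ?K F"
    by (rule F.alg_hom_kernel_ideal[OF T.complex_algebra_axioms word_hom])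
  moreover have "ql_relations q H \<subseteq> ?K"
    using relations_subset word_hom_relation by auto
  ultimately have "ql_ideal q H \<subseteq> ?K"
    unfolding ql_ideal_def by (rule F.genideal_minimal)
  then obtain k where k: "alg_hom (quot_alg F (ql_ideal q H)) T k"
    "\<And>f. f \<in> carrier F \<Longrightarrow> k (proj f) = T.lin_ext word_image f"
    using F.quot_alg_lift[OF ideal_ql_ideal T.complex_algebra_axioms word_hom] by blast
  have "k (x i) = Poly_Mapping.single (\<theta> (e i)) 1" if "i < n" for i
  proof -
    have "k (x i) = 1 \<odot>\<^bsub>T\<^esub> (letter_image (Gen i) \<otimes>\<^bsub>T\<^esub> \<one>\<^bsub>T\<^esub>)"
      using that k(2)[OF word_in_F[of "[Gen i]" 1]] word_hom_single[of "[Gen i]" 1]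
      by (simp add: x_eq del: twisted_algebra_simps)
    then show ?thesis using that by (simp add: letter_image_def M.cocycle_one)
  qed
  then show thesis using k(1) that unfolding quasi_laurent_def by blast
qed

context
  fixes k
  assumes k: "alg_hom L T k" and kx: "\<And>i. i < n \<Longrightarrow> k (x i) = Poly_Mapping.single (\<theta> (e i)) 1"
begin

text \<open>Only the degree is tracked. The scalar is built from cocycle values, and its exact form
  never matters.\<close>

definition homogeneous :: "free_elem set \<Rightarrow> int vec \<Rightarrow> bool" where
  "homogeneous z \<alpha> \<longleftrightarrow> z \<in> carrier L \<and> \<alpha> \<in> carrier_vec n \<and>
     (\<exists>c. c \<noteq> 0 \<and> k z = Poly_Mapping.single (\<theta> \<alpha>) c)"

lemma homogeneous_one: "homogeneous \<one>\<^bsub>L\<^esub> (0\<^sub>v n)"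
  using alg_homD(5)[OF k] unfolding homogeneous_def by (intro conjI exI[of _ 1]) (auto simp: \<theta>_zero)

lemma homogeneous_mult:
  assumes "homogeneous z \<alpha>" "homogeneous y \<beta>"
  shows "homogeneous (z \<otimes>\<^bsub>L\<^esub> y) (\<alpha> + \<beta>)"
proof -
  obtain c d where *: "z \<in> carrier L" "y \<in> carrier L" "\<alpha> \<in> carrier_vec n" "\<beta> \<in> carrier_vec n"
    "c \<noteq> 0" "d \<noteq> 0" "k z = Poly_Mapping.single (\<theta> \<alpha>) c" "k y = Poly_Mapping.single (\<theta> \<beta>) d"
    using assms unfolding homogeneous_def by blast
  then have "k (z \<otimes>\<^bsub>L\<^esub> y) = Poly_Mapping.single (\<theta> (\<alpha> + \<beta>)) (\<omega> (\<theta> \<alpha>) (\<theta> \<beta>) * c * d)"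
    by (simp add: alg_homD(3)[OF k] \<theta>_add)
  moreover have "\<omega> (\<theta> \<alpha>) (\<theta> \<beta>) * c * d \<noteq> 0"
    using * M.cocycle_nonzero by simp
  ultimately show ?thesis using * unfolding homogeneous_def
    by (intro conjI exI[of _ "\<omega> (\<theta> \<alpha>) (\<theta> \<beta>) * c * d"]) simp_all
qed

text \<open>The multiple \<open>s\<close> of the opposite basis vector is a left inverse of
  \<open>k z\<close>, while the image of the inverse of \<open>z\<close> is a right inverse, so the
  two agree.\<close>

lemma homogeneous_inv:
  assumes z: "homogeneous z \<alpha>" and unit: "z \<in> Units L"
  shows "homogeneous (inv\<^bsub>L\<^esub> z) (- \<alpha>)"
proof -
  obtain c where *: "z \<in> carrier L" "\<alpha> \<in> carrier_vec n" "c \<noteq> 0" "k z = Poly_Mapping.single (\<theta> \<alpha>) c"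
    using z unfolding homogeneous_def by blast
  define d where "d = 1 / (\<omega> (\<theta> (- \<alpha>)) (\<theta> \<alpha>) * c)"
  define s where "s = Poly_Mapping.single (\<theta> (- \<alpha>)) d"
  have \<omega>: "\<omega> (\<theta> (- \<alpha>)) (\<theta> \<alpha>) \<noteq> 0" using * by (intro M.cocycle_nonzero) auto
  have "\<theta> (- \<alpha>) \<otimes>\<^bsub>M\<^esub> \<theta> \<alpha> = \<one>\<^bsub>M\<^esub>"
    using *(2) by (rule \<theta>_uminus)
  then have sz: "s \<otimes>\<^bsub>T\<^esub> k z = \<one>\<^bsub>T\<^esub>"
    using * \<omega> by (simp add: s_def d_def)
  have zi: "inv\<^bsub>L\<^esub> z \<in> carrier L" using unit by simp
  have kz: "k z \<otimes>\<^bsub>T\<^esub> k (inv\<^bsub>L\<^esub> z) = \<one>\<^bsub>T\<^esub>"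
    using alg_homD(3)[OF k *(1) zi] alg_homD(5)[OF k] L.Units_r_inv[OF unit]
    by (simp del: twisted_algebra_simps)
  have s: "s \<in> carrier T" using * by (simp add: s_def)
  note kc = alg_homD(1)[OF k *(1)] alg_homD(1)[OF k zi]
  have "k (inv\<^bsub>L\<^esub> z) = (s \<otimes>\<^bsub>T\<^esub> k z) \<otimes>\<^bsub>T\<^esub> k (inv\<^bsub>L\<^esub> z)"
    unfolding sz using kc(2) by (rule T.l_one[symmetric])
  also have "\<dots> = s \<otimes>\<^bsub>T\<^esub> (k z \<otimes>\<^bsub>T\<^esub> k (inv\<^bsub>L\<^esub> z))"
    using s kc by (rule T.m_assoc)
  also have "\<dots> = s" unfolding kz using s by (rule T.r_one)
  finally have "k (inv\<^bsub>L\<^esub> z) = Poly_Mapping.single (\<theta> (- \<alpha>)) d" by (simp add: s_def)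
  moreover have "d \<noteq> 0" using * \<omega> by (simp add: d_def)
  ultimately show ?thesis using * zi unfolding homogeneous_def by auto
qed

lemma homogeneous_x_nat_pow:
  assumes "i < n"
  shows "homogeneous (x i [^]\<^bsub>L\<^esub> m) (int m \<cdot>\<^sub>v e i)"
proof (induction m)
  case 0
  have "int 0 \<cdot>\<^sub>v e i = 0\<^sub>v n" by (intro eq_vecI) auto
  then show ?case using homogeneous_one by simp
next
  case (Suc m)
  have "homogeneous (x i) (e i)"
    using assms kx unfolding homogeneous_def by (intro conjI exI[of _ 1]) auto
  with Suc have "homogeneous (x i [^]\<^bsub>L\<^esub> m \<otimes>\<^bsub>L\<^esub> x i) (int m \<cdot>\<^sub>v e i + e i)"
    by (rule homogeneous_mult)
  moreover have "int m \<cdot>\<^sub>v e i + e i = int (Suc m) \<cdot>\<^sub>v e i"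
    by (intro eq_vecI) (auto simp: algebra_simps)
  ultimately show ?case by simp
qed

lemma homogeneous_x_int_pow:
  assumes "i < n"
  shows "homogeneous (x i [^]\<^bsub>L\<^esub> a) (a \<cdot>\<^sub>v e i)"
proof (cases a)
  case (nonneg m)
  then show ?thesis using homogeneous_x_nat_pow[OF assms] by (simp only: int_pow_int)
next
  case (neg m)
  have "homogeneous (inv\<^bsub>L\<^esub> (x i [^]\<^bsub>L\<^esub> Suc m)) (- (int (Suc m) \<cdot>\<^sub>v e i))"
    by (rule homogeneous_inv[OF homogeneous_x_nat_pow[OF assms] L.Units_pow_closed[OF x_unit(1)[OF assms]]])
  moreover have "- (int (Suc m) \<cdot>\<^sub>v e i) = a \<cdot>\<^sub>v e i"
    unfolding neg by (intro eq_vecI) (auto simp: algebra_simps)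
  ultimately show ?thesis using neg by (simp only: L.int_pow_neg_Suc)
qed

lemma homogeneous_monom_list:
  assumes "set js \<subseteq> {..<n}" "distinct js"
  shows "homogeneous (monom_list js a) (Matrix.vec n (\<lambda>i. if i \<in> set js then a i else 0))"
  using assms
proof (induction js)
  case Nil
  have "Matrix.vec n (\<lambda>i. if i \<in> set [] then a i else 0) = 0\<^sub>v n" by (intro eq_vecI) auto
  then show ?case using homogeneous_one by simp
next
  case (Cons j js)
  then have j: "j < n" and js: "set js \<subseteq> {..<n}" "distinct js" "j \<notin> set js" by auto
  have "homogeneous (monom_list (j # js) a)
      (a j \<cdot>\<^sub>v e j + Matrix.vec n (\<lambda>i. if i \<in> set js then a i else 0))"
    unfolding monom_list_simps
    by (rule homogeneous_mult[OF homogeneous_x_int_pow[OF j] Cons.IH[OF js(1,2)]])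
  moreover have "a j \<cdot>\<^sub>v e j + Matrix.vec n (\<lambda>i. if i \<in> set js then a i else 0) =
      Matrix.vec n (\<lambda>i. if i \<in> set (j # js) then a i else 0)"
    using j js by (intro eq_vecI) (auto simp: unit_vec_def)
  ultimately show ?case by simp
qed

lemma homogeneous_monomial:
  assumes "\<alpha> \<in> carrier_vec n"
  shows "homogeneous (ql_monomial q H \<alpha>) \<alpha>"
proof -
  have "homogeneous (ql_monomial q H \<alpha>) (Matrix.vec n (\<lambda>i. if i \<in> set [0..<n] then \<alpha> $ i else 0))"
    unfolding ql_monomial_eq by (rule homogeneous_monom_list) auto
  moreover have "Matrix.vec n (\<lambda>i. if i \<in> set [0..<n] then \<alpha> $ i else 0) = \<alpha>"
    using assms by (intro eq_vecI) auto
  ultimately show ?thesis by simp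
qed

end

text \<open>The factors \<open>c\<close> are exported with the isomorphism because later arguments
  on coefficients divide by them.\<close>

theorem realization_iso:
  obtains k c where "alg_hom L T k" "bij_betw k (carrier L) (carrier T)"
    "\<And>\<alpha>. \<alpha> \<in> carrier_vec n \<Longrightarrow> c \<alpha> \<noteq> 0"
    "\<And>\<alpha>. \<alpha> \<in> carrier_vec n \<Longrightarrow> k (ql_monomial q H \<alpha>) = Poly_Mapping.single (\<theta> \<alpha>) (c \<alpha>)"
proof -
  obtain k where k: "alg_hom L T k" "\<And>i. i < n \<Longrightarrow> k (x i) = Poly_Mapping.single (\<theta> (e i)) 1"
    using quotient_hom by blast
  have "\<exists>c. c \<noteq> 0 \<and> k (ql_monomial q H \<alpha>) = Poly_Mapping.single (\<theta> \<alpha>) c" if "\<alpha> \<in> carrier_vec n" for \<alpha>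
    using homogeneous_monomial[OF k that] homogeneous_def[OF k] by blast
  then obtain c where c: "\<And>\<alpha>. \<alpha> \<in> carrier_vec n \<Longrightarrow> c \<alpha> \<noteq> 0"
    "\<And>\<alpha>. \<alpha> \<in> carrier_vec n \<Longrightarrow> k (ql_monomial q H \<alpha>) = Poly_Mapping.single (\<theta> \<alpha>) (c \<alpha>)"
    by metis
  have "bij_betw k (carrier L) (carrier T)"
  proof (rule bij_betw_of_spanning_family[OF L.complex_algebra_axioms M.twisted_monoid_axioms k(1) \<theta>_bij])
    fix S assume "S \<subseteq> carrier L" "\<zero>\<^bsub>L\<^esub> \<in> S" "ql_monomial q H ` carrier_vec n \<subseteq> S"
      "\<And>y z. y \<in> S \<Longrightarrow> z \<in> S \<Longrightarrow> y \<oplus>\<^bsub>L\<^esub> z \<in> S" "\<And>d y. y \<in> S \<Longrightarrow> d \<odot>\<^bsub>L\<^esub> y \<in> S"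
    then show "S = carrier L" by (rule monomials_span)
  qed (use c in \<open>simp_all del: twisted_algebra_simps\<close>)
  with k c that show thesis by blast
qed

end


section \<open>Tensor products of twisted monoid algebras\<close>

subsection \<open>Direct products of twisted monoids\<close>

lemma DirProd_list_Nil:
  "carrier (DirProd_list []) = {[]}" "xs \<otimes>\<^bsub>DirProd_list []\<^esub> ys = []" "\<one>\<^bsub>DirProd_list []\<^esub> = []"
  by (simp_all add: DirProd_list_def)

lemma DirProd_list_Cons_carrier:
  "zs \<in> carrier (DirProd_list (G # Gs)) \<longleftrightarrow>
    (\<exists>x xs. zs = x # xs \<and> x \<in> carrier G \<and> xs \<in> carrier (DirProd_list Gs))"
  by (auto simp: DirProd_list_carrier)

lemma DirProd_list_Cons_one: "\<one>\<^bsub>DirProd_list (G # Gs)\<^esub> = \<one>\<^bsub>G\<^esub> # \<one>\<^bsub>DirProd_list Gs\<^esub>"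
  by (simp add: DirProd_list_one)

text \<open>The product of \<open>DirProd_list\<close> is transported along the list constructor, so
  it can be computed only on carriers, where \<open>inv_into\<close> cancels.\<close>

lemma DirProd_list_Cons_mult:
  assumes "x \<in> carrier G" "y \<in> carrier G"
    "xs \<in> carrier (DirProd_list Gs)" "ys \<in> carrier (DirProd_list Gs)"
  shows "(x # xs) \<otimes>\<^bsub>DirProd_list (G # Gs)\<^esub> (y # ys) = (x \<otimes>\<^bsub>G\<^esub> y) # (xs \<otimes>\<^bsub>DirProd_list Gs\<^esub> ys)"
proof -
  let ?f = "\<lambda>(g, gs). g # gs" and ?D = "G \<times>\<times> DirProd_list Gs"
  have inv: "inv_into (carrier ?D) ?f (z # zs) = (z, zs)"
    if "z \<in> carrier G" "zs \<in> carrier (DirProd_list Gs)" for z zs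
    using inv_into_f_f[OF inj_on_DirProd_carrier, of "(z, zs)" G Gs] that by (simp add: DirProd_def)
  have "DirProd_list (G # Gs) = image_group ?f ?D"
    by (simp add: DirProd_list_def)
  then show ?thesis
    using inv assms by (simp add: image_group_def)
qed

lemma DirProd_list_mult_closed:
  assumes "\<forall>G \<in> set Gs. monoid G"
    "xs \<in> carrier (DirProd_list Gs)" "ys \<in> carrier (DirProd_list Gs)"
  shows "xs \<otimes>\<^bsub>DirProd_list Gs\<^esub> ys \<in> carrier (DirProd_list Gs)"
  using assms
proof (induction Gs arbitrary: xs ys)
  case (Cons G Gs)
  then show ?case
    by (auto simp: DirProd_list_Cons_carrier DirProd_list_Cons_mult monoid.m_closed)
qed (simp add: DirProd_list_Nil)

lemma monoid_DirProd_list: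
  assumes "\<forall>G \<in> set Gs. monoid G"
  shows "monoid (DirProd_list Gs)"
  using assms
proof (induction Gs)
  case Nil
  show ?case by (rule monoidI) (auto simp: DirProd_list_Nil)
next
  case (Cons G Gs)
  then have G: "monoid G" and Gs: "monoid (DirProd_list Gs)" by auto
  show ?case
    by (rule monoidI)
      (auto simp: DirProd_list_Cons_carrier DirProd_list_Cons_mult DirProd_list_Cons_one
        monoid.m_closed[OF G] monoid.m_closed[OF Gs] monoid.one_closed[OF G] monoid.one_closed[OF Gs]
        monoid.m_assoc[OF G] monoid.m_assoc[OF Gs] monoid.l_one[OF G] monoid.l_one[OF Gs]
        monoid.r_one[OF G] monoid.r_one[OF Gs])
qed

text \<open>The default value 1 is the trivial cocycle of the empty product.\<close>

fun prod_cocycle :: "('g \<Rightarrow> 'g \<Rightarrow> complex) list \<Rightarrow> 'g list \<Rightarrow> 'g list \<Rightarrow> complex" where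
  "prod_cocycle (w # ws) (a # as) (b # bs) = w a b * prod_cocycle ws as bs"
| "prod_cocycle _ _ _ = 1"

lemma twisted_monoid_DirProd_list:
  assumes "list_all2 twisted_monoid Gs ws"
  shows "twisted_monoid (DirProd_list Gs) (prod_cocycle ws)"
  using assms
proof (induction rule: list_all2_induct)
  case Nil
  have "monoid (DirProd_list [] :: 'a list monoid)" by (rule monoid_DirProd_list) simp
  then show ?case
    by (auto simp: twisted_monoid_def twisted_monoid_axioms_def DirProd_list_Nil)
next
  case (Cons G Gs w ws)
  interpret G: twisted_monoid G w by fact
  interpret D: twisted_monoid "DirProd_list Gs" "prod_cocycle ws" by fact
  have "\<forall>K \<in> set (G # Gs). monoid K"
    using Cons.hyps by (auto simp: twisted_monoid_def list_all2_conv_all_nth in_set_conv_nth)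
  then have "monoid (DirProd_list (G # Gs))" by (rule monoid_DirProd_list)
  \<comment> \<open>The variables \<open>p\<close>, \<open>r\<close>, \<open>s\<close>,
    \<open>t\<close> stand for cocycle values of the tails, so the identity splits into one for the
    head and one for the tails.\<close>
  moreover have "w a b * p * (w (a \<otimes>\<^bsub>G\<^esub> b) c * r) = w b c * s * (w a (b \<otimes>\<^bsub>G\<^esub> c) * t)"
    if "a \<in> carrier G" "b \<in> carrier G" "c \<in> carrier G" "p * r = s * t" for a b c p r s t
    using G.cocycle[OF that(1-3)] that(4) by (metis mult.assoc mult.left_commute)
  ultimately show ?case
    unfolding twisted_monoid_def twisted_monoid_axioms_def
    by (auto simp: DirProd_list_Cons_carrier DirProd_list_Cons_mult DirProd_list_Cons_one
        G.cocycle_nonzero D.cocycle_nonzero D.cocycle G.cocycle_one D.cocycle_one)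
qed


subsection \<open>Pure tensors\<close>

text \<open>Realises the tensor product of functions on a monoid and functions on tuples as
  functions on longer tuples.\<close>

abbreviation cons_tensor ::
    "('g \<Rightarrow>\<^sub>0 complex) \<Rightarrow> ('g list \<Rightarrow>\<^sub>0 complex) \<Rightarrow> ('g list \<Rightarrow>\<^sub>0 complex)" where
  "cons_tensor \<equiv> basis_bilinear (#) (\<lambda>_ _. 1)"

text \<open>Both sides are linear in each of the four arguments, so four nested inductions leave
  only basis vectors, where the cocycle of the product splits.\<close>

lemma cons_tensor_mult:
  assumes p: "Poly_Mapping.keys p \<subseteq> carrier G" "Poly_Mapping.keys p' \<subseteq> carrier G"
    and t: "Poly_Mapping.keys t \<subseteq> carrier (DirProd_list Gs)" "Poly_Mapping.keys t' \<subseteq> carrier (DirProd_list Gs)"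
  shows "cons_tensor (p \<otimes>\<^bsub>twisted_algebra G w\<^esub> p') (t \<otimes>\<^bsub>twisted_algebra (DirProd_list Gs) (prod_cocycle ws)\<^esub> t') =
    cons_tensor p t \<otimes>\<^bsub>twisted_algebra (DirProd_list (G # Gs)) (prod_cocycle (w # ws))\<^esub> cons_tensor p' t'"
  using p(1)
proof (induction p rule: poly_mapping_induct_on)
  case (single a c)
  note a = single
  show ?case using t(1)
  proof (induction t rule: poly_mapping_induct_on)
    case (single as d)
    note as = single
    show ?case using p(2)
    proof (induction p' rule: poly_mapping_induct_on)
      case (single b e)
      note b = single
      show ?case using t(2)
      proof (induction t' rule: poly_mapping_induct_on)
        case (single bs f)
        then show ?case
          using a as b by (simp add: DirProd_list_Cons_mult mult_ac)
      qed (simp_all add: twisted_mult_add basis_bilinear_add_right)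
    qed (simp_all add: twisted_mult_add basis_bilinear_add_left)
  qed (simp_all add: twisted_mult_add basis_bilinear_add_right)
qed (simp_all add: twisted_mult_add basis_bilinear_add_left)

text \<open>The model of a pure tensor: each slot is sent to its twisted algebra, and the resulting
  functions are multiplied out over tuples.\<close>

fun pure_tensor :: "('a \<Rightarrow> ('g \<Rightarrow>\<^sub>0 complex)) list \<Rightarrow> 'a list \<Rightarrow> ('g list \<Rightarrow>\<^sub>0 complex)" where
  "pure_tensor (h # hs) (x # xs) = cons_tensor (h x) (pure_tensor hs xs)"
| "pure_tensor _ _ = Poly_Mapping.single [] 1"

lemma pure_tensor_single:
  assumes "length xs = length hs" "length as = length hs"
    and "\<And>i. i < length hs \<Longrightarrow> (hs ! i) (xs ! i) = Poly_Mapping.single (as ! i) 1"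
  shows "pure_tensor hs xs = Poly_Mapping.single as 1"
  using assms
proof (induction hs arbitrary: xs as)
  case (Cons h hs)
  then obtain y ys b bs where *: "xs = y # ys" "as = b # bs"
    by (metis length_Suc_conv)
  have "pure_tensor hs ys = Poly_Mapping.single bs 1"
    using Cons.prems(3)[of "Suc i" for i] Cons.prems(1,2) by (intro Cons.IH) (auto simp: *)
  then show ?case using Cons.prems(3)[of 0] by (simp add: *)
qed auto

lemma pure_tensor_add:
  assumes "length xs = length hs" "i < length hs" "(hs ! i) z = (hs ! i) x + (hs ! i) y"
  shows "pure_tensor hs (xs[i := z]) = pure_tensor hs (xs[i := x]) + pure_tensor hs (xs[i := y])"
  using assms
proof (induction hs arbitrary: xs i)
  case (Cons h hs)
  then obtain u us where "xs = u # us" by (metis length_Suc_conv)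
  with Cons show ?case
    by (cases i) (auto simp: basis_bilinear_add_left basis_bilinear_add_right)
qed simp

lemma pure_tensor_smult:
  assumes "length xs = length hs" "i < length hs" "(hs ! i) z = Poly_Mapping.map ((*) c) ((hs ! i) x)"
  shows "pure_tensor hs (xs[i := z]) = Poly_Mapping.map ((*) c) (pure_tensor hs (xs[i := x]))"
  using assms
proof (induction hs arbitrary: xs i)
  case (Cons h hs)
  then obtain u us where "xs = u # us" by (metis length_Suc_conv)
  with Cons show ?case
    by (cases i) (auto simp: basis_bilinear_smult)
qed simp

text \<open>The factors \<open>As\<close> come with isomorphisms \<open>hs\<close> onto the twisted monoid algebras of the
  monoids \<open>Gs\<close> with cocycles \<open>ws\<close>.\<close>

inductive tensor_factors ::
    "(complex, 'a) module list \<Rightarrow> ('g, 'm) monoid_scheme list \<Rightarrow> ('g \<Rightarrow> 'g \<Rightarrow> complex) list \<Rightarrow>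
     ('a \<Rightarrow> ('g \<Rightarrow>\<^sub>0 complex)) list \<Rightarrow> bool" where
  Nil: "tensor_factors [] [] [] []"
| Cons: "complex_algebra A \<Longrightarrow> twisted_monoid G w \<Longrightarrow> alg_hom A (twisted_algebra G w) h \<Longrightarrow>
    bij_betw h (carrier A) (carrier (twisted_algebra G w)) \<Longrightarrow> tensor_factors As Gs ws hs \<Longrightarrow>
    tensor_factors (A # As) (G # Gs) (w # ws) (h # hs)"

lemma tensor_factors_length:
  "tensor_factors As Gs ws hs \<Longrightarrow> length Gs = length As \<and> length ws = length As \<and> length hs = length As"
  by (induction rule: tensor_factors.induct) auto

lemma tensor_factors_nth:
  assumes "tensor_factors As Gs ws hs" "i < length As"
  shows "complex_algebra (As ! i)" "twisted_monoid (Gs ! i) (ws ! i)"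
    "alg_hom (As ! i) (twisted_algebra (Gs ! i) (ws ! i)) (hs ! i)"
    "bij_betw (hs ! i) (carrier (As ! i)) (carrier (twisted_algebra (Gs ! i) (ws ! i)))"
proof -
  have "complex_algebra (As ! i) \<and> twisted_monoid (Gs ! i) (ws ! i) \<and>
    alg_hom (As ! i) (twisted_algebra (Gs ! i) (ws ! i)) (hs ! i) \<and>
    bij_betw (hs ! i) (carrier (As ! i)) (carrier (twisted_algebra (Gs ! i) (ws ! i)))"
    using assms
  proof (induction arbitrary: i rule: tensor_factors.induct)
    case (Cons A G w h As Gs ws hs)
    then show ?case by (cases i) auto
  qed simp
  then show "complex_algebra (As ! i)" "twisted_monoid (Gs ! i) (ws ! i)"
    "alg_hom (As ! i) (twisted_algebra (Gs ! i) (ws ! i)) (hs ! i)"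
    "bij_betw (hs ! i) (carrier (As ! i)) (carrier (twisted_algebra (Gs ! i) (ws ! i)))"
    by blast+
qed

lemma tensor_factors_twisted:
  assumes "tensor_factors As Gs ws hs"
  shows "twisted_monoid (DirProd_list Gs) (prod_cocycle ws)"
proof (rule twisted_monoid_DirProd_list)
  show "list_all2 twisted_monoid Gs ws"
    using assms by (induction rule: tensor_factors.induct) auto
qed

lemma tensor_factors_monoid:
  assumes "tensor_factors As Gs ws hs"
  shows "monoid (DirProd_list As)"
proof (rule monoid_DirProd_list)
  show "\<forall>A \<in> set As. monoid A"
    using assms
    by (induction rule: tensor_factors.induct) (auto simp: complex_algebra_def ring.is_monoid)
qed

lemma pure_tensor_closed:
  assumes "tensor_factors As Gs ws hs" "xs \<in> carrier (DirProd_list As)"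
  shows "Poly_Mapping.keys (pure_tensor hs xs) \<subseteq> carrier (DirProd_list Gs)"
  using assms
proof (induction arbitrary: xs rule: tensor_factors.induct)
  case (Cons A G w h As Gs ws hs)
  then obtain y ys where *: "xs = y # ys" "y \<in> carrier A" "ys \<in> carrier (DirProd_list As)"
    by (auto simp: DirProd_list_Cons_carrier)
  have "Poly_Mapping.keys (cons_tensor (h y) (pure_tensor hs ys)) \<subseteq> carrier (DirProd_list (G # Gs))"
    using alg_homD(1)[OF Cons.hyps(3) *(2)] Cons.IH[OF *(3)]
    by (intro keys_basis_bilinear[where K = "carrier G" and K' = "carrier (DirProd_list Gs)"])
      (auto simp: DirProd_list_Cons_carrier)
  then show ?case by (simp add: *)
qed (simp add: DirProd_list_Nil)

lemma pure_tensor_one: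
  assumes "tensor_factors As Gs ws hs"
  shows "pure_tensor hs \<one>\<^bsub>DirProd_list As\<^esub> = Poly_Mapping.single \<one>\<^bsub>DirProd_list Gs\<^esub> 1"
  using assms
proof (induction rule: tensor_factors.induct)
  case (Cons A G w h As Gs ws hs)
  then show ?case
    using alg_homD(5)[OF Cons.hyps(3)] by (simp add: DirProd_list_Cons_one)
qed (simp add: DirProd_list_Nil)

lemma pure_tensor_mult:
  assumes "tensor_factors As Gs ws hs"
    "xs \<in> carrier (DirProd_list As)" "ys \<in> carrier (DirProd_list As)"
  shows "pure_tensor hs (xs \<otimes>\<^bsub>DirProd_list As\<^esub> ys) =
    pure_tensor hs xs \<otimes>\<^bsub>twisted_algebra (DirProd_list Gs) (prod_cocycle ws)\<^esub> pure_tensor hs ys"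
  using assms
proof (induction arbitrary: xs ys rule: tensor_factors.induct)
  case (Cons A G w h As Gs ws hs)
  obtain u us where xs: "xs = u # us" "u \<in> carrier A" "us \<in> carrier (DirProd_list As)"
    using Cons.prems(1) by (auto simp: DirProd_list_Cons_carrier)
  obtain v vs where ys: "ys = v # vs" "v \<in> carrier A" "vs \<in> carrier (DirProd_list As)"
    using Cons.prems(2) by (auto simp: DirProd_list_Cons_carrier)
  have "pure_tensor (h # hs) (xs \<otimes>\<^bsub>DirProd_list (A # As)\<^esub> ys) =
      cons_tensor (h (u \<otimes>\<^bsub>A\<^esub> v)) (pure_tensor hs (us \<otimes>\<^bsub>DirProd_list As\<^esub> vs))"
    using xs ys by (simp add: DirProd_list_Cons_mult)
  also have "\<dots> = cons_tensor (h u \<otimes>\<^bsub>twisted_algebra G w\<^esub> h v)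
      (pure_tensor hs us \<otimes>\<^bsub>twisted_algebra (DirProd_list Gs) (prod_cocycle ws)\<^esub> pure_tensor hs vs)"
    using xs ys Cons.IH by (simp only: alg_homD(3)[OF Cons.hyps(3)])
  also have "\<dots> = cons_tensor (h u) (pure_tensor hs us)
      \<otimes>\<^bsub>twisted_algebra (DirProd_list (G # Gs)) (prod_cocycle (w # ws))\<^esub> cons_tensor (h v) (pure_tensor hs vs)"
    using alg_homD(1)[OF Cons.hyps(3)] xs ys pure_tensor_closed[OF Cons.hyps(5)]
    by (intro cons_tensor_mult) auto
  finally show ?case using xs ys by simp
qed (simp add: DirProd_list_Nil)


text \<open>The map \<open>\<Phi>\<close> evaluates formal tuples as pure tensors. Multilinearity
  puts the span \<open>S\<close> of the relations into its kernel; conversely, every element agrees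
  with its normal form \<open>g (\<Phi> f)\<close> modulo \<open>S\<close>. Hence \<open>S\<close>
  is the whole kernel, which also shows that it is an ideal.\<close>

theorem tensor_algebra_iso:
  assumes D: "tensor_factors As Gs ws hs"
  shows "complex_algebra (tensor_algebra As)"
    and "tensor_algebra As \<cong>\<^sub>a\<^sub>l\<^sub>g twisted_algebra (DirProd_list Gs) (prod_cocycle ws)"
proof -
  define r where "r = length As"
  have len: "length As = r" "length Gs = r" "length ws = r" "length hs = r"
    using tensor_factors_length[OF D] by (auto simp: r_def)
  note nth = tensor_factors_nth[OF D, unfolded len]
  interpret M: twisted_monoid "DirProd_list As" "\<lambda>_ _. 1"
    by (rule twisted_monoid_trivial[OF tensor_factors_monoid[OF D]])
  interpret N: twisted_monoid "DirProd_list Gs" "prod_cocycle ws"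
    by (rule tensor_factors_twisted[OF D])
  define F where "F = twisted_algebra (DirProd_list As) (\<lambda>_ _. 1)"
  define B where "B = twisted_algebra (DirProd_list Gs) (prod_cocycle ws)"
  interpret F: complex_algebra F unfolding F_def by (rule M.complex_algebra_twisted)
  interpret B: complex_algebra B unfolding B_def by (rule N.complex_algebra_twisted)
  have F_simps: "carrier F = {f. Poly_Mapping.keys f \<subseteq> carrier (DirProd_list As)}"
    "\<zero>\<^bsub>F\<^esub> = 0" "\<And>f g. f \<oplus>\<^bsub>F\<^esub> g = f + g" "\<And>c f. c \<odot>\<^bsub>F\<^esub> f = Poly_Mapping.map ((*) c) f"
    by (simp_all add: F_def)
  have B_simps: "carrier B = {f. Poly_Mapping.keys f \<subseteq> carrier (DirProd_list Gs)}"
    "\<zero>\<^bsub>B\<^esub> = 0" "\<And>f g. f \<oplus>\<^bsub>B\<^esub> g = f + g" "\<And>c f. c \<odot>\<^bsub>B\<^esub> f = Poly_Mapping.map ((*) c) f"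
    by (simp_all add: B_def)
  define \<Phi> where "\<Phi> = B.lin_ext (pure_tensor hs)"
  have pt_closed: "pure_tensor hs xs \<in> carrier B" if "xs \<in> carrier (DirProd_list As)" for xs
    using pure_tensor_closed[OF D that] by (simp add: B_simps)
  have \<Phi>: "alg_hom F B \<Phi>"
    unfolding \<Phi>_def F_def
  proof (rule B.lin_ext_alg_hom[OF M.twisted_monoid_axioms])
    show "pure_tensor hs \<in> carrier (DirProd_list As) \<rightarrow> carrier B"
      using pt_closed by auto
    show "pure_tensor hs \<one>\<^bsub>DirProd_list As\<^esub> = \<one>\<^bsub>B\<^esub>"
      using pure_tensor_one[OF D] by (simp add: B_def)
    fix xs ys assume xy: "xs \<in> carrier (DirProd_list As)" "ys \<in> carrier (DirProd_list As)"
    show "pure_tensor hs xs \<otimes>\<^bsub>B\<^esub> pure_tensor hs ys = 1 \<odot>\<^bsub>B\<^esub> pure_tensor hs (xs \<otimes>\<^bsub>DirProd_list As\<^esub> ys)"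
      using pt_closed[OF M.m_closed[OF xy]] pure_tensor_mult[OF D xy] by (simp add: B_def[symmetric])
  qed
  note \<Phi>D = alg_homD[OF \<Phi>, unfolded F_simps B_simps]
  have \<Phi>_zero: "\<Phi> 0 = 0"
    using alg_hom_zero[OF \<Phi> F.complex_algebra_axioms B.complex_algebra_axioms] by (simp add: F_simps B_simps)
  have \<Phi>_single: "\<Phi> (Poly_Mapping.single xs c) = Poly_Mapping.map ((*) c) (pure_tensor hs xs)"
    if "xs \<in> carrier (DirProd_list As)" for xs c
    using pt_closed[OF that] by (simp add: \<Phi>_def B_simps)
  \<comment> \<open>These elements correspond to basis vectors under the isomorphism of the i-th
    factor; they fill the slots of normal forms.\<close>
  define basis where "basis i a = inv_into (carrier (As ! i)) (hs ! i) (Poly_Mapping.single a 1)" for i a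
  have basis: "basis i a \<in> carrier (As ! i)" "(hs ! i) (basis i a) = Poly_Mapping.single a 1"
    if "i < r" "a \<in> carrier (Gs ! i)" for i a
  proof -
    have "Poly_Mapping.single a 1 \<in> hs ! i ` carrier (As ! i)"
      using nth(4)[OF that(1)] that(2) by (auto simp: bij_betw_def)
    then show "basis i a \<in> carrier (As ! i)" "(hs ! i) (basis i a) = Poly_Mapping.single a 1"
      unfolding basis_def by (simp_all add: inv_into_into f_inv_into_f)
  qed
  define tuple where "tuple as = map (\<lambda>i. basis i (as ! i)) [0..<r]" for as
  have tuple: "tuple as \<in> carrier (DirProd_list As)" "pure_tensor hs (tuple as) = Poly_Mapping.single as 1"
    if as: "as \<in> carrier (DirProd_list Gs)" for as
  proof -
    note as' = DirProd_list_carrier_mem[OF as, unfolded len]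
    show "tuple as \<in> carrier (DirProd_list As)"
      by (rule DirProd_list_carrier_memI) (auto simp: tuple_def len as' basis)
    show "pure_tensor hs (tuple as) = Poly_Mapping.single as 1"
      by (rule pure_tensor_single) (auto simp: tuple_def len as' basis)
  qed
  \<comment> \<open>A linear section of \<open>\<Phi>\<close>. It need not be multiplicative, since
    it serves only to select a normal form modulo the relations.\<close>
  define g where "g = F.lin_ext (\<lambda>as. Poly_Mapping.single (tuple as) 1)"
  have tuple_F: "Poly_Mapping.single (tuple as) 1 \<in> carrier F" if "as \<in> carrier (DirProd_list Gs)" for as
    using tuple(1)[OF that] by (simp add: F_simps)
  have g_add: "g (p + s) = g p + g s" if "p \<in> carrier B" "s \<in> carrier B" for p s
    unfolding g_def F_simps(3)[symmetric] using that tuple_F by (intro F.lin_ext_add) (auto simp: B_simps)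
  have g_smult: "g (Poly_Mapping.map ((*) c) p) = Poly_Mapping.map ((*) c) (g p)" if "p \<in> carrier B" for p c
    unfolding g_def F_simps(4)[symmetric] using that tuple_F by (intro F.lin_ext_smult) (auto simp: B_simps)
  have g_single: "g (Poly_Mapping.single as 1) = Poly_Mapping.single (tuple as) 1"
    if "as \<in> carrier (DirProd_list Gs)" for as
    using F.lin_ext_single[where \<phi> = "\<lambda>as. Poly_Mapping.single (tuple as) 1", OF tuple_F[OF that], of 1]
      F.smult_one[OF tuple_F[OF that]]
    unfolding g_def by simp
  have g_zero: "g 0 = 0" by (simp add: g_def F_simps)

  interpret V: vectorspace class_ring F by (rule F.is_vectorspace)
  define R where "R = multilinear_relations As"
  define S where "S = V.span R"
  have upd: "xs[i := x] \<in> carrier (DirProd_list As)"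
    if "xs \<in> carrier (DirProd_list As)" "x \<in> carrier (As ! i)" for xs i x
  proof (rule DirProd_list_carrier_memI)
    note xs = DirProd_list_carrier_mem[OF that(1)]
    show "length (xs[i := x]) = length As" using xs by simp
    fix j assume "j < length As"
    then show "xs[i := x] ! j \<in> carrier (As ! j)"
      using xs that(2) by (cases "i = j") auto
  qed
  have minus_F: "f - f' \<in> carrier F" "f - f' = f + Poly_Mapping.map ((*) (-1)) f'"
    if "f \<in> carrier F" "f' \<in> carrier F" for f f'
  proof -
    show eq: "f - f' = f + Poly_Mapping.map ((*) (-1)) f'"
      by (rule poly_mapping_eqI) (simp only: lookup_add lookup_minus lookup_uminus lookup_map_times mult_minus1 diff_conv_add_uminus)
    show "f - f' \<in> carrier F"
      unfolding eq using F.a_closed[OF that(1) F.smult_closed[OF that(2), of "-1"]]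
      by (simp only: F_simps(3,4))
  qed
  have \<Phi>_minus: "\<Phi> (f - f') = \<Phi> f - \<Phi> f'" if "f \<in> carrier F" "f' \<in> carrier F" for f f'
  proof -
    have "\<Phi> (f \<oplus>\<^bsub>F\<^esub> (-1) \<odot>\<^bsub>F\<^esub> f') = \<Phi> f \<oplus>\<^bsub>B\<^esub> (-1) \<odot>\<^bsub>B\<^esub> \<Phi> f'"
      using that by (simp only: alg_homD(2,4)[OF \<Phi>] F.smult_closed)
    then have "\<Phi> (f - f') = \<Phi> f + Poly_Mapping.map ((*) (-1)) (\<Phi> f')"
      unfolding minus_F(2)[OF that] F_simps B_simps .
    also have "\<dots> = \<Phi> f - \<Phi> f'"
      by (rule poly_mapping_eqI) (simp only: lookup_add lookup_minus lookup_uminus lookup_map_times mult_minus1 diff_conv_add_uminus)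
    finally show ?thesis .
  qed
  have R_F: "f \<in> carrier F \<and> \<Phi> f = 0" if "f \<in> R" for f
  proof -
    consider (add) xs i x y where "xs \<in> carrier (DirProd_list As)" "i < r" "x \<in> carrier (As ! i)" "y \<in> carrier (As ! i)"
        "f = Poly_Mapping.single (xs[i := x \<oplus>\<^bsub>As ! i\<^esub> y]) 1
          - Poly_Mapping.single (xs[i := x]) 1 - Poly_Mapping.single (xs[i := y]) 1"
      | (smult) xs i x c where "xs \<in> carrier (DirProd_list As)" "i < r" "x \<in> carrier (As ! i)"
        "f = Poly_Mapping.single (xs[i := c \<odot>\<^bsub>As ! i\<^esub> x]) 1 - Poly_Mapping.single (xs[i := x]) c"
      using \<open>f \<in> R\<close> unfolding R_def multilinear_relations_def len by blast
    then show ?thesis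
    proof cases
      case add
      interpret A: complex_algebra "As ! i" by (rule nth(1)[OF add(2)])
      have s: "Poly_Mapping.single (xs[i := x \<oplus>\<^bsub>As ! i\<^esub> y]) 1 \<in> carrier F"
        "Poly_Mapping.single (xs[i := x]) 1 \<in> carrier F" "Poly_Mapping.single (xs[i := y]) 1 \<in> carrier F"
        using upd add by (auto simp: F_simps)
      have "pure_tensor hs (xs[i := x \<oplus>\<^bsub>As ! i\<^esub> y]) = pure_tensor hs (xs[i := x]) + pure_tensor hs (xs[i := y])"
        using add DirProd_list_carrier_mem(1)[OF add(1)] alg_homD(2)[OF nth(3)[OF add(2)] add(3,4)]
        by (intro pure_tensor_add) (simp_all add: len)
      then show ?thesis
        using add s upd by (simp add: minus_F(1) \<Phi>_minus \<Phi>_single map_times_add)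
    next
      case smult
      interpret A: complex_algebra "As ! i" by (rule nth(1)[OF smult(2)])
      have s: "Poly_Mapping.single (xs[i := c \<odot>\<^bsub>As ! i\<^esub> x]) 1 \<in> carrier F"
        "Poly_Mapping.single (xs[i := x]) c \<in> carrier F"
        using upd smult by (auto simp: F_simps)
      have "pure_tensor hs (xs[i := c \<odot>\<^bsub>As ! i\<^esub> x]) = Poly_Mapping.map ((*) c) (pure_tensor hs (xs[i := x]))"
        using smult DirProd_list_carrier_mem(1)[OF smult(1)] alg_homD(4)[OF nth(3)[OF smult(2)] smult(3)]
        by (intro pure_tensor_smult) (simp_all add: len)
      moreover have "Poly_Mapping.map ((*) 1) p = p" for p :: "'b list \<Rightarrow>\<^sub>0 complex"
        by (rule poly_mapping_eqI) simp
      ultimately show ?thesis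
        using smult s upd by (simp add: minus_F(1) \<Phi>_minus \<Phi>_single)
    qed
  qed
  have sub: "LinearCombinations.submodule class_ring S F"
    unfolding S_def using R_F by (intro V.span_is_submodule) auto
  interpret S: LinearCombinations.submodule class_ring S F by (rule sub)
  have S_add: "f + f' \<in> S" if "f \<in> S" "f' \<in> S" for f f'
    using S.m_closed[OF that] by (simp add: F_simps)
  have S_smult: "Poly_Mapping.map ((*) c) f \<in> S" if "f \<in> S" for f c
    using S.smult_closed[of c f] that by (simp add: F_simps)
  let ?K = "{f \<in> carrier F. \<Phi> f = \<zero>\<^bsub>B\<^esub>}"
  have "LinearCombinations.submodule class_ring ?K F"
    using F.is_module F.zero_closed
    by unfold_locales
      (auto simp: alg_homD[OF \<Phi>] alg_hom_zero[OF \<Phi> F.complex_algebra_axioms B.complex_algebra_axioms])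
  then have S_K: "S \<subseteq> ?K"
    unfolding S_def using R_F by (intro V.span_is_subset) (auto simp: B_simps)

  \<comment> \<open>The elements congruent to their normal form modulo \<open>S\<close>. The aim is
    to show that this subspace is everything.\<close>
  define Q where "Q = {f \<in> carrier F. f - g (\<Phi> f) \<in> S}"
  have S_Q: "S \<subseteq> Q"
    using S_K by (auto simp: Q_def B_simps g_zero)
  have Q_add: "f + f' \<in> Q" if "f \<in> Q" "f' \<in> Q" for f f'
  proof -
    have c: "f \<in> carrier F" "f' \<in> carrier F" using that by (auto simp: Q_def)
    have eq: "f + f' - g (\<Phi> (f + f')) = (f - g (\<Phi> f)) + (f' - g (\<Phi> f'))"
      using c alg_homD(1,2)[OF \<Phi>] by (simp add: F_simps(3) B_simps(3) g_add)
    have "f - g (\<Phi> f) \<in> S" "f' - g (\<Phi> f') \<in> S" using that by (auto simp: Q_def)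
    then have "f + f' - g (\<Phi> (f + f')) \<in> S" unfolding eq by (rule S_add)
    then show ?thesis using F.a_closed[OF c] by (simp only: Q_def F_simps(3) mem_Collect_eq)
  qed
  have Q_smult: "Poly_Mapping.map ((*) c) f \<in> Q" if "f \<in> Q" for f c
  proof -
    have c: "f \<in> carrier F" using that by (auto simp: Q_def)
    have "\<Phi> (Poly_Mapping.map ((*) c) f) = Poly_Mapping.map ((*) c) (\<Phi> f)"
      using alg_homD(4)[OF \<Phi> c] by (simp add: F_simps(4) B_simps(4))
    then have eq: "Poly_Mapping.map ((*) c) f - g (\<Phi> (Poly_Mapping.map ((*) c) f)) =
        Poly_Mapping.map ((*) c) (f - g (\<Phi> f))"
      using alg_homD(1)[OF \<Phi> c] by (simp add: g_smult poly_mapping_eqI lookup_minus right_diff_distrib)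
    have "f - g (\<Phi> f) \<in> S" using that by (auto simp: Q_def)
    then have "Poly_Mapping.map ((*) c) f - g (\<Phi> (Poly_Mapping.map ((*) c) f)) \<in> S"
      unfolding eq by (rule S_smult)
    then show ?thesis using F.smult_closed[OF c] by (simp only: Q_def F_simps(4) mem_Collect_eq)
  qed
  \<comment> \<open>The induction runs over slots: those below \<open>k\<close> are arbitrary, those
    from \<open>k\<close> on already hold basis elements. At 0 the tuple equals its own normal form,
    and \<open>k = r\<close> allows every tuple.\<close>
  have slots: "word' \<in> Q"
    if "k \<le> r" "xs \<in> carrier (DirProd_list As)" "word' = Poly_Mapping.single xs 1"
      "\<And>i. k \<le> i \<Longrightarrow> i < r \<Longrightarrow> \<exists>a \<in> carrier (Gs ! i). xs ! i = basis i a" for k xs word'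
    using that
  proof (induction k arbitrary: xs word')
    case 0
    then obtain a where a: "\<And>i. i < r \<Longrightarrow> a i \<in> carrier (Gs ! i) \<and> xs ! i = basis i (a i)"
      by (metis le0)
    define as where "as = map a [0..<r]"
    have as: "as \<in> carrier (DirProd_list Gs)"
      by (rule DirProd_list_carrier_memI) (auto simp: as_def len a)
    have "xs = tuple as"
      using DirProd_list_carrier_mem(1)[OF 0(2)] a by (auto simp: tuple_def as_def len intro!: nth_equalityI)
    moreover have "\<Phi> (Poly_Mapping.single (tuple as) 1) = Poly_Mapping.single as 1"
      using tuple[OF as] by (simp add: \<Phi>_single)
    ultimately show ?case
      using 0 as tuple_F[OF as] S.zero_closed by (simp add: Q_def g_single F_simps(2))
  next
    case (Suc k)
    then have k: "k < r" by simp
    interpret A: complex_algebra "As ! k" by (rule nth(1)[OF k])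
    note xs = DirProd_list_carrier_mem[OF Suc.prems(2), unfolded len]
    \<comment> \<open>Slot \<open>k\<close> is parametrised by its image \<open>p\<close>, so that
      induction on \<open>p\<close> expands it in basis elements by means of the relations.\<close>
    have "Poly_Mapping.single (xs[k := inv_into (carrier (As ! k)) (hs ! k) p]) 1 \<in> Q"
      if "Poly_Mapping.keys p \<subseteq> carrier (Gs ! k)" for p
    proof -
      let ?inv = "inv_into (carrier (As ! k)) (hs ! k)"
      have inv: "alg_hom (twisted_algebra (Gs ! k) (ws ! k)) (As ! k) ?inv"
        by (rule alg_hom_inv_into[OF nth(3)[OF k] nth(4)[OF k] nth(1)[OF k]])
      note invD = alg_homD[OF inv, simplified]
      have slot_add: "Poly_Mapping.single (xs[k := x \<oplus>\<^bsub>As ! k\<^esub> y]) 1 \<in> Q"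
        if "Poly_Mapping.single (xs[k := x]) 1 \<in> Q" "Poly_Mapping.single (xs[k := y]) 1 \<in> Q"
          "x \<in> carrier (As ! k)" "y \<in> carrier (As ! k)" for x y
      proof -
        have "Poly_Mapping.single (xs[k := x \<oplus>\<^bsub>As ! k\<^esub> y]) 1
          - Poly_Mapping.single (xs[k := x]) 1 - Poly_Mapping.single (xs[k := y]) 1 \<in> R"
          unfolding R_def multilinear_relations_def len using that k Suc.prems(2) by blast
        then have "Poly_Mapping.single (xs[k := x \<oplus>\<^bsub>As ! k\<^esub> y]) 1
          - Poly_Mapping.single (xs[k := x]) 1 - Poly_Mapping.single (xs[k := y]) 1 \<in> Q"
          using S_Q V.in_own_span[of R] R_F unfolding S_def by auto
        from Q_add[OF Q_add[OF this that(1)] that(2)] show ?thesis by simp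
      qed
      have smult: "Poly_Mapping.single (xs[k := c \<odot>\<^bsub>As ! k\<^esub> x]) 1 \<in> Q"
        if "Poly_Mapping.single (xs[k := x]) 1 \<in> Q" "x \<in> carrier (As ! k)" for x c
      proof -
        have "Poly_Mapping.single (xs[k := c \<odot>\<^bsub>As ! k\<^esub> x]) 1 - Poly_Mapping.single (xs[k := x]) c \<in> R"
          unfolding R_def multilinear_relations_def len using that k Suc.prems(2) by blast
        then have "Poly_Mapping.single (xs[k := c \<odot>\<^bsub>As ! k\<^esub> x]) 1 - Poly_Mapping.single (xs[k := x]) c \<in> Q"
          using S_Q V.in_own_span[of R] R_F unfolding S_def by auto
        from Q_add[OF this Q_smult[OF that(1), of c]] show ?thesis by simp
      qed
      have slot_basis: "Poly_Mapping.single (xs[k := basis k a]) 1 \<in> Q" if a: "a \<in> carrier (Gs ! k)" for a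
      proof (rule Suc.IH[OF _ upd[OF Suc.prems(2) basis(1)[OF k a]] refl])
        fix i assume "k \<le> i" "i < r"
        then show "\<exists>b\<in>carrier (Gs ! i). xs[k := basis k a] ! i = basis i b"
          using a xs(1) Suc.prems(4)[of i] by (cases "i = k") auto
      qed (use k in simp)
      show ?thesis using that
      proof (induction p rule: poly_mapping_induct_on)
        case zero
        obtain a where a: "a \<in> carrier (Gs ! k)"
          using nth(2)[OF k] monoid.one_closed unfolding twisted_monoid_def by blast
        have "?inv 0 = \<zero>\<^bsub>As ! k\<^esub>"
          using invD(4)[of 0 0] A.smult_zero_left[OF invD(1)[of 0]] by simp
        \<comment> \<open>Zero is written as a multiple of a basis element so that the homogeneity
          relation applies to it.\<close>
        also have "\<dots> = 0 \<odot>\<^bsub>As ! k\<^esub> basis k a"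
          using A.smult_zero_left[OF basis(1)[OF k a]] by simp
        finally show ?case
          using smult[OF slot_basis[OF a] basis(1)[OF k a], of 0] by simp
      next
        case (single a c)
        have "?inv (Poly_Mapping.single a c) = c \<odot>\<^bsub>As ! k\<^esub> basis k a"
          using invD(4)[of "Poly_Mapping.single a 1" c] single by (simp add: basis_def)
        then show ?case
          using smult[OF slot_basis[OF single] basis(1)[OF k single], of c] by simp
      next
        case (add p s)
        then show ?case
          using slot_add[of "?inv p" "?inv s"] invD(1,2) by simp
      qed
    qed
    from this[of "(hs ! k) (xs ! k)"] show ?case
      using alg_homD(1)[OF nth(3)[OF k] xs(2)[OF k]] nth(4)[OF k] xs k Suc.prems(3)
      by (simp add: bij_betw_def inv_into_f_f)
  qed
  have all_Q: "f \<in> Q" if "Poly_Mapping.keys f \<subseteq> carrier (DirProd_list As)" for f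
    using that
  proof (induction f rule: poly_mapping_induct_on)
    case zero
    show ?case using S_Q S.zero_closed by (auto simp: F_simps)
  next
    case (single xs c)
    then have "Poly_Mapping.single xs 1 \<in> Q" by (intro slots[of r]) auto
    from Q_smult[OF this, of c] show ?case by simp
  qed (rule Q_add)
  have "?K \<subseteq> S"
  proof
    fix f assume "f \<in> ?K"
    then have "f \<in> Q" "\<Phi> f = 0" using all_Q by (auto simp: F_simps(1) B_simps(2))
    then show "f \<in> S" by (simp add: Q_def g_zero)
  qed
  \<comment> \<open>As a kernel, the span is now known to be an ideal, which the quotient
    construction requires.\<close>
  with S_K have S_eq: "S = ?K" by blast
  have "\<Phi> ` carrier F = carrier B"
  proof
    show "\<Phi> ` carrier F \<subseteq> carrier B" using alg_homD(1)[OF \<Phi>] by auto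
    have "\<exists>f \<in> carrier F. \<Phi> f = p" if "Poly_Mapping.keys p \<subseteq> carrier (DirProd_list Gs)" for p
      using that
    proof (induction p rule: poly_mapping_induct_on)
      case zero
      show ?case using \<Phi>_zero by (intro bexI[of _ 0]) (auto simp: F_simps)
    next
      case (single as c)
      then show ?case using tuple[OF single] \<Phi>_single[of "tuple as" c]
        by (intro bexI[of _ "Poly_Mapping.single (tuple as) c"]) (auto simp: F_simps)
    next
      case (add p s)
      then obtain f f' where f: "f \<in> carrier F" "f' \<in> carrier F" "\<Phi> f = p" "\<Phi> f' = s" by blast
      then show ?case
        using alg_homD(2)[OF \<Phi> f(1,2)] F.a_closed[OF f(1,2)]
        by (intro bexI[of _ "f + f'"]) (simp_all add: F_simps(3) B_simps(3))
    qed
    then show "carrier B \<subseteq> \<Phi> ` carrier F" by (force simp: B_simps)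
  qed
  then have "quot_alg F S \<cong>\<^sub>a\<^sub>l\<^sub>g B"
    unfolding S_eq by (rule F.quot_alg_iso[OF B.complex_algebra_axioms \<Phi>])
  moreover have "complex_algebra (quot_alg F S)"
    unfolding S_eq
    by (rule F.complex_algebra_quot_alg(1)[OF F.alg_hom_kernel_ideal[OF B.complex_algebra_axioms \<Phi>]])
  moreover have "tensor_algebra As = quot_alg F S"
    by (simp add: tensor_algebra_def Let_def F_def S_def R_def monoid_algebra_twisted)
  ultimately show "complex_algebra (tensor_algebra As)"
    "tensor_algebra As \<cong>\<^sub>a\<^sub>l\<^sub>g twisted_algebra (DirProd_list Gs) (prod_cocycle ws)"
    by (simp_all add: B_def)
qed


section \<open>Lattices with a bilinear form\<close>

lemma powi_add: "(q :: complex) \<noteq> 0 \<Longrightarrow> q powi (a + b) = q powi a * q powi b"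
  by (rule power_int_add) simp

text \<open>The kernel keeps its ambient vectors and the ambient addition, so it can stand in one
  list with the rank 2 lattices as a factor of a direct product.\<close>

abbreviation sublattice :: "nat \<Rightarrow> int vec set \<Rightarrow> int vec monoid" where
  "sublattice n C \<equiv> (monoid_vec TYPE(int) n)\<lparr>carrier := C\<rparr>"

lemma monoid_vec_int_simps [simp]:
  "carrier (monoid_vec TYPE(int) n) = carrier_vec n"
  "\<alpha> \<otimes>\<^bsub>monoid_vec TYPE(int) n\<^esub> \<beta> = \<alpha> + \<beta>"
  "\<one>\<^bsub>monoid_vec TYPE(int) n\<^esub> = 0\<^sub>v n"
  by (simp_all add: monoid_vec_def)

lemma sublattice_full: "sublattice n (carrier_vec n) = monoid_vec TYPE(int) n"
  by (simp add: monoid_vec_def)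

definition form_cocycle :: "complex \<Rightarrow> int mat \<Rightarrow> int vec \<Rightarrow> int vec \<Rightarrow> complex" where
  "form_cocycle q U \<alpha> \<beta> = q powi (\<alpha> \<bullet> (U *\<^sub>v \<beta>))"

lemma form_add_left:
  assumes "(U :: int mat) \<in> carrier_mat n n" "\<alpha> \<in> carrier_vec n" "\<beta> \<in> carrier_vec n" "\<gamma> \<in> carrier_vec n"
  shows "(\<alpha> + \<beta>) \<bullet> (U *\<^sub>v \<gamma>) = \<alpha> \<bullet> (U *\<^sub>v \<gamma>) + \<beta> \<bullet> (U *\<^sub>v \<gamma>)"
  using assms by (intro add_scalar_prod_distrib[of _ n]) auto

lemma form_add_right:
  assumes "(U :: int mat) \<in> carrier_mat n n" "\<alpha> \<in> carrier_vec n" "\<beta> \<in> carrier_vec n" "\<gamma> \<in> carrier_vec n"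
  shows "\<alpha> \<bullet> (U *\<^sub>v (\<beta> + \<gamma>)) = \<alpha> \<bullet> (U *\<^sub>v \<beta>) + \<alpha> \<bullet> (U *\<^sub>v \<gamma>)"
  using assms by (simp add: mult_add_distrib_mat_vec[of _ n n] scalar_prod_add_distrib[of _ n])

text \<open>With a bilinear exponent, both sides of the cocycle identity are \<open>q\<close> to the
  sum of the three pairwise values of the form.\<close>

lemma twisted_monoid_sublattice:
  assumes q: "q \<noteq> 0" and U: "U \<in> carrier_mat n n"
    and C: "C \<subseteq> carrier_vec n" "0\<^sub>v n \<in> C" "\<And>\<alpha> \<beta>. \<alpha> \<in> C \<Longrightarrow> \<beta> \<in> C \<Longrightarrow> \<alpha> + \<beta> \<in> C"
  shows "twisted_monoid (sublattice n C) (form_cocycle q U)"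
proof -
  have "monoid (sublattice n C)"
    by (rule monoidI) (use C in \<open>auto simp: assoc_add_vec[of _ n] subset_iff\<close>)
  moreover have "form_cocycle q U \<alpha> \<beta> * form_cocycle q U (\<alpha> + \<beta>) \<gamma> =
      form_cocycle q U \<beta> \<gamma> * form_cocycle q U \<alpha> (\<beta> + \<gamma>)"
    if "\<alpha> \<in> C" "\<beta> \<in> C" "\<gamma> \<in> C" for \<alpha> \<beta> \<gamma>
    using that C(1) q U
    by (simp add: form_cocycle_def form_add_left[of _ n] form_add_right[of _ n] powi_add subset_iff)
  moreover have "form_cocycle q U (0\<^sub>v n) \<alpha> = 1" "form_cocycle q U \<alpha> (0\<^sub>v n) = 1" if "\<alpha> \<in> C" for \<alpha>
  proof -
    have \<alpha>: "\<alpha> \<in> carrier_vec n" using that C by auto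
    have "U *\<^sub>v 0\<^sub>v n = 0\<^sub>v n" using U by (intro eq_vecI) auto
    moreover have "U *\<^sub>v \<alpha> \<in> carrier_vec n" using U \<alpha> by simp
    ultimately show "form_cocycle q U (0\<^sub>v n) \<alpha> = 1" "form_cocycle q U \<alpha> (0\<^sub>v n) = 1"
      using \<alpha> by (simp_all add: form_cocycle_def)
  qed
  ultimately show ?thesis
    using q by (simp add: twisted_monoid_def twisted_monoid_axioms_def form_cocycle_def)
qed

text \<open>An integral matrix whose difference with its transpose is H when H is skew-symmetric;
  half of H would lead to square roots of q.\<close>

definition upper_part :: "int mat \<Rightarrow> int mat" where
  "upper_part H = Matrix.mat (dim_row H) (dim_col H) (\<lambda>(i, j). if i < j then H $$ (i, j) else 0)"

lemma upper_part_carrier: "H \<in> carrier_mat n n \<Longrightarrow> upper_part H \<in> carrier_mat n n"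
  by (auto simp: upper_part_def)

lemma form_cocycle_commutator:
  assumes q: "q \<noteq> 0" and H: "H \<in> carrier_mat n n" "transpose_mat H = - H"
    and \<alpha>: "\<alpha> \<in> carrier_vec n" and \<beta>: "\<beta> \<in> carrier_vec n"
  shows "form_cocycle q (upper_part H) \<alpha> \<beta> =
    q powi (\<alpha> \<bullet> (H *\<^sub>v \<beta>)) * form_cocycle q (upper_part H) \<beta> \<alpha>"
proof -
  let ?U = "upper_part H"
  have U: "?U \<in> carrier_mat n n" using H(1) by (rule upper_part_carrier)
  have skew: "H $$ (j, i) = - H $$ (i, j)" if "i < n" "j < n" for i j
    using arg_cong[OF H(2), of "\<lambda>A. A $$ (i, j)"] that H(1) by simp
  have "H + transpose_mat ?U = ?U"
  proof (rule eq_matI)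
    fix i j assume "i < dim_row ?U" "j < dim_col ?U"
    then show "(H + transpose_mat ?U) $$ (i, j) = ?U $$ (i, j)"
      using H(1) skew[of i j] skew[of i i] by (auto simp: upper_part_def)
  qed (use H(1) in \<open>auto simp: upper_part_def\<close>)
  then have "\<alpha> \<bullet> (?U *\<^sub>v \<beta>) = \<alpha> \<bullet> ((H + transpose_mat ?U) *\<^sub>v \<beta>)"
    by simp
  also have "\<dots> = \<alpha> \<bullet> (H *\<^sub>v \<beta>) + \<alpha> \<bullet> (transpose_mat ?U *\<^sub>v \<beta>)"
    using H(1) U \<alpha> \<beta> by (simp add: add_mult_distrib_mat_vec[of _ n n] scalar_prod_add_distrib[of _ n])
  also have "\<alpha> \<bullet> (transpose_mat ?U *\<^sub>v \<beta>) = (transpose_mat ?U *\<^sub>v \<beta>) \<bullet> \<alpha>"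
    using U \<alpha> \<beta> by (intro comm_scalar_prod[of _ n]) auto
  also have "\<dots> = \<beta> \<bullet> (?U *\<^sub>v \<alpha>)"
    using U \<alpha> \<beta> by (rule transpose_vec_mult_scalar)
  finally show ?thesis using q by (simp add: form_cocycle_def powi_add)
qed

lemma form_unit_vec:
  assumes "H \<in> carrier_mat n n" "i < n" "j < n"
  shows "unit_vec n i \<bullet> (H *\<^sub>v unit_vec n j) = (H $$ (i, j) :: int)"
proof -
  have "unit_vec n i \<bullet> (H *\<^sub>v unit_vec n j) = (H *\<^sub>v unit_vec n j) $ i"
    using assms by (intro scalar_prod_left_unit) auto
  also have "\<dots> = row H i \<bullet> unit_vec n j" using assms by simp
  also have "\<dots> = row H i $ j" using assms by (intro scalar_prod_right_unit)
  finally show ?thesis using assms by simp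
qed

lemma int_kernel_eq: "H \<in> carrier_mat n n \<Longrightarrow> int_kernel H = {\<alpha> \<in> carrier_vec n. H *\<^sub>v \<alpha> = 0\<^sub>v n}"
  by (auto simp: int_kernel_def)

lemma int_kernel_closed:
  assumes "H \<in> carrier_mat n n"
  shows "int_kernel H \<subseteq> carrier_vec n" "0\<^sub>v n \<in> int_kernel H"
    "\<alpha> \<in> int_kernel H \<Longrightarrow> \<beta> \<in> int_kernel H \<Longrightarrow> \<alpha> + \<beta> \<in> int_kernel H"
proof -
  show "0\<^sub>v n \<in> int_kernel H"
    using assms by (auto simp: int_kernel_eq intro!: eq_vecI)
qed (use assms in \<open>auto simp: int_kernel_eq mult_add_distrib_mat_vec[of _ n n]\<close>)


subsection \<open>The normal form of a skew-symmetric matrix\<close>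

definition normal_form :: "nat list \<Rightarrow> nat \<Rightarrow> int mat" where
  "normal_form ms k = diag_block_mat (map (\<lambda>m. int m \<cdot>\<^sub>m \<S>) ms @ [0\<^sub>m k k])"

lemma symplectic2_carrier: "\<S> \<in> carrier_mat 2 2"
  by (simp add: symplectic2_def mat_of_rows_list_def numeral_2_eq_2)

lemma symplectic2_index:
  "\<S> $$ (0, 0) = 0" "\<S> $$ (0, Suc 0) = 1" "\<S> $$ (Suc 0, 0) = -1" "\<S> $$ (Suc 0, Suc 0) = 0"
  by (simp_all add: symplectic2_def mat_of_rows_list_def)

lemma normal_form_Nil: "normal_form [] k = 0\<^sub>m k k"
  by (simp add: normal_form_def)

lemma normal_form_carrier: "normal_form ms k \<in> carrier_mat (2 * length ms + k) (2 * length ms + k)"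
proof -
  have "map dim_row (map (\<lambda>m. int m \<cdot>\<^sub>m \<S>) ms) = replicate (length ms) 2"
    "map dim_col (map (\<lambda>m. int m \<cdot>\<^sub>m \<S>) ms) = replicate (length ms) 2"
    using symplectic2_carrier by (induction ms) auto
  then show ?thesis
    unfolding normal_form_def carrier_mat_def dim_diag_block_mat mem_Collect_eq map_append sum_list_append
    by (simp add: sum_list_replicate)
qed

text \<open>Coordinates 2i and 2i+1 span the i-th plane, so a row meets only the column of its
  partner, with a sign given by parity.\<close>

lemma normal_form_index:
  assumes "r < 2 * length ms + k" "c < 2 * length ms + k"
  shows "normal_form ms k $$ (r, c) =
    (if r < 2 * length ms \<and> c = (if even r then Suc r else r - 1)
     then (if even r then int (ms ! (r div 2)) else - int (ms ! (r div 2))) else 0)"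
  using assms
proof (induction ms arbitrary: r c)
  case Nil
  then show ?case by (simp add: normal_form_Nil)
next
  case (Cons m ms)
  let ?A = "int m \<cdot>\<^sub>m \<S>" and ?D = "normal_form ms k"
  have A: "dim_row ?A = 2" "dim_col ?A = 2" using symplectic2_carrier by auto
  have D: "dim_row ?D = 2 * length ms + k" "dim_col ?D = 2 * length ms + k"
    using normal_form_carrier by blast+
  have "normal_form (m # ms) k = four_block_mat ?A (0\<^sub>m 2 (dim_col ?D)) (0\<^sub>m (dim_row ?D) 2) ?D"
    using symplectic2_carrier by (simp add: normal_form_def Let_def)
  then have eq: "normal_form (m # ms) k $$ (r, c) =
      (if r < 2 then if c < 2 then ?A $$ (r, c) else 0
       else if c < 2 then 0 else ?D $$ (r - 2, c - 2))"
    using Cons.prems A D by auto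
  consider "r = 0" | "r = 1" | r' where "r = Suc (Suc r')" by (metis One_nat_def nat.exhaust)
  then show ?case
  proof cases
    case 1
    then show ?thesis unfolding eq using Cons.prems A
      by (auto simp: less_2_cases_iff symplectic2_index)
  next
    case 2
    then show ?thesis unfolding eq using Cons.prems A
      by (auto simp: less_2_cases_iff symplectic2_index)
  next
    case 3
    show ?thesis
    proof (cases "c < 2")
      case True
      then show ?thesis unfolding eq using 3 by (auto elim: oddE)
    next
      case False
      then obtain c' where c: "c = Suc (Suc c')" by (metis One_nat_def nat.exhaust less_2_cases_iff)
      have "?D $$ (r', c') = (if r' < 2 * length ms \<and> c' = (if even r' then Suc r' else r' - 1)
         then (if even r' then int (ms ! (r' div 2)) else - int (ms ! (r' div 2))) else 0)"
        using Cons.prems 3 c by (intro Cons.IH) auto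
      \<comment> \<open>Truncated subtraction is harmless here because an odd \<open>r'\<close> is
        positive.\<close>
      moreover have "(Suc (Suc c') = Suc (Suc r') - 1) = (c' = r' - 1)" if "odd r'"
        using that by (cases r') auto
      ultimately show ?thesis unfolding eq using 3 c by auto
    qed
  qed
qed

lemma normal_form_mult_vec:
  assumes v: "v \<in> carrier_vec (2 * length ms + k)" and r: "r < 2 * length ms + k"
  shows "(normal_form ms k *\<^sub>v v) $ r =
    (if r < 2 * length ms then
       (if even r then int (ms ! (r div 2)) * v $ Suc r else - int (ms ! (r div 2)) * v $ (r - 1))
     else 0)"
proof -
  let ?n = "2 * length ms + k" and ?c = "if even r then Suc r else r - 1"
  let ?d = "if even r then int (ms ! (r div 2)) else - int (ms ! (r div 2))"
  have "(normal_form ms k *\<^sub>v v) $ r = (\<Sum>c<?n. normal_form ms k $$ (r, c) * v $ c)"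
    using normal_form_carrier[of ms k] v r
    by (auto simp: scalar_prod_def atLeast0LessThan intro!: sum.cong)
  \<comment> \<open>Only the partner column survives. In the zero block \<open>?c\<close> may leave
    the index range, which the inner conditional guards against.\<close>
  also have "\<dots> = (\<Sum>c<?n. if c = ?c then (if r < 2 * length ms then ?d * v $ c else 0) else 0)"
    using r by (intro sum.cong refl) (simp add: normal_form_index)
  also have "\<dots> = (if r < 2 * length ms then ?d * v $ ?c else 0)"
  proof (cases "r < 2 * length ms")
    case True
    then have "?c < 2 * length ms" by (auto elim!: evenE)
    then show ?thesis using True by simp
  next
    case False
    then show ?thesis by simp
  qed
  finally show ?thesis by simp
qed

lemma sum_even_odd: "(\<Sum>r<2 * N. f r) = (\<Sum>i<N. f (2 * i) + f (2 * i + 1) :: int)" for N :: nat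
  by (induction N) (simp_all add: add_ac)

lemma normal_form_form:
  assumes u: "u \<in> carrier_vec (2 * length ms + k)" and v: "v \<in> carrier_vec (2 * length ms + k)"
  shows "u \<bullet> (normal_form ms k *\<^sub>v v) =
    (\<Sum>i<length ms. int (ms ! i) * (u $ (2 * i) * v $ (2 * i + 1) - u $ (2 * i + 1) * v $ (2 * i)))"
proof -
  let ?n = "2 * length ms + k"
  have "u \<bullet> (normal_form ms k *\<^sub>v v) = (\<Sum>r<?n. u $ r * (normal_form ms k *\<^sub>v v) $ r)"
    using normal_form_carrier[of ms k] by (simp add: scalar_prod_def atLeast0LessThan)
  also have "\<dots> = (\<Sum>r<2 * length ms. u $ r * (normal_form ms k *\<^sub>v v) $ r)"
    by (rule sum.mono_neutral_right) (auto simp: normal_form_mult_vec[OF v])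
  also have "\<dots> = (\<Sum>i<length ms. int (ms ! i) * (u $ (2 * i) * v $ (2 * i + 1) - u $ (2 * i + 1) * v $ (2 * i)))"
    unfolding sum_even_odd
    by (rule sum.cong) (auto simp: normal_form_mult_vec[OF v] algebra_simps)
  finally show ?thesis .
qed

lemma symplectic2_form:
  assumes "u \<in> carrier_vec 2" "v \<in> carrier_vec 2"
  shows "u \<bullet> (\<S> *\<^sub>v v) = u $ 0 * v $ 1 - u $ 1 * v $ 0"
proof -
  \<comment> \<open>The standard plane is the normal form with a single block, so its form is a case
    of \<open>normal_form_form\<close>.\<close>
  have "normal_form [1] 0 = \<S>"
  proof (rule eq_matI)
    fix i j assume "i < dim_row \<S>" "j < dim_col \<S>"
    then show "normal_form [1] 0 $$ (i, j) = \<S> $$ (i, j)"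
      using symplectic2_carrier normal_form_index[of i "[1]" 0 j]
      by (auto simp: less_2_cases_iff symplectic2_index)
  qed (use normal_form_carrier[of "[1]" 0] symplectic2_carrier in auto)
  then show ?thesis using normal_form_form[of u "[1]" 0 v] assms by simp
qed

lemma normal_form_kernel:
  assumes v: "v \<in> carrier_vec (2 * length ms + k)" and pos: "\<forall>m \<in> set ms. 0 < m"
  shows "normal_form ms k *\<^sub>v v = 0\<^sub>v (2 * length ms + k) \<longleftrightarrow> (\<forall>j < 2 * length ms. v $ j = 0)"
proof
  assume eq: "normal_form ms k *\<^sub>v v = 0\<^sub>v (2 * length ms + k)"
  show "\<forall>j < 2 * length ms. v $ j = 0"
  proof (intro allI impI)
    fix j assume j: "j < 2 * length ms"
    \<comment> \<open>Coordinate \<open>j\<close> is read off in the row of its partner, where it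
      appears with a nonzero factor.\<close>
    define r where "r = (if even j then Suc j else j - 1)"
    have r: "r < 2 * length ms" using j by (auto simp: r_def elim!: evenE)
    then have "0 < ms ! (r div 2)" using pos by simp
    moreover have "(normal_form ms k *\<^sub>v v) $ r = 0" using eq r by simp
    ultimately show "v $ j = 0"
      using normal_form_mult_vec[OF v, of r] r by (auto simp: r_def elim!: oddE split: if_splits)
  qed
next
  assume *: "\<forall>j < 2 * length ms. v $ j = 0"
  show "normal_form ms k *\<^sub>v v = 0\<^sub>v (2 * length ms + k)"
  proof (rule eq_vecI)
    fix r assume "r < dim_vec (0\<^sub>v (2 * length ms + k) :: int vec)"
    then have r: "r < 2 * length ms + k" by simp
    have "Suc r < 2 * length ms" if "even r" "r < 2 * length ms" using that by (auto elim!: evenE)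
    then show "(normal_form ms k *\<^sub>v v) $ r = 0\<^sub>v (2 * length ms + k) $ r"
      using normal_form_mult_vec[OF v r] * r by auto
  qed (use normal_form_carrier[of ms k] in auto)
qed


section \<open>The kernel subalgebra\<close>

lemma (in complex_algebra) complex_subalgebra:
  assumes C: "C \<subseteq> carrier A" "\<one> \<in> C"
    and closed: "\<And>y z. y \<in> C \<Longrightarrow> z \<in> C \<Longrightarrow> y \<oplus> z \<in> C" "\<And>y z. y \<in> C \<Longrightarrow> z \<in> C \<Longrightarrow> y \<otimes> z \<in> C"
      "\<And>d y. y \<in> C \<Longrightarrow> d \<odot> y \<in> C"
  shows "complex_algebra (A\<lparr>carrier := C\<rparr>)"
proof -
  let ?B = "A\<lparr>carrier := C\<rparr>"
  have zero: "\<zero> \<in> C" using closed(3)[OF C(2), of 0] by simp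
  have minus: "\<ominus> y \<in> C" if "y \<in> C" for y
    using closed(3)[OF that, of "-1"] C(1) that by (auto simp: smult_minus_one)
  have "abelian_group ?B"
  proof (rule abelian_groupI)
    fix y assume "y \<in> carrier ?B"
    then show "\<exists>z\<in>carrier ?B. z \<oplus>\<^bsub>?B\<^esub> y = \<zero>\<^bsub>?B\<^esub>"
      using minus C(1) by (intro bexI[of _ "\<ominus> y"]) (auto simp: l_neg)
  qed (use C closed zero in \<open>auto simp: a_ac subset_iff\<close>)
  moreover have "monoid ?B"
    by (rule monoidI) (use C closed in \<open>auto simp: m_assoc subset_iff\<close>)
  ultimately have "ring ?B"
    by (rule ringI) (use C in \<open>auto simp: l_distr r_distr subset_iff\<close>)
  moreover have "complex_algebra_axioms ?B"
    by standard (use C closed in \<open>auto simp: smult_l_distr smult_r_distr smult_smult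
      mult_smult_left mult_smult_right subset_iff\<close>)
  ultimately show ?thesis by (simp add: complex_algebra_def)
qed

lemma vec_add_left_cancel:
  assumes "\<alpha> \<in> carrier_vec n" "\<beta> \<in> carrier_vec n" "\<gamma> \<in> carrier_vec n"
  shows "\<gamma> + \<alpha> = \<gamma> + \<beta> \<longleftrightarrow> \<alpha> = (\<beta> :: int vec)"
proof
  assume eq: "\<gamma> + \<alpha> = \<gamma> + \<beta>"
  show "\<alpha> = \<beta>"
  proof (rule eq_vecI)
    fix i assume "i < dim_vec \<beta>"
    then show "\<alpha> $ i = \<beta> $ i"
      using arg_cong[OF eq, of "\<lambda>v. v $ i"] assms by simp
  qed (use assms in auto)
qed simp

lemma powi_eq_one:
  assumes "\<forall>k>0. q ^ k \<noteq> (1 :: complex)" "q powi z = 1"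
  shows "z = 0"
proof (rule ccontr)
  assume "z \<noteq> 0"
  then have "0 < nat \<bar>z\<bar>" by simp
  moreover have "q ^ nat \<bar>z\<bar> = 1"
    using assms(2) by (auto simp: power_int_def abs_if power_inverse split: if_splits)
  ultimately show False using assms(1) by blast
qed

text \<open>Coordinates on \<open>L\<close>: questions about spans, bases and the centre become
  questions about supports and coefficients under \<open>k\<close>.\<close>

locale quasi_laurent_monomials = quasi_laurent_algebra q H n for q H n +
  fixes k :: "free_elem set \<Rightarrow> (int vec \<Rightarrow>\<^sub>0 complex)" and c :: "int vec \<Rightarrow> complex"
  assumes skew: "transpose_mat H = - H"
    and k: "alg_hom L (twisted_algebra (monoid_vec TYPE(int) n) (form_cocycle q (upper_part H))) k"
    and k_bij: "bij_betw k (carrier L)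
      (carrier (twisted_algebra (monoid_vec TYPE(int) n) (form_cocycle q (upper_part H))))"
    and c_nonzero: "\<alpha> \<in> carrier_vec n \<Longrightarrow> c \<alpha> \<noteq> 0"
    and k_monomial: "\<alpha> \<in> carrier_vec n \<Longrightarrow> k (ql_monomial q H \<alpha>) = Poly_Mapping.single \<alpha> (c \<alpha>)"
begin

abbreviation "\<omega> \<equiv> form_cocycle q (upper_part H)"
abbreviation "K \<equiv> int_kernel H"
abbreviation "T \<equiv> twisted_algebra (monoid_vec TYPE(int) n) \<omega>"
abbreviation "TK \<equiv> twisted_algebra (sublattice n K) \<omega>"
abbreviation "Z \<equiv> ql_kernel_algebra q H"
text \<open>The kernel algebra described by supports; closure under products is easier to see here
  than for a span.\<close>

abbreviation "C \<equiv> {z \<in> carrier L. Poly_Mapping.keys (k z) \<subseteq> K}"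

lemmas K_closed = int_kernel_closed[OF H_carrier]

sublocale M: twisted_monoid "monoid_vec TYPE(int) n" \<omega>
  using twisted_monoid_sublattice[OF q_nonzero upper_part_carrier[OF H_carrier], of "carrier_vec n"]
  by (simp add: sublattice_full)

sublocale N: twisted_monoid "sublattice n K" \<omega>
  using K_closed by (intro twisted_monoid_sublattice[OF q_nonzero upper_part_carrier[OF H_carrier]])

sublocale T: complex_algebra T
  by (rule M.complex_algebra_twisted)

lemma cocycle_commutator:
  "\<alpha> \<in> carrier_vec n \<Longrightarrow> \<beta> \<in> carrier_vec n \<Longrightarrow> \<omega> \<alpha> \<beta> = q powi (\<alpha> \<bullet> (H *\<^sub>v \<beta>)) * \<omega> \<beta> \<alpha>"
  by (rule form_cocycle_commutator[OF q_nonzero H_carrier skew])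

lemma cocycle_kernel:
  assumes "\<alpha> \<in> carrier_vec n" "\<beta> \<in> K"
  shows "\<omega> \<alpha> \<beta> = \<omega> \<beta> \<alpha>"
  using assms cocycle_commutator[of \<alpha> \<beta>] by (simp add: int_kernel_eq[OF H_carrier])

lemma k_closed: "z \<in> carrier L \<Longrightarrow> Poly_Mapping.keys (k z) \<subseteq> carrier_vec n"
  using alg_homD(1)[OF k, of z] by simp

lemmas k_hom = alg_homD(2-5)[OF k, simplified]

lemma k_zero: "k \<zero>\<^bsub>L\<^esub> = 0"
  using alg_hom_zero[OF k L.complex_algebra_axioms T.complex_algebra_axioms] by simp

lemma k_inj: "y \<in> carrier L \<Longrightarrow> z \<in> carrier L \<Longrightarrow> k y = k z \<Longrightarrow> y = z"
  using k_bij by (auto simp: bij_betw_def inj_on_def)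

lemma TK_mult: "p \<otimes>\<^bsub>TK\<^esub> r = p \<otimes>\<^bsub>T\<^esub> r"
  by (simp add: twisted_mult_eq)

lemma monomial_in_C: "\<alpha> \<in> K \<Longrightarrow> ql_monomial q H \<alpha> \<in> C"
proof -
  assume \<alpha>: "\<alpha> \<in> K"
  then have "k (ql_monomial q H \<alpha>) = Poly_Mapping.single \<alpha> (c \<alpha>)"
    using K_closed(1) by (intro k_monomial) auto
  with \<alpha> show ?thesis by simp
qed

lemma C_closed:
  shows "\<zero>\<^bsub>L\<^esub> \<in> C" "\<one>\<^bsub>L\<^esub> \<in> C"
    and "y \<in> C \<Longrightarrow> z \<in> C \<Longrightarrow> y \<oplus>\<^bsub>L\<^esub> z \<in> C"
    and "y \<in> C \<Longrightarrow> z \<in> C \<Longrightarrow> y \<otimes>\<^bsub>L\<^esub> z \<in> C"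
    and "y \<in> C \<Longrightarrow> d \<odot>\<^bsub>L\<^esub> y \<in> C"
proof -
  show "y \<in> C \<Longrightarrow> z \<in> C \<Longrightarrow> y \<otimes>\<^bsub>L\<^esub> z \<in> C"
    using N.twisted_mult_closed[of "k y" "k z"] by (simp add: k_hom TK_mult)
  show "y \<in> C \<Longrightarrow> d \<odot>\<^bsub>L\<^esub> y \<in> C"
    using keys_map_times[of d "k y"] by (auto simp: k_hom)
qed (use K_closed in \<open>simp_all add: k_zero k_hom keys_add_subset\<close>)

lemma submodule_C: "LinearCombinations.submodule class_ring C L"
  unfolding LinearCombinations.submodule_def
  using C_closed(1,3,5) L.is_module by blast

text \<open>Every function supported in \<open>K\<close> is the image of an element of the span,
  after division by the factors \<open>c\<close>; injectivity of \<open>k\<close> pulls this back to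
  \<open>C\<close>.\<close>

lemma span_monomials: "LinearCombinations.module.span class_ring L (ql_monomial q H ` K) = C"
proof
  interpret V: vectorspace class_ring L by (rule L.is_vectorspace)
  let ?S = "V.span (ql_monomial q H ` K)"
  show "?S \<subseteq> C"
    using monomial_in_C submodule_C by (intro V.span_is_subset) auto
  have mono: "ql_monomial q H ` K \<subseteq> carrier L" by auto
  interpret S: LinearCombinations.submodule class_ring ?S L
    by (rule V.span_is_submodule[OF mono])
  have "\<exists>z \<in> ?S. k z = p" if "Poly_Mapping.keys p \<subseteq> K" for p
    using that
  proof (induction p rule: poly_mapping_induct_on)
    case zero
    show ?case using S.zero_closed k_zero by blast
  next
    case (single \<alpha> d)
    then have \<alpha>: "\<alpha> \<in> carrier_vec n" using K_closed(1) by auto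
    have "ql_monomial q H \<alpha> \<in> ?S" using V.in_own_span[OF mono] single by auto
    then have "(d / c \<alpha>) \<odot>\<^bsub>L\<^esub> ql_monomial q H \<alpha> \<in> ?S"
      by (intro S.smult_closed) auto
    moreover have "k ((d / c \<alpha>) \<odot>\<^bsub>L\<^esub> ql_monomial q H \<alpha>) = Poly_Mapping.single \<alpha> d"
      using c_nonzero[OF \<alpha>] k_monomial[OF \<alpha>] by (simp add: k_hom)
    ultimately show ?case by blast
  next
    case (add p r)
    then obtain y z where yz: "y \<in> ?S" "z \<in> ?S" "k y = p" "k z = r" by blast
    then have "y \<in> carrier L" "z \<in> carrier L" using S.subset by auto
    then have "k (y \<oplus>\<^bsub>L\<^esub> z) = p + r" using yz by (simp add: k_hom)
    then show ?case using S.m_closed[OF yz(1,2)] by blast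
  qed
  then show "C \<subseteq> ?S"
    using k_inj S.subset by blast
qed

lemma Z_eq: "Z = L\<lparr>carrier := C\<rparr>"
  by (simp only: ql_kernel_algebra_def span_monomials)

lemma Z_simps:
  "carrier Z = C" "y \<oplus>\<^bsub>Z\<^esub> z = y \<oplus>\<^bsub>L\<^esub> z" "y \<otimes>\<^bsub>Z\<^esub> z = y \<otimes>\<^bsub>L\<^esub> z" "\<one>\<^bsub>Z\<^esub> = \<one>\<^bsub>L\<^esub>"
  "\<zero>\<^bsub>Z\<^esub> = \<zero>\<^bsub>L\<^esub>" "d \<odot>\<^bsub>Z\<^esub> z = d \<odot>\<^bsub>L\<^esub> z"
  by (simp_all add: Z_eq)

lemma complex_algebra_Z: "complex_algebra Z"
  unfolding Z_eq using C_closed by (intro L.complex_subalgebra) auto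

sublocale Z: complex_algebra Z
  by (rule complex_algebra_Z)

lemma Z_twisted:
  shows "alg_hom Z TK k" and "bij_betw k (carrier Z) (carrier TK)"
proof -
  show "alg_hom Z TK k"
    unfolding alg_hom_def Ring.ring_hom_def using TK_mult by (auto simp: Z_simps k_hom)
  have "inj_on k C" using k_inj by (auto simp: inj_on_def)
  moreover have "k ` C = {p. Poly_Mapping.keys p \<subseteq> K}"
  proof
    show "{p. Poly_Mapping.keys p \<subseteq> K} \<subseteq> k ` C"
    proof
      fix p :: "int vec \<Rightarrow>\<^sub>0 complex"
      assume "p \<in> {p. Poly_Mapping.keys p \<subseteq> K}"
      moreover from this have "p \<in> k ` carrier L"
        using k_bij K_closed(1) by (auto simp: bij_betw_def)
      ultimately show "p \<in> k ` C" by auto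
    qed
  qed auto
  ultimately show "bij_betw k (carrier Z) (carrier TK)"
    by (simp add: bij_betw_def Z_simps)
qed

lemma inj_monomial: "inj_on (ql_monomial q H) (carrier_vec n)"
proof (rule inj_onI)
  fix \<alpha> \<beta> assume "\<alpha> \<in> carrier_vec n" "\<beta> \<in> carrier_vec n" "ql_monomial q H \<alpha> = ql_monomial q H \<beta>"
  then have "Poly_Mapping.single \<alpha> (c \<alpha>) = Poly_Mapping.single \<beta> (c \<beta>)" "c \<alpha> \<noteq> 0"
    using k_monomial c_nonzero by metis+
  then show "\<alpha> = \<beta>" by (metis lookup_single_eq lookup_single_not_eq)
qed

lemma coefficient_finsum:
  assumes "finite A" "f \<in> A \<rightarrow> carrier L"
  shows "Poly_Mapping.lookup (k (\<Oplus>\<^bsub>L\<^esub>v\<in>A. f v)) \<alpha> = (\<Sum>v\<in>A. Poly_Mapping.lookup (k (f v)) \<alpha>)"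
  using assms
proof (induction rule: finite_induct)
  case empty
  then show ?case by (simp add: k_zero)
next
  case (insert v A)
  then show ?case by (simp add: k_hom lookup_add Pi_iff)
qed

lemma basis_monomials: "vectorspace.basis class_ring Z (ql_monomial q H ` K)"
proof -
  interpret V: vectorspace class_ring L by (rule L.is_vectorspace)
  interpret W: vectorspace class_ring Z by (rule Z.is_vectorspace)
  let ?B = "ql_monomial q H ` K"
  have B: "?B \<subseteq> C" using monomial_in_C by auto
  have BL: "?B \<subseteq> carrier L" by auto
  \<comment> \<open>Span and independence are computed in \<open>L\<close> and transferred to the
    submodule.\<close>
  have "W.span ?B = V.span ?B"
    using V.span_li_not_depend(1)[OF B submodule_C] by (simp add: Z_eq)
  then have gen: "W.span ?B = carrier Z"
    by (simp add: span_monomials Z_simps)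
  have "V.lin_indpt ?B"
  proof
    assume "V.lin_dep ?B"
    then obtain A a v where *: "finite A" "A \<subseteq> ?B" "V.lincomb a A = \<zero>\<^bsub>L\<^esub>" "v \<in> A" "a v \<noteq> 0"
      unfolding V.lin_dep_def by auto
    obtain \<alpha> where \<alpha>: "\<alpha> \<in> K" "v = ql_monomial q H \<alpha>" using * by blast
    then have \<alpha>n: "\<alpha> \<in> carrier_vec n" using K_closed(1) by auto
    have AL: "u \<in> carrier L" if "u \<in> A" for u using *(2) that by auto
    \<comment> \<open>The coefficient at \<open>\<alpha>\<close> isolates \<open>v\<close>, because
      distinct monomials go to multiples of distinct basis vectors.\<close>
    have "0 = (\<Sum>u\<in>A. Poly_Mapping.lookup (k (a u \<odot>\<^bsub>L\<^esub> u)) \<alpha>)"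
      using coefficient_finsum[of A "\<lambda>u. a u \<odot>\<^bsub>L\<^esub> u" \<alpha>] * AL
      by (auto simp: V.lincomb_def k_zero)
    also have "\<dots> = (\<Sum>u\<in>A. a u * Poly_Mapping.lookup (k u) \<alpha>)"
      using AL by (intro sum.cong) (simp_all add: k_hom)
    also have "\<dots> = (\<Sum>u\<in>A. if u = v then a v * c \<alpha> else 0)"
    proof (intro sum.cong refl)
      fix u assume "u \<in> A"
      then obtain \<beta> where \<beta>: "\<beta> \<in> K" "u = ql_monomial q H \<beta>" using *(2) by blast
      then have "k u = Poly_Mapping.single \<beta> (c \<beta>)" using k_monomial K_closed(1) by auto
      moreover have "u = v \<longleftrightarrow> \<beta> = \<alpha>"
        using inj_onD[OF inj_monomial, of \<beta> \<alpha>] \<beta> \<alpha> K_closed(1) by auto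
      ultimately show "a u * Poly_Mapping.lookup (k u) \<alpha> = (if u = v then a v * c \<alpha> else 0)"
        by (auto simp: lookup_single when_def)
    qed
    also have "\<dots> = a v * c \<alpha>" using * by simp
    finally show False using *(5) c_nonzero[OF \<alpha>n] by simp
  qed
  then have "W.lin_indpt ?B"
    using V.span_li_not_depend(2)[OF B submodule_C] by (simp add: Z_eq)
  then show ?thesis
    using gen B by (simp add: W.basis_def Z_simps)
qed

text \<open>Multiplication by a basis vector translates supports injectively, so a single
  coefficient of \<open>p\<close> contributes. Both products are read at the same index to make left
  and right comparable.\<close>

lemma lookup_single_mult:
  assumes p: "Poly_Mapping.keys p \<subseteq> carrier_vec n" and \<alpha>: "\<alpha> \<in> carrier_vec n" and \<beta>: "\<beta> \<in> carrier_vec n"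
  shows "Poly_Mapping.lookup (Poly_Mapping.single \<beta> d \<otimes>\<^bsub>T\<^esub> p) (\<beta> + \<alpha>) = \<omega> \<beta> \<alpha> * d * Poly_Mapping.lookup p \<alpha>"
    and "Poly_Mapping.lookup (p \<otimes>\<^bsub>T\<^esub> Poly_Mapping.single \<beta> d) (\<beta> + \<alpha>) = \<omega> \<alpha> \<beta> * d * Poly_Mapping.lookup p \<alpha>"
proof -
  show "Poly_Mapping.lookup (Poly_Mapping.single \<beta> d \<otimes>\<^bsub>T\<^esub> p) (\<beta> + \<alpha>) = \<omega> \<beta> \<alpha> * d * Poly_Mapping.lookup p \<alpha>"
    using p
  proof (induction p rule: poly_mapping_induct_on)
    case (single \<gamma> e)
    then show ?case
      using \<alpha> \<beta> by (auto simp: lookup_single when_def vec_add_left_cancel[of _ n])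
  qed (simp_all add: twisted_mult_add lookup_add algebra_simps)
  show "Poly_Mapping.lookup (p \<otimes>\<^bsub>T\<^esub> Poly_Mapping.single \<beta> d) (\<beta> + \<alpha>) = \<omega> \<alpha> \<beta> * d * Poly_Mapping.lookup p \<alpha>"
    using p
  proof (induction p rule: poly_mapping_induct_on)
    case (single \<gamma> e)
    then have "\<gamma> + \<beta> = \<beta> + \<gamma>" using \<beta> by (intro comm_add_vec)
    then show ?case
      using \<alpha> \<beta> single by (auto simp: lookup_single when_def vec_add_left_cancel[of _ n])
  qed (simp_all add: twisted_mult_add lookup_add algebra_simps)
qed

lemma kernel_central:
  assumes "Poly_Mapping.keys p \<subseteq> K" "Poly_Mapping.keys r \<subseteq> carrier_vec n"
  shows "p \<otimes>\<^bsub>T\<^esub> r = r \<otimes>\<^bsub>T\<^esub> p"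
  using assms(1)
proof (induction p rule: poly_mapping_induct_on)
  case (single \<alpha> d)
  then have \<alpha>: "\<alpha> \<in> carrier_vec n" using K_closed(1) by auto
  show ?case using assms(2)
  proof (induction r rule: poly_mapping_induct_on)
    case s: (single \<beta> e)
    then show ?case
      using cocycle_kernel[OF s single] comm_add_vec[OF \<alpha> s] by (simp add: mult_ac)
  qed (simp_all add: twisted_mult_add)
qed (simp_all add: twisted_mult_add)

lemma kernel_algebra_eq_centre:
  assumes "(\<forall>k>0. q ^ k \<noteq> 1) \<or> H = 0\<^sub>m n n"
  shows "Z = alg_centre L"
proof -
  have "C = {z \<in> carrier L. \<forall>a \<in> carrier L. z \<otimes>\<^bsub>L\<^esub> a = a \<otimes>\<^bsub>L\<^esub> z}"
  proof (intro Collect_cong conj_cong refl iffI ballI)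
    fix z a assume "z \<in> carrier L" "Poly_Mapping.keys (k z) \<subseteq> K" "a \<in> carrier L"
    then have "k (z \<otimes>\<^bsub>L\<^esub> a) = k (a \<otimes>\<^bsub>L\<^esub> z)"
      using kernel_central[of "k z" "k a"] k_closed by (simp add: k_hom)
    then show "z \<otimes>\<^bsub>L\<^esub> a = a \<otimes>\<^bsub>L\<^esub> z"
      using \<open>z \<in> carrier L\<close> \<open>a \<in> carrier L\<close> by (intro k_inj) auto
  next
    fix z assume z: "z \<in> carrier L" and comm: "\<forall>a \<in> carrier L. z \<otimes>\<^bsub>L\<^esub> a = a \<otimes>\<^bsub>L\<^esub> z"
    show "Poly_Mapping.keys (k z) \<subseteq> K"
    proof
      fix \<alpha> assume key: "\<alpha> \<in> Poly_Mapping.keys (k z)"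
      then have \<alpha>: "\<alpha> \<in> carrier_vec n" using k_closed[OF z] by auto
      \<comment> \<open>Commutation with the monomial of \<open>\<beta>\<close> is compared at the
        exponent \<open>\<beta> + \<alpha>\<close>; the coefficient at \<open>\<alpha>\<close> is
        nonzero and cancels.\<close>
      have powi: "q powi (\<beta> \<bullet> (H *\<^sub>v \<alpha>)) = 1" if \<beta>: "\<beta> \<in> carrier_vec n" for \<beta>
      proof -
        have "k (z \<otimes>\<^bsub>L\<^esub> ql_monomial q H \<beta>) = k (ql_monomial q H \<beta> \<otimes>\<^bsub>L\<^esub> z)"
          using comm by simp
        then have "k z \<otimes>\<^bsub>T\<^esub> Poly_Mapping.single \<beta> (c \<beta>) = Poly_Mapping.single \<beta> (c \<beta>) \<otimes>\<^bsub>T\<^esub> k z"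
          using z k_monomial[OF \<beta>] by (simp add: k_hom)
        then have "\<omega> \<alpha> \<beta> * c \<beta> * Poly_Mapping.lookup (k z) \<alpha> = \<omega> \<beta> \<alpha> * c \<beta> * Poly_Mapping.lookup (k z) \<alpha>"
          using lookup_single_mult[OF k_closed[OF z] \<alpha> \<beta>, of "c \<beta>"] by metis
        then have "\<omega> \<alpha> \<beta> = \<omega> \<beta> \<alpha>"
          using key c_nonzero[OF \<beta>] by (simp add: in_keys_iff)
        moreover have "\<omega> \<alpha> \<beta> \<noteq> 0" using M.cocycle_nonzero[of \<alpha> \<beta>] \<alpha> \<beta> by simp
        ultimately show ?thesis using cocycle_commutator[OF \<beta> \<alpha>] by simp
      qed
      \<comment> \<open>If \<open>q\<close> is not a root of unity, the exponents vanish, and unit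
        vectors as \<open>\<beta>\<close> read off the entries.\<close>
      from assms have "H *\<^sub>v \<alpha> = 0\<^sub>v n"
      proof
        assume root: "\<forall>k>0. q ^ k \<noteq> 1"
        show ?thesis
        proof (rule eq_vecI)
          fix i assume "i < dim_vec (0\<^sub>v n :: int vec)"
          then have i: "i < n" by simp
          have "unit_vec n i \<bullet> (H *\<^sub>v \<alpha>) = 0"
            by (rule powi_eq_one[OF root powi]) simp
          then show "(H *\<^sub>v \<alpha>) $ i = 0\<^sub>v n $ i"
            using i \<alpha> H_carrier by (simp add: scalar_prod_left_unit[of _ n])
        qed (use H_carrier in auto)
      next
        assume "H = 0\<^sub>m n n"
        then show ?thesis using \<alpha> by (auto intro!: eq_vecI)
      qed
      then show "\<alpha> \<in> K" using \<alpha> by (simp add: int_kernel_eq[OF H_carrier])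
    qed
  qed
  then show ?thesis by (simp add: Z_eq alg_centre_def)
qed

end


section \<open>The decomposition\<close>

text \<open>The lattice of exponents is identified with itself. The commutator of the upper part
  evaluates on unit vectors to the entries of H.\<close>

lemma quasi_laurent_monomials_exist:
  assumes "q \<noteq> 0" "H \<in> carrier_mat n n" "transpose_mat H = - H"
  obtains k c where "quasi_laurent_monomials q H n k c"
proof -
  let ?M = "monoid_vec TYPE(int) n" and ?\<omega> = "form_cocycle q (upper_part H)"
  have "twisted_monoid (sublattice n (carrier_vec n)) ?\<omega>"
    using assms(2) by (intro twisted_monoid_sublattice[OF assms(1)] upper_part_carrier) auto
  then have M: "twisted_monoid ?M ?\<omega>" by (simp only: sublattice_full)
  interpret quasi_laurent_realization q H n ?M ?\<omega> "\<lambda>\<alpha>. \<alpha>"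
  proof (intro quasi_laurent_realization.intro quasi_laurent_realization_axioms.intro
      quasi_laurent_algebra.intro M assms)
    fix i j assume ij: "i < n" "j < n"
    show "?\<omega> (unit_vec n i) (unit_vec n j) = q powi (H $$ (i, j)) * ?\<omega> (unit_vec n j) (unit_vec n i)"
      using form_cocycle_commutator[OF assms, of "unit_vec n i" "unit_vec n j"] form_unit_vec[OF assms(2) ij]
      by simp
  qed (auto simp: bij_betw_def)
  obtain k c where "alg_hom L T k" "bij_betw k (carrier L) (carrier T)"
    "\<And>\<alpha>. \<alpha> \<in> carrier_vec n \<Longrightarrow> c \<alpha> \<noteq> 0"
    "\<And>\<alpha>. \<alpha> \<in> carrier_vec n \<Longrightarrow> k (ql_monomial q H \<alpha>) = Poly_Mapping.single \<alpha> (c \<alpha>)"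
    using realization_iso by blast
  then have "quasi_laurent_monomials q H n k c"
    by (intro quasi_laurent_monomials.intro quasi_laurent_monomials_axioms.intro
        quasi_laurent_algebra_axioms assms(3))
  then show thesis by (rule that)
qed

text \<open>A determinant of 1 or -1 is its own inverse, so scaling the adjugate by it gives an
  integral inverse.\<close>

lemma unimodular_inverse:
  assumes W: "(W :: int mat) \<in> carrier_mat n n" and det: "det W = 1 \<or> det W = -1"
  obtains V where "V \<in> carrier_mat n n" "W * V = 1\<^sub>m n" "V * W = 1\<^sub>m n"
proof
  let ?V = "det W \<cdot>\<^sub>m adj_mat W"
  note adj = adj_mat[OF W]
  have det2: "det W * det W = 1" using det by auto
  show "?V \<in> carrier_mat n n" using adj(1) by simp
  have "det W \<cdot>\<^sub>m (det W \<cdot>\<^sub>m 1\<^sub>m n) = (1\<^sub>m n :: int mat)"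
    by (rule eq_matI) (auto simp: det2 simp flip: mult.assoc)
  then show "W * ?V = 1\<^sub>m n" "?V * W = 1\<^sub>m n"
    using mult_smult_distrib[OF W adj(1), of "det W"] mult_smult_assoc_mat[OF adj(1) W, of "det W"] adj(2,3)
    by simp_all
qed

lemma prod_cocycle_nth:
  assumes "length as = length ws" "length bs = length ws"
  shows "prod_cocycle ws as bs = (\<Prod>i<length ws. (ws ! i) (as ! i) (bs ! i))"
  using assms
proof (induction ws arbitrary: as bs)
  case (Cons w ws)
  then obtain a as' b bs' where "as = a # as'" "bs = b # bs'"
    by (metis length_Suc_conv)
  with Cons show ?case by (simp add: prod.lessThan_Suc_shift del: prod.lessThan_Suc)
qed simp

lemma DirProd_list_mult_nth:
  assumes "xs \<in> carrier (DirProd_list Gs)" "ys \<in> carrier (DirProd_list Gs)" "i < length Gs"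
  shows "(xs \<otimes>\<^bsub>DirProd_list Gs\<^esub> ys) ! i = (xs ! i) \<otimes>\<^bsub>Gs ! i\<^esub> (ys ! i)"
  using assms
proof (induction Gs arbitrary: xs ys i)
  case (Cons G Gs)
  then show ?case
    by (cases i) (auto simp: DirProd_list_Cons_carrier DirProd_list_Cons_mult)
qed simp

lemma powi_sum: "(q :: complex) \<noteq> 0 \<Longrightarrow> (\<Prod>i<(N::nat). q powi f i) = q powi (\<Sum>i<N. f i)"
  by (induction N) (simp_all add: powi_add)

text \<open>Here \<open>P\<close> is the transpose of the base change matrix, so that \<open>\<alpha> = P \<beta>\<close> expresses
  exponent vectors in the new basis.\<close>

locale quasi_laurent_normal_form = quasi_laurent_monomials q H n k c for q H n k c +
  fixes P V :: "int mat" and ms :: "nat list" and d :: nat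
  assumes n_eq: "n = 2 * length ms + d"
    and P: "P \<in> carrier_mat n n" and V: "V \<in> carrier_mat n n"
    and PV: "P * V = 1\<^sub>m n" and VP: "V * P = 1\<^sub>m n"
    and normal: "transpose_mat P * H * P = normal_form ms d"
    and pos: "\<forall>m \<in> set ms. 0 < m"
begin

abbreviation "N \<equiv> length ms"

lemma index_bounds:
  "j < 2 * N \<Longrightarrow> j < n" "j < d \<Longrightarrow> j + 2 * N < n" "j < n \<Longrightarrow> \<not> j < 2 * N \<Longrightarrow> j - 2 * N < d"
  using n_eq by auto

lemma P_V: "\<alpha> \<in> carrier_vec n \<Longrightarrow> P *\<^sub>v (V *\<^sub>v \<alpha>) = \<alpha>"
  using assoc_mult_mat_vec[OF P V, of \<alpha>] PV by simp

lemma V_P: "\<alpha> \<in> carrier_vec n \<Longrightarrow> V *\<^sub>v (P *\<^sub>v \<alpha>) = \<alpha>"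
  using assoc_mult_mat_vec[OF V P, of \<alpha>] VP by simp

lemma P_closed: "\<alpha> \<in> carrier_vec n \<Longrightarrow> P *\<^sub>v \<alpha> \<in> carrier_vec n"
  using P by simp

lemma V_closed: "\<alpha> \<in> carrier_vec n \<Longrightarrow> V *\<^sub>v \<alpha> \<in> carrier_vec n"
  using V by simp

lemma V_add: "\<alpha> \<in> carrier_vec n \<Longrightarrow> \<beta> \<in> carrier_vec n \<Longrightarrow> V *\<^sub>v (\<alpha> + \<beta>) = V *\<^sub>v \<alpha> + V *\<^sub>v \<beta>"
  using V by (rule mult_add_distrib_mat_vec)

lemma P_add: "\<alpha> \<in> carrier_vec n \<Longrightarrow> \<beta> \<in> carrier_vec n \<Longrightarrow> P *\<^sub>v (\<alpha> + \<beta>) = P *\<^sub>v \<alpha> + P *\<^sub>v \<beta>"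
  using P by (rule mult_add_distrib_mat_vec)

lemma normal_form_vec:
  assumes "\<beta> \<in> carrier_vec n"
  shows "normal_form ms d *\<^sub>v \<beta> = transpose_mat P *\<^sub>v (H *\<^sub>v (P *\<^sub>v \<beta>))"
proof -
  have Pt: "transpose_mat P \<in> carrier_mat n n" using P by simp
  show ?thesis
    unfolding normal[symmetric] using assms P H_carrier Pt
    by (simp add: assoc_mult_mat_vec[of _ n n _ n])
qed

lemma form_eq:
  assumes "\<alpha> \<in> carrier_vec n" "\<beta> \<in> carrier_vec n"
  shows "\<alpha> \<bullet> (H *\<^sub>v \<beta>) = (V *\<^sub>v \<alpha>) \<bullet> (normal_form ms d *\<^sub>v (V *\<^sub>v \<beta>))"
proof -
  have H\<beta>: "H *\<^sub>v \<beta> \<in> carrier_vec n" using H_carrier assms by simp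
  have "normal_form ms d *\<^sub>v (V *\<^sub>v \<beta>) = transpose_mat P *\<^sub>v (H *\<^sub>v \<beta>)"
    using normal_form_vec[OF V_closed[OF assms(2)]] P_V[OF assms(2)] by simp
  then have "(V *\<^sub>v \<alpha>) \<bullet> (normal_form ms d *\<^sub>v (V *\<^sub>v \<beta>)) = (transpose_mat P *\<^sub>v (H *\<^sub>v \<beta>)) \<bullet> (V *\<^sub>v \<alpha>)"
    using assms P V H_carrier by (simp add: comm_scalar_prod[of _ n])
  also have "\<dots> = (H *\<^sub>v \<beta>) \<bullet> (P *\<^sub>v (V *\<^sub>v \<alpha>))"
    using P V_closed[OF assms(1)] H\<beta> by (rule transpose_vec_mult_scalar)
  also have "\<dots> = \<alpha> \<bullet> (H *\<^sub>v \<beta>)"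
    using P_V[OF assms(1)] assms H\<beta> by (simp add: comm_scalar_prod[of _ n])
  finally show ?thesis by simp
qed

text \<open>Multiplication by the invertible transpose of \<open>P\<close> does not affect whether H
  maps the vector to 0, so the kernel can be read off the normal form.\<close>

lemma kernel_iff:
  assumes "\<alpha> \<in> carrier_vec n"
  shows "\<alpha> \<in> K \<longleftrightarrow> (\<forall>j < 2 * N. (V *\<^sub>v \<alpha>) $ j = 0)"
proof -
  have Pt: "transpose_mat P \<in> carrier_mat n n" "transpose_mat V \<in> carrier_mat n n" using P V by auto
  have H\<alpha>: "H *\<^sub>v \<alpha> \<in> carrier_vec n" using H_carrier assms by simp
  have "transpose_mat V * transpose_mat P = 1\<^sub>m n"
    using transpose_mult[OF P V] PV by simp
  then have inv: "transpose_mat V *\<^sub>v (transpose_mat P *\<^sub>v (H *\<^sub>v \<alpha>)) = H *\<^sub>v \<alpha>"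
    using assoc_mult_mat_vec[OF Pt(2,1) H\<alpha>] H\<alpha> by simp
  have zero: "A *\<^sub>v 0\<^sub>v n = 0\<^sub>v n" if "A \<in> carrier_mat n n" for A :: "int mat"
    using that by (intro eq_vecI) auto
  have "normal_form ms d *\<^sub>v (V *\<^sub>v \<alpha>) = transpose_mat P *\<^sub>v (H *\<^sub>v \<alpha>)"
    using normal_form_vec[OF V_closed[OF assms]] P_V[OF assms] by simp
  then have "normal_form ms d *\<^sub>v (V *\<^sub>v \<alpha>) = 0\<^sub>v n \<longleftrightarrow> H *\<^sub>v \<alpha> = 0\<^sub>v n"
    using inv zero[OF Pt(1)] zero[OF Pt(2)] by metis
  moreover have "normal_form ms d *\<^sub>v (V *\<^sub>v \<alpha>) = 0\<^sub>v n \<longleftrightarrow> (\<forall>j < 2 * N. (V *\<^sub>v \<alpha>) $ j = 0)"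
    using normal_form_kernel[of "V *\<^sub>v \<alpha>" ms d] V_closed[OF assms] pos by (simp add: n_eq)
  ultimately show ?thesis
    using assms by (simp add: int_kernel_eq[OF H_carrier])
qed

text \<open>In the new coordinates, the projection onto the kernel; it keeps length \<open>n\<close>
  so that \<open>P\<close> can be applied afterwards.\<close>

definition tail :: "int vec \<Rightarrow> int vec" where
  "tail \<beta> = Matrix.vec n (\<lambda>j. if j < 2 * N then 0 else \<beta> $ j)"

lemma tail_closed: "tail \<beta> \<in> carrier_vec n"
  by (simp add: tail_def)

lemma P_tail_kernel: "P *\<^sub>v tail \<beta> \<in> K"
  unfolding kernel_iff[OF P_closed[OF tail_closed]] V_P[OF tail_closed]
  using index_bounds(1) by (simp add: tail_def)

lemma kernel_tail:
  assumes "\<kappa> \<in> K"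
  shows "P *\<^sub>v tail (V *\<^sub>v \<kappa>) = \<kappa>"
proof -
  have \<kappa>: "\<kappa> \<in> carrier_vec n" using assms K_closed(1) by auto
  have "tail (V *\<^sub>v \<kappa>) = V *\<^sub>v \<kappa>"
  proof (rule eq_vecI)
    fix j assume "j < dim_vec (V *\<^sub>v \<kappa>)"
    then show "tail (V *\<^sub>v \<kappa>) $ j = (V *\<^sub>v \<kappa>) $ j"
      using kernel_iff[OF \<kappa>] assms V by (simp add: tail_def del: index_mult_mat_vec)
  qed (use V in \<open>simp add: tail_def\<close>)
  then show ?thesis using P_V[OF \<kappa>] by simp
qed

text \<open>On the kernel \<open>\<omega>\<close> is symmetric but may differ from 1. For the zero
  matrix the commutation condition asks only for symmetry, so L_q[0] on \<open>d\<close> generators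
  is isomorphic both to \<open>TK\<close> and to the untwisted group algebra.\<close>

lemma Z_laurent: "Z \<cong>\<^sub>a\<^sub>l\<^sub>g laurent_algebra d"
proof -
  define pad :: "int vec \<Rightarrow> int vec" where
    "pad \<gamma> = Matrix.vec n (\<lambda>j. if j < 2 * N then 0 else \<gamma> $ (j - 2 * N))" for \<gamma>
  define unpad :: "int vec \<Rightarrow> int vec" where
    "unpad \<beta> = Matrix.vec d (\<lambda>j. \<beta> $ (j + 2 * N))" for \<beta>
  have pad_tail: "pad (unpad \<beta>) = tail \<beta>" for \<beta>
    by (intro eq_vecI) (auto simp: pad_def unpad_def tail_def index_bounds)
  have tail_pad: "tail (pad \<gamma>) = pad \<gamma>" for \<gamma>
    by (intro eq_vecI) (auto simp: pad_def tail_def)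
  have unpad_pad: "unpad (pad \<gamma>) = \<gamma>" if "\<gamma> \<in> carrier_vec d" for \<gamma>
    using that by (intro eq_vecI) (auto simp: pad_def unpad_def index_bounds)
  have pad_closed: "pad \<gamma> \<in> carrier_vec n" for \<gamma> by (simp add: pad_def)
  have pad_add: "pad (\<gamma> + \<delta>) = pad \<gamma> + pad \<delta>" if "\<gamma> \<in> carrier_vec d" "\<delta> \<in> carrier_vec d" for \<gamma> \<delta>
    using that by (intro eq_vecI) (auto simp: pad_def index_bounds)
  have in_K: "P *\<^sub>v pad \<gamma> \<in> K" for \<gamma>
    using P_tail_kernel[of "pad \<gamma>"] by (simp add: tail_pad)
  interpret R: quasi_laurent_realization q "0\<^sub>m d d" d "sublattice n K" \<omega> "\<lambda>\<gamma>. P *\<^sub>v pad \<gamma>"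
  proof (intro quasi_laurent_realization.intro quasi_laurent_realization_axioms.intro
      quasi_laurent_algebra.intro N.twisted_monoid_axioms q_nonzero)
    show "bij_betw (\<lambda>\<gamma>. P *\<^sub>v pad \<gamma>) (carrier_vec d) (carrier (sublattice n K))"
    proof (rule bij_betwI[where g = "\<lambda>\<kappa>. unpad (V *\<^sub>v \<kappa>)"])
      show "(\<lambda>\<kappa>. unpad (V *\<^sub>v \<kappa>)) \<in> carrier (sublattice n K) \<rightarrow> carrier_vec d"
        by (auto simp: unpad_def)
    qed (use in_K kernel_tail in \<open>auto simp: V_P pad_closed unpad_pad pad_tail\<close>)
    show "\<omega> (P *\<^sub>v pad (unit_vec d i)) (P *\<^sub>v pad (unit_vec d j)) =
        q powi (0\<^sub>m d d $$ (i, j)) * \<omega> (P *\<^sub>v pad (unit_vec d j)) (P *\<^sub>v pad (unit_vec d i))"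
      if "i < d" "j < d" for i j
      using that in_K cocycle_kernel[OF P_closed[OF pad_closed] in_K] by simp
  qed (auto simp: pad_add P_add pad_closed)
  interpret S: quasi_laurent_realization q "0\<^sub>m d d" d "monoid_vec TYPE(int) d" "\<lambda>_ _. 1" "\<lambda>\<gamma>. \<gamma>"
  proof (intro quasi_laurent_realization.intro quasi_laurent_realization_axioms.intro
      quasi_laurent_algebra.intro twisted_monoid_trivial q_nonzero)
    show "monoid (monoid_vec TYPE(int) d)"
      by (rule monoidI) (auto simp: assoc_add_vec[of _ d])
  qed (auto simp: bij_betw_def)
  have "\<L> q (0\<^sub>m d d) \<cong>\<^sub>a\<^sub>l\<^sub>g TK"
    using R.realization_iso by (metis alg_isoI)
  then have "TK \<cong>\<^sub>a\<^sub>l\<^sub>g \<L> q (0\<^sub>m d d)"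
    using R.L.complex_algebra_axioms by (rule alg_iso_sym)
  moreover have "\<L> q (0\<^sub>m d d) \<cong>\<^sub>a\<^sub>l\<^sub>g laurent_algebra d"
    unfolding laurent_algebra_def monoid_algebra_twisted
    using S.realization_iso by (metis alg_isoI)
  moreover have "Z \<cong>\<^sub>a\<^sub>l\<^sub>g TK"
    by (rule alg_isoI[OF Z_twisted])
  ultimately show ?thesis by (metis alg_iso_trans)
qed

section \<open>Splitting the exponent lattice into planes and the kernel\<close>

abbreviation "planes \<equiv> replicate N (monoid_vec TYPE(int) 2) @ [sublattice n K]"
abbreviation "plane_cocycles \<equiv> map (\<lambda>m. form_cocycle (q ^ m) (upper_part \<S>)) ms @ [\<omega>]"

lemma symplectic2_skew: "transpose_mat \<S> = - \<S>"
  using symplectic2_carrier by (intro eq_matI) (auto simp: less_2_cases_iff symplectic2_index)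

lemma tensor_factors_exist:
  obtains hs where "tensor_factors (map (\<lambda>m. \<L> (q ^ m) \<S>) ms @ [Z]) planes plane_cocycles hs"
proof -
  \<comment> \<open>The induction runs over a separate list \<open>ls\<close>, because
    \<open>ms\<close> is fixed by the locale.\<close>
  have "\<exists>hs. tensor_factors (map (\<lambda>m. \<L> (q ^ m) \<S>) ls @ [Z])
      (replicate (length ls) (monoid_vec TYPE(int) 2) @ [sublattice n K])
      (map (\<lambda>m. form_cocycle (q ^ m) (upper_part \<S>)) ls @ [\<omega>]) hs" for ls
  proof (induction ls)
    case Nil
    have "tensor_factors [Z] [sublattice n K] [\<omega>] [k]"
      by (intro tensor_factors.intros complex_algebra_Z N.twisted_monoid_axioms Z_twisted)
    then show ?case by auto
  next
    case (Cons m ls)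
    then obtain hs where hs: "tensor_factors (map (\<lambda>m. \<L> (q ^ m) \<S>) ls @ [Z])
      (replicate (length ls) (monoid_vec TYPE(int) 2) @ [sublattice n K])
      (map (\<lambda>m. form_cocycle (q ^ m) (upper_part \<S>)) ls @ [\<omega>]) hs" by blast
    have "q ^ m \<noteq> 0" using q_nonzero by simp
    then obtain h b where "quasi_laurent_monomials (q ^ m) \<S> 2 h b"
      using symplectic2_carrier symplectic2_skew by (rule quasi_laurent_monomials_exist)
    then interpret h: quasi_laurent_monomials "q ^ m" \<S> 2 h b .
    show ?case
      using tensor_factors.Cons[OF h.L.complex_algebra_axioms h.M.twisted_monoid_axioms h.k h.k_bij hs]
      by auto
  qed
  then show thesis using that by blast
qed

text \<open>The last entry is returned to the original coordinates, since the last monoid is the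
  kernel itself and not its coordinate lattice.\<close>

definition blocks :: "int vec \<Rightarrow> int vec list" where
  "blocks \<alpha> = map (\<lambda>i. Matrix.vec 2 (\<lambda>j. (V *\<^sub>v \<alpha>) $ (2 * i + j))) [0..<N] @ [P *\<^sub>v tail (V *\<^sub>v \<alpha>)]"

lemma length_blocks: "length (blocks \<alpha>) = Suc N"
  by (simp add: blocks_def)

lemma blocks_nth:
  "i < N \<Longrightarrow> blocks \<alpha> ! i = Matrix.vec 2 (\<lambda>j. (V *\<^sub>v \<alpha>) $ (2 * i + j))"
  "blocks \<alpha> ! N = P *\<^sub>v tail (V *\<^sub>v \<alpha>)"
  by (simp_all add: blocks_def nth_append)

lemma planes_nth: "i < N \<Longrightarrow> planes ! i = monoid_vec TYPE(int) 2" "planes ! N = sublattice n K"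
  by (simp_all add: nth_append)

lemma planes_carrierI:
  assumes "length gs = Suc N" "\<And>i. i < N \<Longrightarrow> gs ! i \<in> carrier_vec 2" "gs ! N \<in> K"
  shows "gs \<in> carrier (DirProd_list planes)"
proof (rule DirProd_list_carrier_memI)
  fix i assume "i < length planes"
  then show "gs ! i \<in> carrier (planes ! i)"
    using assms planes_nth(1)[of i] planes_nth(2) by (cases "i = N") auto
qed (use assms in simp)

lemma planes_carrierD:
  assumes "gs \<in> carrier (DirProd_list planes)"
  shows "length gs = Suc N" "\<And>i. i < N \<Longrightarrow> gs ! i \<in> carrier_vec 2" "gs ! N \<in> K"
proof -
  note gs = DirProd_list_carrier_mem[OF assms]
  show "length gs = Suc N" using gs(1) by simp
  show "gs ! i \<in> carrier_vec 2" if "i < N" for i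
    using gs(2)[of i] planes_nth(1)[OF that] that by simp
  show "gs ! N \<in> K"
    using gs(2)[of N] planes_nth(2) by simp
qed

lemma blocks_closed: "blocks \<alpha> \<in> carrier (DirProd_list planes)"
  by (rule planes_carrierI) (simp_all add: length_blocks blocks_nth P_tail_kernel)

lemma bij_blocks: "bij_betw blocks (carrier_vec n) (carrier (DirProd_list planes))"
proof -
  \<comment> \<open>The inverse reassembles new coordinates: the first 2N come from the planes, the
    others from the kernel vector after applying \<open>V\<close>.\<close>
  define glue where "glue gs = Matrix.vec n (\<lambda>j. if j < 2 * N then gs ! (j div 2) $ (j mod 2)
    else (V *\<^sub>v (gs ! N)) $ j)" for gs :: "int vec list"
  have glue_closed: "glue gs \<in> carrier_vec n" for gs by (simp add: glue_def)
  show ?thesis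
  proof (rule bij_betwI[where g = "\<lambda>gs. P *\<^sub>v glue gs"])
    show "blocks \<in> carrier_vec n \<rightarrow> carrier (DirProd_list planes)"
      using blocks_closed by blast
    show "(\<lambda>gs. P *\<^sub>v glue gs) \<in> carrier (DirProd_list planes) \<rightarrow> carrier_vec n"
      using P_closed[OF glue_closed] by blast
  next
    fix \<alpha> :: "int vec" assume \<alpha>: "\<alpha> \<in> carrier_vec n"
    have "glue (blocks \<alpha>) = V *\<^sub>v \<alpha>"
    proof (rule eq_vecI)
      fix j assume "j < dim_vec (V *\<^sub>v \<alpha>)"
      then have j: "j < n" using V by simp
      show "glue (blocks \<alpha>) $ j = (V *\<^sub>v \<alpha>) $ j"
      proof (cases "j < 2 * N")
        case True
        then have "j div 2 < N" by auto
        then show ?thesis using True j by (simp add: glue_def blocks_nth)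
      next
        case False
        then show ?thesis using j by (simp add: glue_def blocks_nth V_P tail_closed) (simp add: tail_def)
      qed
    qed (use V in \<open>simp add: glue_def\<close>)
    then show "P *\<^sub>v glue (blocks \<alpha>) = \<alpha>" using P_V[OF \<alpha>] by simp
  next
    fix gs assume gs: "gs \<in> carrier (DirProd_list planes)"
    note gsD = planes_carrierD[OF gs]
    have VP: "V *\<^sub>v (P *\<^sub>v glue gs) = glue gs" by (rule V_P[OF glue_closed])
    have \<kappa>: "gs ! N \<in> carrier_vec n" using gsD(3) K_closed(1) by auto
    show "blocks (P *\<^sub>v glue gs) = gs"
    proof (rule nth_equalityI)
      fix i assume "i < length (blocks (P *\<^sub>v glue gs))"
      then consider "i < N" | "i = N" by (force simp: length_blocks)
      then show "blocks (P *\<^sub>v glue gs) ! i = gs ! i"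
      proof cases
        case 1
        then have "2 * i + j < n" "2 * i + j < 2 * N" "(2 * i + j) div 2 = i" "(2 * i + j) mod 2 = j"
          if "j < 2" for j using that n_eq by auto
        then show ?thesis
          unfolding blocks_nth(1)[OF 1] VP using gsD(2)[OF 1] by (intro eq_vecI) (auto simp: glue_def)
      next
        case 2
        have "tail (glue gs) = tail (V *\<^sub>v (gs ! N))"
          by (intro eq_vecI) (auto simp: tail_def glue_def)
        then show ?thesis using 2 kernel_tail[OF gsD(3)] by (simp add: blocks_nth VP)
      qed
    qed (simp add: length_blocks gsD)
  qed
qed

lemma blocks_add:
  assumes "\<alpha> \<in> carrier_vec n" "\<beta> \<in> carrier_vec n"
  shows "blocks (\<alpha> + \<beta>) = blocks \<alpha> \<otimes>\<^bsub>DirProd_list planes\<^esub> blocks \<beta>"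
proof (rule nth_equalityI)
  have planes: "\<forall>G \<in> set planes. monoid G"
  proof -
    have "monoid (monoid_vec TYPE(int) 2)"
      by (rule monoidI) (auto simp: assoc_add_vec[of _ 2])
    then show ?thesis using N.monoid_axioms by auto
  qed
  show len: "length (blocks (\<alpha> + \<beta>)) = length (blocks \<alpha> \<otimes>\<^bsub>DirProd_list planes\<^esub> blocks \<beta>)"
    using DirProd_list_carrier_mem(1)[OF DirProd_list_mult_closed[OF planes blocks_closed blocks_closed]]
    by (simp add: length_blocks)
  fix i assume i: "i < length (blocks (\<alpha> + \<beta>))"
  then have nth: "(blocks \<alpha> \<otimes>\<^bsub>DirProd_list planes\<^esub> blocks \<beta>) ! i = blocks \<alpha> ! i \<otimes>\<^bsub>planes ! i\<^esub> blocks \<beta> ! i"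
    by (intro DirProd_list_mult_nth blocks_closed) (simp add: length_blocks)
  consider "i < N" | "i = N" using i by (force simp: length_blocks)
  then show "blocks (\<alpha> + \<beta>) ! i = (blocks \<alpha> \<otimes>\<^bsub>DirProd_list planes\<^esub> blocks \<beta>) ! i"
  proof cases
    case 1
    then have "2 * i + j < n" if "j < 2" for j using that n_eq by auto
    then have "Matrix.vec 2 (\<lambda>j. (V *\<^sub>v \<alpha> + V *\<^sub>v \<beta>) $ (2 * i + j)) =
      Matrix.vec 2 (\<lambda>j. (V *\<^sub>v \<alpha>) $ (2 * i + j)) + Matrix.vec 2 (\<lambda>j. (V *\<^sub>v \<beta>) $ (2 * i + j))"
      using V by (intro eq_vecI) (simp_all del: index_mult_mat_vec)
    then show ?thesis
      unfolding nth planes_nth(1)[OF 1] blocks_nth(1)[OF 1] V_add[OF assms] monoid_vec_int_simps .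
  next
    case 2
    have "tail (V *\<^sub>v \<alpha> + V *\<^sub>v \<beta>) = tail (V *\<^sub>v \<alpha>) + tail (V *\<^sub>v \<beta>)"
      using V by (intro eq_vecI) (auto simp: tail_def simp del: index_mult_mat_vec)
    then have "blocks (\<alpha> + \<beta>) ! N = blocks \<alpha> ! N + blocks \<beta> ! N"
      unfolding blocks_nth(2) V_add[OF assms] by (simp add: P_add tail_closed)
    then show ?thesis
      using nth planes_nth(2) 2 by simp
  qed
qed

text \<open>The kernel factor is symmetric and contributes nothing. Plane i contributes a power of
  \<open>q\<close> whose exponent is the i-th summand of the normal form.\<close>

lemma blocks_commutator:
  assumes "\<alpha> \<in> carrier_vec n" "\<beta> \<in> carrier_vec n"
  shows "prod_cocycle plane_cocycles (blocks \<alpha>) (blocks \<beta>) =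
    q powi (\<alpha> \<bullet> (H *\<^sub>v \<beta>)) * prod_cocycle plane_cocycles (blocks \<beta>) (blocks \<alpha>)"
proof -
  let ?f = "\<lambda>\<alpha> \<beta> i. (plane_cocycles ! i) (blocks \<alpha> ! i) (blocks \<beta> ! i)"
  let ?E = "\<lambda>i. int (ms ! i) * ((V *\<^sub>v \<alpha>) $ (2 * i) * (V *\<^sub>v \<beta>) $ (2 * i + 1)
    - (V *\<^sub>v \<alpha>) $ (2 * i + 1) * (V *\<^sub>v \<beta>) $ (2 * i))"
  have prod: "prod_cocycle plane_cocycles (blocks \<alpha>) (blocks \<beta>) = (\<Prod>i<N. ?f \<alpha> \<beta> i) * ?f \<alpha> \<beta> N" for \<alpha> \<beta>
    using prod_cocycle_nth[of "blocks \<alpha>" plane_cocycles "blocks \<beta>"] by (simp add: length_blocks)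
  have last: "?f \<alpha> \<beta> N = ?f \<beta> \<alpha> N"
    using cocycle_kernel[OF _ P_tail_kernel] P_tail_kernel K_closed(1)
    by (auto simp: nth_append blocks_nth)
  have plane: "?f \<alpha> \<beta> i = q powi (?E i) * ?f \<beta> \<alpha> i" if i: "i < N" for i
  proof -
    let ?u = "Matrix.vec 2 (\<lambda>j. (V *\<^sub>v \<alpha>) $ (2 * i + j))" and ?v = "Matrix.vec 2 (\<lambda>j. (V *\<^sub>v \<beta>) $ (2 * i + j))"
    have "q ^ (ms ! i) \<noteq> 0" using q_nonzero by simp
    then have "?f \<alpha> \<beta> i = (q ^ (ms ! i)) powi (?u \<bullet> (\<S> *\<^sub>v ?v)) * ?f \<beta> \<alpha> i"
      using i form_cocycle_commutator[OF _ symplectic2_carrier symplectic2_skew, of "q ^ (ms ! i)" ?u ?v]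
      by (simp add: nth_append blocks_nth)
    also have "(q ^ (ms ! i)) powi (?u \<bullet> (\<S> *\<^sub>v ?v)) = q powi (?E i)"
      by (simp add: symplectic2_form power_int_power)
    finally show ?thesis .
  qed
  have "(\<Prod>i<N. ?f \<alpha> \<beta> i) = q powi (\<Sum>i<N. ?E i) * (\<Prod>i<N. ?f \<beta> \<alpha> i)"
    unfolding powi_sum[OF q_nonzero, symmetric] prod.distrib[symmetric]
    by (rule prod.cong[OF refl]) (rule plane, simp)
  moreover have "(\<Sum>i<N. ?E i) = \<alpha> \<bullet> (H *\<^sub>v \<beta>)"
    unfolding form_eq[OF assms]
    using V_closed[OF assms(1)] V_closed[OF assms(2)] unfolding n_eq by (rule normal_form_form[symmetric])
  ultimately show ?thesis by (simp only: prod last mult.assoc)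
qed

theorem L_tensor: "L \<cong>\<^sub>a\<^sub>l\<^sub>g tensor_algebra (map (\<lambda>m. \<L> (q ^ m) \<S>) ms @ [Z])"
proof -
  obtain hs where hs: "tensor_factors (map (\<lambda>m. \<L> (q ^ m) \<S>) ms @ [Z]) planes plane_cocycles hs"
    by (rule tensor_factors_exist)
  let ?As = "map (\<lambda>m. \<L> (q ^ m) \<S>) ms @ [Z]"
  interpret B: quasi_laurent_realization q H n "DirProd_list planes" "prod_cocycle plane_cocycles" blocks
  proof (intro quasi_laurent_realization.intro quasi_laurent_realization_axioms.intro
      quasi_laurent_algebra_axioms tensor_factors_twisted[OF hs] bij_blocks blocks_add)
    fix i j assume "i < n" "j < n"
    then show "prod_cocycle plane_cocycles (blocks (unit_vec n i)) (blocks (unit_vec n j)) =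
      q powi (H $$ (i, j)) * prod_cocycle plane_cocycles (blocks (unit_vec n j)) (blocks (unit_vec n i))"
      using blocks_commutator[of "unit_vec n i" "unit_vec n j"] form_unit_vec[OF H_carrier] by simp
  qed
  have "L \<cong>\<^sub>a\<^sub>l\<^sub>g B.T"
    using B.realization_iso by (metis alg_isoI)
  moreover have "B.T \<cong>\<^sub>a\<^sub>l\<^sub>g tensor_algebra ?As"
    using tensor_algebra_iso(2,1)[OF hs] by (rule alg_iso_sym)
  ultimately show ?thesis by (rule alg_iso_trans)
qed

end


theorem corollary2p1:
  fixes q :: complex and H W :: "int mat" and n N :: nat and ms :: "nat list"
  assumes "q \<noteq> 0"
    and "H \<in> carrier_mat n n" and "transpose_mat H = - H"
    and "vec_space.rank n (map_mat rat_of_int H) = 2 * N"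
    and "length ms = N" and "sorted ms" and "\<forall>m \<in> set ms. 0 < m"
    and "W \<in> carrier_mat n n" and "det W = 1 \<or> det W = -1"
    and "W * H * transpose_mat W =
           diag_block_mat (map (\<lambda>m. int m \<cdot>\<^sub>m \<S>) ms @ [0\<^sub>m (n - 2 * N) (n - 2 * N)])"
  shows "let L = \<L> q H; Z = ql_kernel_algebra q H in
           ((\<forall>k > 0. q ^ k \<noteq> 1) \<or> N = 0 \<longrightarrow> Z = alg_centre L)
         \<and> L \<cong>\<^sub>a\<^sub>l\<^sub>g tensor_algebra (map (\<lambda>m. \<L> (q ^ m) \<S>) ms @ [Z])
         \<and> Z \<cong>\<^sub>a\<^sub>l\<^sub>g laurent_algebra (n - vec_space.rank n (map_mat rat_of_int H))
         \<and> inj_on (ql_monomial q H) (int_kernel H)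
         \<and> vectorspace.basis class_ring Z (ql_monomial q H ` int_kernel H)"
proof -
  obtain k c where "quasi_laurent_monomials q H n k c"
    using assms(1-3) by (rule quasi_laurent_monomials_exist)
  then interpret quasi_laurent_monomials q H n k c .
  \<comment> \<open>With this choice the congruence of the hypothesis becomes a change of
    coordinates for column vectors.\<close>
  let ?P = "transpose_mat W"
  have P: "?P \<in> carrier_mat n n" "det ?P = 1 \<or> det ?P = -1"
    using assms(8,9) by (auto simp: det_transpose)
  obtain V where V: "V \<in> carrier_mat n n" "?P * V = 1\<^sub>m n" "V * ?P = 1\<^sub>m n"
    using P by (rule unimodular_inverse)
  have normal: "transpose_mat ?P * H * ?P = normal_form ms (n - 2 * N)"
    using assms(10) by (simp add: normal_form_def)
  \<comment> \<open>Truncated subtraction in n - 2N could hide 2N > n; comparing the numbers of rows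
    excludes this.\<close>
  have "n = dim_row (transpose_mat ?P * H * ?P)"
    using assms(8) by simp
  then have n: "n = 2 * length ms + (n - 2 * N)"
    unfolding normal using carrier_matD(1)[OF normal_form_carrier[of ms "n - 2 * N"]] by (rule trans)
  interpret quasi_laurent_normal_form q H n k c ?P V ms "n - 2 * N"
    using n P(1) V normal assms(7)
    by (intro quasi_laurent_normal_form.intro quasi_laurent_normal_form_axioms.intro
        quasi_laurent_monomials_axioms)
  have "Z = alg_centre L" if "(\<forall>k > 0. q ^ k \<noteq> 1) \<or> N = 0"
  proof (rule kernel_algebra_eq_centre)
    \<comment> \<open>Without planes the condition in \<open>kernel_iff\<close> is vacuous, so every
      unit vector lies in the kernel.\<close>
    have "H = 0\<^sub>m n n" if "N = 0"
    proof (rule eq_matI)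
      fix i j assume "i < dim_row (0\<^sub>m n n :: int mat)" "j < dim_col (0\<^sub>m n n :: int mat)"
      then have ij: "i < n" "j < n" by auto
      have "unit_vec n j \<in> int_kernel H"
        using kernel_iff[of "unit_vec n j"] that assms(5) by simp
      then have "H *\<^sub>v unit_vec n j = 0\<^sub>v n"
        using assms(2) by (simp add: int_kernel_eq)
      then show "H $$ (i, j) = 0\<^sub>m n n $$ (i, j)"
        using form_unit_vec[OF assms(2) ij] ij by simp
    qed (use assms(2) in auto)
    then show "(\<forall>k > 0. q ^ k \<noteq> 1) \<or> H = 0\<^sub>m n n" using that by blast
  qed
  moreover have "inj_on (ql_monomial q H) (int_kernel H)"
    using inj_monomial K_closed(1) by (rule inj_on_subset)
  ultimately show ?thesis
    unfolding Let_def assms(4) using L_tensor Z_laurent basis_monomials by blast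
qed

end
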